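(* Let $n\ge 1$ and let $\vec\kappa=(\kappa_1,\kappa_2,\dots)$ be a vector of non-negative integers such that $1\kappa_1+2\kappa_2+3\kappa_3+\dots=n$. Let $\mathrm{Sym}_n$ be the space of real symmetric $n\times n$ matrices with the Frobenius inner product $\langle A,B\rangle=\mathrm{Tr}(A^{\mathsf T}B)$. Then the smooth semialgebraic set $$\mathrm{Sym}_{n,\vec\kappa}=\{A\in \mathrm{Sym}_n : A \text{ has exactly } \kappa_i \text{ distinct eigenvalues of multiplicity } i, \text{ for each } i\ge 1\}$$ is a minimal submanifold of the Euclidean space $(\mathrm{Sym}_n,\langle\cdot,\cdot\rangle)$.
   Context: The multiplicity of an eigenvalue $\lambda$ of $A\in\mathrm{Sym}_n$ is its multiplicity as a root of the characteristic polynomial $\det(t\,\mathrm{Id}-A)$. A (smooth, embedded, not necessarily closed) submanifold $X$ of a Riemannian manifold $(M,g)$ is called minimal if its mean curvature vector field $H$ is identically zero. Here $H$ is the trace with respect to the induced metric of the second fundamental form $b(\xi,\eta)=(\nabla_\xi\vec\eta)^\perp$ of $X$, where $\nabla$ is the Levi-Civita connection of $M$, $\vec\eta$ is a local vector field extending $\eta$ that is tangent to $X$ along $X$, and $\perp$ denotes the component normal to $X$. In a local frame $e^1,\dots,e^k$ of $TX$ with Gram matrix $G=(g(e^i,e^j))$, $H=\sum_{i,j}(G^{-1})_{ij}\,b(e^i,e^j)$. *)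

theory Defs
  imports "HOL-Analysis.Analysis" "HOL-Computational_Algebra.Polynomial"
begin

section \<open>The Euclidean space of real symmetric matrices\<close>

typedef ('n::finite) symmat = "{A :: real^'n^'n. transpose A = A}"
  morphisms mat_of_sym sym_of_mat
  by (rule exI[of _ 0]) (simp add: transpose_def zero_vec_def)

setup_lifting type_definition_symmat

lemma trace_transpose_mult_eq_inner:
  fixes A B :: "real^'n^'n"
  shows "trace (transpose A ** B) = A \<bullet> B"
proof -
  have "trace (transpose A ** B) = (\<Sum>i\<in>UNIV. \<Sum>k\<in>UNIV. A$k$i * B$k$i)"
    by (simp add: trace_def matrix_matrix_mult_def transpose_def)
  also have "\<dots> = (\<Sum>k\<in>UNIV. \<Sum>i\<in>UNIV. A$k$i * B$k$i)"
    by (rule sum.swap)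
  finally show ?thesis
    by (simp add: inner_vec_def)
qed

instantiation symmat :: (finite) real_inner
begin

lift_definition zero_symmat :: "'a symmat" is 0
  by (simp add: transpose_def zero_vec_def)

lift_definition plus_symmat :: "'a symmat \<Rightarrow> 'a symmat \<Rightarrow> 'a symmat" is "(+)"
  by (simp add: transpose_def vec_eq_iff)

lift_definition minus_symmat :: "'a symmat \<Rightarrow> 'a symmat \<Rightarrow> 'a symmat" is "(-)"
  by (simp add: transpose_def vec_eq_iff)

lift_definition uminus_symmat :: "'a symmat \<Rightarrow> 'a symmat" is uminus
  by (simp add: transpose_def vec_eq_iff)

lift_definition scaleR_symmat :: "real \<Rightarrow> 'a symmat \<Rightarrow> 'a symmat" is "(*\<^sub>R)"
  by (simp add: transpose_def vec_eq_iff)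

lift_definition inner_symmat :: "'a symmat \<Rightarrow> 'a symmat \<Rightarrow> real"
  is "\<lambda>A B. trace (transpose A ** B)" .

definition norm_symmat :: "'a symmat \<Rightarrow> real"
  where "norm_symmat A = sqrt (A \<bullet> A)"

definition sgn_symmat :: "'a symmat \<Rightarrow> 'a symmat"
  where "sgn_symmat A = scaleR (inverse (norm A)) A"

definition dist_symmat :: "'a symmat \<Rightarrow> 'a symmat \<Rightarrow> real"
  where "dist_symmat A B = norm (A - B)"

definition uniformity_symmat :: "('a symmat \<times> 'a symmat) filter"
  where [code del]: "uniformity_symmat = (INF e\<in>{0 <..}. principal {(x, y). dist x y < e})"

definition open_symmat :: "'a symmat set \<Rightarrow> bool"
  where [code del]: "open_symmat S = (\<forall>x\<in>S. \<forall>\<^sub>F (x', y) in uniformity. x' = x \<longrightarrow> y \<in> S)"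

instance
proof
  have inner_eq: "A \<bullet> B = mat_of_sym A \<bullet> mat_of_sym B" for A B :: "'a symmat"
    by (simp only: inner_symmat.rep_eq trace_transpose_mult_eq_inner)
  fix A B C :: "'a symmat" and r s :: real
  show "A + B + C = A + (B + C)" "A + B = B + A" "0 + A = A" "- A + A = 0" "A - B = A + - B"
    by (transfer; simp)+
  show "r *\<^sub>R (A + B) = r *\<^sub>R A + r *\<^sub>R B" "(r + s) *\<^sub>R A = r *\<^sub>R A + s *\<^sub>R A"
    "r *\<^sub>R s *\<^sub>R A = (r * s) *\<^sub>R A" "1 *\<^sub>R A = A"
    by (transfer; simp add: algebra_simps)+
  show "A \<bullet> B = B \<bullet> A" "(A + B) \<bullet> C = A \<bullet> C + B \<bullet> C" "(r *\<^sub>R A) \<bullet> B = r * (A \<bullet> B)"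
    "0 \<le> A \<bullet> A" "(A \<bullet> A = 0) = (A = 0)"
    unfolding inner_eq plus_symmat.rep_eq scaleR_symmat.rep_eq mat_of_sym_inject[symmetric]
      zero_symmat.rep_eq
    by (rule inner_commute, simp_all add: inner_add_left)
qed (simp_all add: norm_symmat_def sgn_symmat_def dist_symmat_def uniformity_symmat_def
      open_symmat_def)

end

lemma inner_symmat_eq: "A \<bullet> B = mat_of_sym A \<bullet> mat_of_sym B"
  by (simp only: inner_symmat.rep_eq trace_transpose_mult_eq_inner)

lemma subspace_symmetric: "subspace {A :: real^'n^'n. transpose A = A}"
  by (auto simp: subspace_def transpose_def vec_eq_iff)

lemma orthonormal_basis_symmetric:
  "\<exists>B. B \<subseteq> {A :: real^'n^'n. transpose A = A} \<and> pairwise orthogonal B \<and>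
    (\<forall>x\<in>B. norm x = 1) \<and> finite B \<and> span B = {A. transpose A = A}"
proof -
  obtain B where "B \<subseteq> {A :: real^'n^'n. transpose A = A}" "pairwise orthogonal B"
    "\<And>x. x \<in> B \<Longrightarrow> norm x = 1" "independent B"
    "card B = dim {A :: real^'n^'n. transpose A = A}" "span B = {A. transpose A = A}"
    by (rule orthonormal_basis_subspace[OF subspace_symmetric[where 'n='n]]) (rule that)
  then show ?thesis
    by (intro exI[of _ B] conjI ballI) (rule finiteI_independent | assumption)+
qed

instantiation symmat :: (finite) euclidean_space
begin

text \<open>The type class wants some fixed orthonormal basis; nothing below depends on which one.\<close>

definition Basis_symmat :: "'a symmat set"
  where "Basis_symmat = sym_of_mat ` (SOME B. B \<subseteq> {A. transpose A = A} \<and>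
    pairwise orthogonal B \<and> (\<forall>x\<in>B. norm x = 1) \<and> finite B \<and> span B = {A. transpose A = A})"

instance
proof
  define B :: "(real^'a^'a) set" where "B = (SOME B. B \<subseteq> {A. transpose A = A} \<and>
    pairwise orthogonal B \<and> (\<forall>x\<in>B. norm x = 1) \<and> finite B \<and> span B = {A. transpose A = A})"
  have B: "B \<subseteq> {A. transpose A = A}" "pairwise orthogonal B" "\<forall>x\<in>B. norm x = 1" "finite B"
    "span B = {A. transpose A = A}"
    using someI_ex[OF orthonormal_basis_symmetric[where 'n='a]] unfolding B_def[symmetric] by auto
  have Basis: "(Basis :: 'a symmat set) = sym_of_mat ` B"
    by (simp add: Basis_symmat_def B_def)
  have rep: "mat_of_sym (sym_of_mat x) = x" if "x \<in> B" for x
    using that B(1) by (auto intro: sym_of_mat_inverse)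
  show "(Basis :: 'a symmat set) \<noteq> {}"
  proof
    assume "(Basis :: 'a symmat set) = {}"
    then have "{A :: real^'a^'a. transpose A = A} = {0}"
      using B(5) by (simp add: Basis)
    moreover have "(mat 1 :: real^'a^'a) \<in> {A. transpose A = A}"
      by simp
    moreover have "(mat 1 :: real^'a^'a) \<noteq> 0"
      by (simp add: mat_def vec_eq_iff)
    ultimately show False
      by blast
  qed
  show "finite (Basis :: 'a symmat set)"
    by (simp add: Basis B(4))
  show "u \<bullet> v = (if u = v then 1 else 0)" if uv: "u \<in> Basis" "v \<in> Basis" for u v :: "'a symmat"
  proof -
    obtain x y where xy: "x \<in> B" "u = sym_of_mat x" "y \<in> B" "v = sym_of_mat y"
      using uv by (auto simp: Basis)
    then have "u = v \<longleftrightarrow> x = y"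
      by (metis rep)
    moreover have "x \<bullet> x = 1"
      using B(3) xy by (simp add: norm_eq_1)
    moreover have "x \<noteq> y \<Longrightarrow> x \<bullet> y = 0"
      using B(2) xy by (auto simp: pairwise_def orthogonal_def)
    ultimately show ?thesis
      using xy by (auto simp: inner_symmat_eq rep)
  qed
  show "(\<forall>u\<in>Basis. x \<bullet> u = 0) \<longleftrightarrow> x = 0" for x :: "'a symmat"
  proof
    assume *: "\<forall>u\<in>Basis. x \<bullet> u = 0"
    have "orthogonal (mat_of_sym x) y" if "y \<in> B" for y
      using * that by (auto simp: Basis inner_symmat_eq rep orthogonal_def)
    then have "orthogonal (mat_of_sym x) (mat_of_sym x)"
      using mat_of_sym[of x] B(5) orthogonal_to_span by blast
    then show "x = 0"
      by (metis inner_eq_zero_iff inner_symmat_eq orthogonal_def)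
  qed simp
qed

end

section \<open>Eigenvalues and their multiplicities\<close>

definition charpoly :: "real^'n^'n \<Rightarrow> real poly"
  where "charpoly A = det (mat [:0, 1:] - (\<chi> i j. [:A$i$j:]))"

definition eigenvalue :: "real^'n^'n \<Rightarrow> real \<Rightarrow> bool"
  where "eigenvalue A l \<longleftrightarrow> (\<exists>v. v \<noteq> 0 \<and> A *v v = l *s v)"

definition eigenvalue_multiplicity :: "real^'n^'n \<Rightarrow> real \<Rightarrow> nat"
  where "eigenvalue_multiplicity A l = order l (charpoly A)"

text \<open>Only \<open>\<kappa> 1, \<kappa> 2, \<dots>\<close> are meaningful; the value \<open>\<kappa> 0\<close> is ignored.\<close>

definition Sym_kappa :: "(nat \<Rightarrow> nat) \<Rightarrow> ('n::finite) symmat set"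
  where "Sym_kappa \<kappa> = {A. \<forall>i\<ge>1. card {l. eigenvalue (mat_of_sym A) l \<and>
    eigenvalue_multiplicity (mat_of_sym A) l = i} = \<kappa> i}"

section \<open>Semialgebraic sets\<close>

inductive semialgebraic :: "'a::euclidean_space set \<Rightarrow> bool" where
  eq: "real_polynomial_function f \<Longrightarrow> semialgebraic {x. f x = 0}"
| gt: "real_polynomial_function f \<Longrightarrow> semialgebraic {x. f x > 0}"
| Un: "semialgebraic S \<Longrightarrow> semialgebraic T \<Longrightarrow> semialgebraic (S \<union> T)"
| Compl: "semialgebraic S \<Longrightarrow> semialgebraic (- S)"

section \<open>Smooth maps and embedded submanifolds of a Euclidean space\<close>

text \<open>On an open set of a Euclidean space, \<open>f\<close> is of class \<open>C\<^sup>k\<^sup>+\<^sup>1\<close> iff it is differentiable and all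
  its directional derivatives are of class \<open>C\<^sup>k\<close>. These notions are only used for open sets.\<close>

fun Ck_on :: "nat \<Rightarrow> 'a::euclidean_space set \<Rightarrow> ('a \<Rightarrow> 'b::euclidean_space) \<Rightarrow> bool" where
  "Ck_on 0 S f \<longleftrightarrow> continuous_on S f"
| "Ck_on (Suc k) S f \<longleftrightarrow> (\<forall>x\<in>S. f differentiable (at x)) \<and>
     (\<forall>v. Ck_on k S (\<lambda>x. frechet_derivative f (at x) v))"

definition smooth_on :: "'a::euclidean_space set \<Rightarrow> ('a \<Rightarrow> 'b::euclidean_space) \<Rightarrow> bool"
  where "smooth_on S f \<longleftrightarrow> (\<forall>k. Ck_on k S f)"

text \<open>Slice charts: around each of its points, a diffeomorphism between open sets of the ambient
  space straightens \<open>X\<close> to a linear subspace of dimension \<open>k\<close>.\<close>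

definition embedded_submanifold :: "nat \<Rightarrow> 'a::euclidean_space set \<Rightarrow> bool"
  where "embedded_submanifold k X \<longleftrightarrow> (\<forall>p\<in>X. \<exists>U \<phi> \<psi> W.
    open U \<and> p \<in> U \<and> open (\<phi> ` U) \<and> smooth_on U \<phi> \<and> smooth_on (\<phi> ` U) \<psi> \<and>
    (\<forall>x\<in>U. \<psi> (\<phi> x) = x) \<and> subspace (W :: 'a set) \<and> dim W = k \<and>
    \<phi> ` (U \<inter> X) = \<phi> ` U \<inter> W)"

definition tangent_space :: "'a::euclidean_space set \<Rightarrow> 'a \<Rightarrow> 'a set"
  where "tangent_space X p = {v. \<exists>e>0. \<exists>c :: real \<Rightarrow> 'a. smooth_on {-e<..<e} c \<and>
    c ` {-e<..<e} \<subseteq> X \<and> c 0 = p \<and> vector_derivative c (at 0) = v}"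

section \<open>Second fundamental form and mean curvature\<close>

definition normal_component :: "'a::euclidean_space set \<Rightarrow> 'a \<Rightarrow> 'a \<Rightarrow> 'a"
  where "normal_component X p v =
    (THE w. w \<in> orthogonal_comp (tangent_space X p) \<and> v - w \<in> tangent_space X p)"

definition tangent_extension ::
    "'a::euclidean_space set \<Rightarrow> 'a \<Rightarrow> 'a \<Rightarrow> ('a \<Rightarrow> 'a) \<Rightarrow> bool"
  where "tangent_extension X p \<eta> Y \<longleftrightarrow> Y p = \<eta> \<and> (\<exists>U. open U \<and> p \<in> U \<and> smooth_on U Y \<and>
    (\<forall>q\<in>U \<inter> X. Y q \<in> tangent_space X q))"

text \<open>The Levi-Civita connection of a Euclidean space is the directional derivative of vector
  fields.\<close>

definition levi_civita :: "'a::euclidean_space \<Rightarrow> 'a \<Rightarrow> ('a \<Rightarrow> 'a) \<Rightarrow> 'a"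
  where "levi_civita p \<xi> Y = frechet_derivative Y (at p) \<xi>"

definition second_fundamental_form :: "'a::euclidean_space set \<Rightarrow> 'a \<Rightarrow> 'a \<Rightarrow> 'a \<Rightarrow> 'a"
  where "second_fundamental_form X p \<xi> \<eta> =
    normal_component X p (levi_civita p \<xi> (SOME Y. tangent_extension X p \<eta> Y))"

text \<open>The trace with respect to the induced metric is taken over an orthonormal basis of the
  tangent space, where the Gram matrix is the identity.\<close>

definition mean_curvature :: "'a::euclidean_space set \<Rightarrow> 'a \<Rightarrow> 'a"
  where "mean_curvature X p =
    (\<Sum>v\<in>(SOME B. pairwise orthogonal B \<and> (\<forall>v\<in>B. norm v = 1) \<and> span B = tangent_space X p).
      second_fundamental_form X p v v)"

definition minimal_submanifold :: "'a::euclidean_space set \<Rightarrow> bool"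
  where "minimal_submanifold X \<longleftrightarrow>
    (\<exists>k. embedded_submanifold k X) \<and> (\<forall>p\<in>X. mean_curvature X p = 0)"

end

theory Submission
  imports Defs
begin

text \<open>Write \<open>X\<close> for \<open>Sym_kappa \<kappa>\<close>. By the spectral theorem a symmetric matrix is \<open>Q diag(a) Q\<^sup>T\<close> with
\<open>Q\<close> orthogonal, and whether it lies in \<open>X\<close> depends only on the pattern of coincidences among the numbers
\<open>a i\<close>. Hence \<open>X\<close> is invariant under conjugation by orthogonal matrices, which acts on the symmetric
matrices by linear isometries.

Minimality is a consequence of this symmetry. An isometry that preserves \<open>X\<close> and fixes \<open>p \<in> X\<close> fixes the
mean curvature vector at \<open>p\<close> (\<open>mean_curvature_fixed_by_isometry\<close>). The isometries that fix
\<open>p = Q diag(a) Q\<^sup>T\<close> include conjugation, in the basis given by \<open>Q\<close>, by diagonal sign matrices and by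
permutations of indices with equal \<open>a i\<close>. A symmetric matrix fixed by all of them is \<open>Q diag(w) Q\<^sup>T\<close>, where
\<open>w i = w j\<close> whenever \<open>a i = a j\<close>; adding small multiples of it to \<open>p\<close> does not change the pattern of
coincidences, so it is tangent to \<open>X\<close> (\<open>tangent_if_fixed_by_stabiliser\<close>). The mean curvature vector is
therefore both tangent and normal, that is, zero. No second fundamental form has to be computed.

For this the mean curvature must be independent of the orthonormal basis and of the vector fields that
enter its definition. In a slice chart with inverse \<open>\<psi>\<close>, the normal part of the derivative of a
tangent vector field is the normal part of a second derivative of \<open>\<psi>\<close>
(\<open>normal_levi_civita\<close>); this is bilinear in the values of the vectors at the point, and the trace of
a bilinear map does not depend on the orthonormal basis.

A slice chart near \<open>p\<close> comes from the smooth inverse function theorem. Split a symmetric matrix, in the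
basis given by \<open>Q\<close>, into its blocks \<open>D\<close> on the eigenspaces of \<open>p\<close> and the entries outside these
blocks; divide the latter by differences of eigenvalues to get a skew-symmetric matrix \<open>S\<close>. Rotating
\<open>D\<close> by the Cayley transform of \<open>S\<close> is a map whose derivative at \<open>p\<close> is the identity. The rotated matrix
has the spectrum of \<open>D\<close>, whose blocks have eigenvalues near distinct eigenvalues of \<open>p\<close>; so it lies in
\<open>X\<close> exactly if every block of \<open>D\<close> is scalar (\<open>param_mem_iff\<close>), which is a linear condition.

Finally, \<open>X\<close> is semialgebraic because \<open>\<kappa>\<close> is determined by the numbers \<open>N k\<close> of eigenvalues, counted
with multiplicity, that have multiplicity greater than \<open>k\<close>. Let \<open>\<chi>\<close> be the characteristic polynomial
of \<open>A\<close>. Then \<open>N k\<close> is the dimension of the kernel of the sum over \<open>j \<le> k\<close> of the squares of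
\<open>\<chi>\<^sup>(\<^sup>j\<^sup>)(A)\<close>, which is the order of vanishing at 0 of a polynomial whose coefficients are polynomials in
the entries of \<open>A\<close>.\<close>

section \<open>The spectral theorem for symmetric matrices\<close>

definition diag :: "('n::finite \<Rightarrow> 'a::zero) \<Rightarrow> 'a^'n^'n"
  where "diag a = (\<chi> i j. if i = j then a i else 0)"

lemma diag_nth [simp]: "diag a $ i $ j = (if i = j then a i else 0)"
  by (simp add: diag_def)

text \<open>The form \<open>x \<bullet> A x\<close> attains a maximum \<open>m\<close> on the unit sphere of \<open>E\<close>, say at \<open>x\<close>. Then
\<open>m |y|\<^sup>2 - y \<bullet> A y\<close> is nonnegative on \<open>E\<close> and vanishes at \<open>x\<close>, so its derivative at \<open>x\<close> in the
direction \<open>r = m x - A x\<close> vanishes. That derivative is \<open>2 |r|\<^sup>2\<close>.\<close>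

lemma symmetric_maximiser_eigenvector:
  fixes A :: "real^'n^'n"
  assumes A: "transpose A = A" and E: "subspace E" and inv: "\<And>x. x \<in> E \<Longrightarrow> A *v x \<in> E"
    and ne: "E \<noteq> {0}"
  obtains x l where "x \<in> E" "norm x = 1" "A *v x = l *\<^sub>R x"
proof -
  have sym: "x \<bullet> (A *v y) = (A *v x) \<bullet> y" for x y
    by (metis A dot_lmul_matrix vector_transpose_matrix)
  obtain z where z: "z \<in> E" "z \<noteq> 0"
    using ne subspace_0[OF E] by blast
  have "compact (sphere 0 1 \<inter> E)"
    using closed_subspace[OF E] by (intro compact_Int_closed) auto
  moreover have "(1 / norm z) *\<^sub>R z \<in> sphere 0 1 \<inter> E"
    using z E by (auto simp: subspace_scale)
  moreover have "continuous_on (sphere 0 1 \<inter> E) (\<lambda>x. x \<bullet> (A *v x))"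
    by (intro continuous_on_inner continuous_on_id linear_continuous_on matrix_vector_mul_bounded_linear)
  ultimately obtain x where x: "x \<in> sphere 0 1 \<inter> E"
    and max: "\<And>y. y \<in> sphere 0 1 \<inter> E \<Longrightarrow> y \<bullet> (A *v y) \<le> x \<bullet> (A *v x)"
    using continuous_attains_sup[of "sphere 0 1 \<inter> E" "\<lambda>x. x \<bullet> (A *v x)"] by blast
  define m where "m = x \<bullet> (A *v x)"
  define q where "q y = m * (y \<bullet> y) - y \<bullet> (A *v y)" for y
  have q0: "q y \<ge> 0" if "y \<in> E" for y
  proof (cases "y = 0")
    case False
    let ?u = "(1 / norm y) *\<^sub>R y"
    have "?u \<in> sphere 0 1 \<inter> E"
      using that E False by (auto simp: subspace_scale)
    then have "?u \<bullet> (A *v ?u) \<le> m"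
      using max unfolding m_def by blast
    then have "(y \<bullet> (A *v y)) / (norm y)^2 \<le> m"
      by (simp add: matrix_vector_mult_scaleR power2_eq_square)
    then show ?thesis
      using False by (simp add: q_def field_simps power2_norm_eq_inner)
  qed (simp add: q_def)
  define r where "r = m *\<^sub>R x - A *v x"
  have rE: "r \<in> E"
    unfolding r_def using x E inv by (auto intro!: subspace_diff subspace_scale)
  have qx: "q x = 0"
    using x by (simp add: q_def m_def power2_norm_eq_inner[symmetric])
  have expand: "q (x + t *\<^sub>R r) = 2 * t * (r \<bullet> r) + t^2 * q r" for t
  proof -
    have "q (x + t *\<^sub>R r) = q x + 2 * t * (m * (x \<bullet> r) - (A *v x) \<bullet> r) + t^2 * q r"
      unfolding q_def
      by (simp add: matrix_vector_right_distrib matrix_vector_mult_scaleR inner_add_left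
          inner_add_right sym[of x r] inner_commute[of r x] inner_commute[of r "A *v x"] algebra_simps power2_eq_square)
    also have "m * (x \<bullet> r) - (A *v x) \<bullet> r = r \<bullet> r"
      by (simp add: r_def inner_diff_left)
    finally show ?thesis
      by (simp add: qx)
  qed
  have "r \<bullet> r = 0"
  proof (rule ccontr)
    assume "r \<bullet> r \<noteq> 0"
    then have pos: "r \<bullet> r > 0"
      by (simp add: less_le)
    have qr: "q r \<ge> 0" by (rule q0[OF rE])
    \<comment> \<open>This nearly minimises \<open>2 t (r \<bullet> r) + t\<^sup>2 q r\<close>; the summand 1 keeps the denominator positive.\<close>
    define t where "t = - (r \<bullet> r) / (q r + 1)"
    have "0 \<le> q (x + t *\<^sub>R r)"
      using x rE E by (intro q0) (auto intro!: subspace_add subspace_scale)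
    then have "0 \<le> t * (2 * (r \<bullet> r) + t * q r)"
      by (simp add: expand algebra_simps power2_eq_square)
    moreover have "t < 0"
      using pos qr by (simp add: t_def divide_neg_pos)
    moreover have "t * q r \<ge> - (r \<bullet> r)"
    proof -
      have "(r \<bullet> r) * (q r / (q r + 1)) \<le> (r \<bullet> r) * 1"
        using qr pos by (intro mult_left_mono) auto
      then show ?thesis by (simp add: t_def)
    qed
    ultimately show False
      using pos by (smt (verit) mult_neg_pos)
  qed
  then have "A *v x = m *\<^sub>R x"
    by (simp add: r_def)
  then show ?thesis
    using that x by auto
qed

text \<open>The orthogonal complement of a set of eigenvectors is invariant under \<open>A\<close>, hence contains a further
eigenvector.\<close>

lemma symmetric_orthonormal_eigenvectors:
  fixes A :: "real^'n^'n"
  assumes A: "transpose A = A" and k: "k \<le> CARD('n)"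
  shows "\<exists>B. card B = k \<and> finite B \<and> pairwise orthogonal B \<and>
    (\<forall>x\<in>B. norm x = 1 \<and> (\<exists>l. A *v x = l *\<^sub>R x))"
  using k
proof (induction k)
  case 0
  show ?case by (rule exI[of _ "{}"]) auto
next
  case (Suc k)
  then obtain B where B: "card B = k" "finite B" "pairwise orthogonal B"
    "\<And>x. x \<in> B \<Longrightarrow> norm x = 1" "\<And>x. x \<in> B \<Longrightarrow> \<exists>l. A *v x = l *\<^sub>R x"
    by auto
  define E where "E = {x. \<forall>b\<in>B. orthogonal x b}"
  have sE: "subspace E"
    by (auto simp: E_def subspace_def orthogonal_def inner_add_left)
  have sym: "x \<bullet> (A *v y) = (A *v x) \<bullet> y" for x y
    by (metis A dot_lmul_matrix vector_transpose_matrix)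
  have invE: "A *v x \<in> E" if "x \<in> E" for x
    unfolding E_def
  proof safe
    fix b assume b: "b \<in> B"
    then obtain l where "A *v b = l *\<^sub>R b" using B by blast
    then show "orthogonal (A *v x) b"
      using that b by (auto simp: E_def orthogonal_def sym[symmetric])
  qed
  have "dim (span B) < DIM(real^'n)"
    using dim_le_card'[OF B(2)] B(1) Suc.prems by (simp add: dim_span)
  then obtain z where z: "z \<noteq> 0" "\<And>y. y \<in> span B \<Longrightarrow> orthogonal z y"
    using orthogonal_to_subspace_exists[of B] by (auto simp: dim_span)
  then have "z \<in> E"
    by (auto simp: E_def span_base)
  with z have "E \<noteq> {0}" by auto
  from symmetric_maximiser_eigenvector[OF A sE invE this]
  obtain x l where x: "x \<in> E" "norm x = 1" "A *v x = l *\<^sub>R x" by metis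
  have "x \<notin> B"
    using x by (auto simp: E_def orthogonal_def)
  then show ?case
    using B x by (intro exI[of _ "insert x B"])
      (auto simp: pairwise_insert E_def orthogonal_commute)
qed

theorem symmetric_diagonalisation:
  fixes A :: "real^'n^'n"
  assumes A: "transpose A = A"
  obtains Q a where "orthogonal_matrix Q" "A = Q ** diag a ** transpose Q"
proof -
  obtain B where B: "card B = CARD('n)" "finite B" "pairwise orthogonal B"
    "\<And>x. x \<in> B \<Longrightarrow> norm x = 1" "\<And>x. x \<in> B \<Longrightarrow> \<exists>l. A *v x = l *\<^sub>R x"
    using symmetric_orthonormal_eigenvectors[OF A, of "CARD('n)"] by auto
  obtain f :: "'n \<Rightarrow> real^'n" where f: "bij_betw f UNIV B"
    using finite_same_card_bij[of "UNIV::'n set" B] B by auto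
  then have fB: "f j \<in> B" for j
    by (auto simp: bij_betw_def)
  obtain a where a: "A *v f j = a j *\<^sub>R f j" for j
    using B(5)[OF fB] by metis
  define Q where "Q = (\<chi> i j. f j $ i)"
  have col: "column j Q = f j" for j
    by (simp add: Q_def column_def vec_eq_iff)
  have orth: "orthogonal_matrix Q"
    unfolding orthogonal_matrix_orthonormal_columns col
    using B(3,4) fB f by (metis UNIV_I bij_betw_def inj_onD pairwiseD)
  have "A ** Q = Q ** diag a"
  proof -
    have "(A ** Q) $ i $ j = (Q ** diag a) $ i $ j" for i j
    proof -
      have "(A ** Q) $ i $ j = (A *v f j) $ i"
        by (simp add: matrix_matrix_mult_def matrix_vector_mult_def Q_def)
      also have "\<dots> = (Q ** diag a) $ i $ j"
        by (simp add: a matrix_matrix_mult_def Q_def diag_def if_distrib sum.delta cong: if_cong)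
      finally show ?thesis .
    qed
    then show ?thesis by (simp add: vec_eq_iff)
  qed
  then have "A = Q ** diag a ** transpose Q"
    using orth by (metis matrix_mul_assoc matrix_mul_rid orthogonal_matrix_def)
  with orth show ?thesis by (rule that)
qed

section \<open>Eigenvalues and their multiplicities\<close>

lemma diag_times: "diag (a :: 'n::finite \<Rightarrow> 'a::semiring_1) ** diag b = diag (\<lambda>i. a i * b i)"
  by (simp add: vec_eq_iff matrix_matrix_mult_def if_distrib[of "\<lambda>x. x * _"] if_distrib[of "\<lambda>x. _ * x"] sum.delta cong: if_cong)

lemma diag_1: "diag (\<lambda>_. 1) = mat 1"
  by (simp add: vec_eq_iff mat_def)

text \<open>Brings \<open>A\<close> into the ring over which the characteristic polynomial is a determinant, so that the
multiplicativity of determinants applies.\<close>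

definition const_matrix :: "real^'n^'m \<Rightarrow> real poly^'n^'m"
  where "const_matrix A = (\<chi> i j. [:A $ i $ j:])"

lemma const_poly_sum: "[:sum f S:] = (\<Sum>i\<in>S. [:f i:])"
proof (induction S rule: infinite_finite_induct)
  case (insert x S)
  have "[:f x + sum f S:] = [:f x:] + [:sum f S:]"
    by simp
  with insert show ?case
    by simp
qed auto

lemma const_matrix_mult: "const_matrix (A ** B) = const_matrix A ** const_matrix B"
  by (simp add: const_matrix_def matrix_matrix_mult_def vec_eq_iff const_poly_sum mult.commute)

lemma const_matrix_1: "const_matrix (mat 1) = mat 1"
  by (simp add: const_matrix_def mat_def vec_eq_iff)

lemma mat_commute: "mat c ** A = A ** mat (c::'a::comm_semiring_1)"
  by (simp add: vec_eq_iff matrix_matrix_mult_def mat_def mult.commute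
      if_distrib[of "\<lambda>x. x * _"] if_distrib[of "\<lambda>x. _ * x"] sum.delta sum.delta' cong: if_cong)

lemma charpoly_eq: "charpoly A = det (mat [:0, 1:] - const_matrix A)"
  by (simp add: charpoly_def const_matrix_def)

text \<open>Over the polynomial ring \<open>Q\<close> remains orthogonal, and the scalar matrix with the indeterminate on the
diagonal commutes with it.\<close>

lemma charpoly_conj:
  assumes Q: "orthogonal_matrix Q"
  shows "charpoly (Q ** M ** transpose Q) = charpoly M"
proof -
  let ?P = "const_matrix Q" and ?R = "const_matrix (transpose Q)" and ?X = "mat [:0, 1:]"
  have PR: "?P ** ?R = mat 1"
    using Q by (simp add: orthogonal_matrix_def flip: const_matrix_mult) (simp add: const_matrix_1)
  have sub: "A ** (B - C) = A ** B - A ** C" "(B - C) ** A = B ** A - C ** A"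
    for A B C :: "real poly^'n^'n"
    by (simp_all add: vec_eq_iff matrix_matrix_mult_def sum_subtractf algebra_simps)
  have "?P ** ?X ** ?R = ?X"
    by (metis PR mat_commute matrix_mul_assoc matrix_mul_rid)
  then have "?X - const_matrix (Q ** M ** transpose Q) = ?P ** (?X - const_matrix M) ** ?R"
    by (simp add: const_matrix_mult sub)
  then have "charpoly (Q ** M ** transpose Q) = det ?P * charpoly M * det ?R"
    by (simp add: charpoly_eq det_mul)
  also have "\<dots> = det (?P ** ?R) * charpoly M"
    by (simp add: det_mul mult_ac)
  finally show ?thesis
    by (simp add: PR)
qed

lemma charpoly_diag: "charpoly (diag a) = (\<Prod>i\<in>UNIV. [:- a i, 1:])"
  unfolding charpoly_eq by (subst det_diagonal) (auto simp: const_matrix_def mat_def)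

lemma order_prod_linear:
  assumes "finite S"
  shows "order l (\<Prod>i\<in>S. [:- a i, 1 :: 'a::idom:]) = card {i\<in>S. a i = l}"
  using assms
proof (induction S)
  case (insert x S)
  have nz: "(\<Prod>i\<in>T. [:- a i, 1:]) \<noteq> 0" if "finite T" for T
    using that by simp
  have "order l [:- a x, 1:] = (if a x = l then 1 else 0)"
    using order_power_n_n[of l 1] by (auto intro!: order_0I)
  moreover have "{i \<in> insert x S. a i = l} = (if a x = l then insert x {i\<in>S. a i = l} else {i\<in>S. a i = l})"
    by auto
  moreover have "order l (\<Prod>i\<in>insert x S. [:- a i, 1:]) = order l [:- a x, 1:] + order l (\<Prod>i\<in>S. [:- a i, 1:])"
    using insert.hyps nz[of "insert x S"] by (simp add: order_mult del: mult_pCons_left)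
  ultimately show ?case
    using insert by simp
qed simp

lemma orthogonal_conj_cancel:
  assumes "orthogonal_matrix Q"
  shows "transpose Q ** (Q ** M ** transpose Q) ** Q = M"
  by (metis assms matrix_mul_assoc matrix_mul_lid matrix_mul_rid orthogonal_matrix_def)

lemma eigenvalue_conj_diag:
  assumes Q: "orthogonal_matrix Q"
  shows "eigenvalue (Q ** diag a ** transpose Q) l \<longleftrightarrow> l \<in> range a"
proof
  have diagv: "diag a *v u = (\<chi> i. a i * u $ i)" for u
    by (simp add: vec_eq_iff matrix_vector_mult_def if_distrib[of "\<lambda>x. x * _"] sum.delta cong: if_cong)
  have QQ: "transpose Q *v (Q *v u) = u" "Q *v (transpose Q *v u) = u" for u
    using Q by (simp_all only: matrix_vector_mul_assoc orthogonal_matrix_def matrix_vector_mul_lid)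
  {
    assume "eigenvalue (Q ** diag a ** transpose Q) l"
    then obtain v where v: "v \<noteq> 0" "Q *v (diag a *v (transpose Q *v v)) = l *s v"
      by (auto simp: eigenvalue_def matrix_vector_mul_assoc matrix_mul_assoc simp del: transpose_matrix_vector)
    define u where "u = transpose Q *v v"
    have "u \<noteq> 0"
      using v(1) QQ(2)[of v] by (auto simp: u_def)
    then obtain i where i: "u $ i \<noteq> 0"
      by (auto simp: vec_eq_iff)
    have "diag a *v u = l *s u"
      using arg_cong[OF v(2), of "\<lambda>x. transpose Q *v x"]
      by (simp only: QQ vector_scalar_commute u_def)
    then have "a i * u $ i = l * u $ i"
      unfolding diagv by (simp add: vec_eq_iff)
    with i show "l \<in> range a" by auto
  }
  assume "l \<in> range a"
  then obtain i where i: "l = a i" by auto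
  have "(Q ** diag a ** transpose Q) *v (Q *v axis i 1) = l *s (Q *v axis i 1)"
  proof -
    have "diag a *v axis i 1 = l *s axis i 1"
      unfolding diagv by (simp add: vec_eq_iff axis_def i)
    then show ?thesis
      by (metis QQ(1) matrix_vector_mul_assoc vector_scalar_commute)
  qed
  moreover have "Q *v axis i 1 \<noteq> 0"
    using QQ(1)[of "axis i 1"] by (auto simp del: transpose_matrix_vector)
  ultimately show "eigenvalue (Q ** diag a ** transpose Q) l"
    unfolding eigenvalue_def by blast
qed

lemma eigenvalue_multiplicity_conj_diag:
  assumes Q: "orthogonal_matrix Q"
  shows "eigenvalue_multiplicity (Q ** diag a ** transpose Q) l = card {i. a i = l}"
  by (simp add: eigenvalue_multiplicity_def charpoly_conj[OF Q] charpoly_diag order_prod_linear)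

text \<open>The function \<open>a\<close> lists the eigenvalues of a symmetric matrix, each as often as its multiplicity.\<close>

definition number_of_multiplicity :: "('n::finite \<Rightarrow> 'b) \<Rightarrow> nat \<Rightarrow> nat"
  where "number_of_multiplicity a i = card {l\<in>range a. card {j. a j = l} = i}"

lemma number_of_multiplicity_0: "number_of_multiplicity a 0 = 0"
proof -
  have "{l \<in> range a. card {j. a j = l} = 0} = {}" by auto
  then show ?thesis by (simp add: number_of_multiplicity_def)
qed

lemma number_of_multiplicity_large:
  fixes a :: "'n::finite \<Rightarrow> 'b"
  assumes "k > CARD('n)"
  shows "number_of_multiplicity a k = 0"
proof -
  have "card {j. a j = l} < k" for l
    using assms by (meson UNIV_I card_mono finite le_less_trans subsetI)
  then have "{l \<in> range a. card {j. a j = l} = k} = {}" by force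
  then show ?thesis by (simp add: number_of_multiplicity_def)
qed

lemma bij_betw_matching_fibres:
  assumes fin: "finite A" "finite B"
    and card: "\<And>c. card {x\<in>A. f x = c} = card {y\<in>B. g y = c}"
  shows "\<exists>h. bij_betw h A B \<and> (\<forall>x\<in>A. g (h x) = f x)"
proof -
  have "\<exists>h. bij_betw h {x\<in>A. f x = c} {y\<in>B. g y = c}" for c
    using card[of c] fin by (intro finite_same_card_bij) auto
  then obtain H where H: "\<And>c. bij_betw (H c) {x\<in>A. f x = c} {y\<in>B. g y = c}" by metis
  define h where "h x = H (f x) x" for x
  have h: "h x \<in> B" "g (h x) = f x" if "x \<in> A" for x
    using bij_betwE[OF H[of "f x"]] that by (auto simp: h_def)
  have "bij_betw h A B"
  proof (rule bij_betwI')
    fix x y assume xy: "x \<in> A" "y \<in> A"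
    show "h x = h y \<longleftrightarrow> x = y"
    proof
      assume eq: "h x = h y"
      then have "f x = f y" using h xy by metis
      then show "x = y"
        using eq xy bij_betw_imp_inj_on[OF H[of "f y"]] by (auto simp: h_def inj_on_def)
    qed simp
  next
    fix y assume y: "y \<in> B"
    then obtain x where "x \<in> A" "f x = g y" "H (g y) x = y"
      using bij_betw_imp_surj_on[OF H[of "g y"]] by (force simp: set_eq_iff image_iff)
    then show "\<exists>x\<in>A. y = h x" by (auto simp: h_def intro!: bexI[of _ x])
  qed (rule h)
  then show ?thesis using h(2) by blast
qed

lemma number_of_multiplicity_reindex:
  assumes \<pi>: "bij \<pi>" and \<beta>: "inj_on \<beta> (range a)" and b: "\<And>i. b (\<pi> i) = \<beta> (a i)"
  shows "number_of_multiplicity b = number_of_multiplicity a"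
proof
  fix i
  have range: "range b = \<beta> ` range a"
  proof -
    have "range b = b ` range \<pi>" using \<pi> by (simp add: bij_is_surj)
    then show ?thesis using b by (simp add: image_image)
  qed
  have card: "card {j. b j = \<beta> l} = card {j. a j = l}" if "l \<in> range a" for l
  proof -
    have "{j. b j = \<beta> l} = \<pi> ` {j. a j = l}"
    proof
      show "{j. b j = \<beta> l} \<subseteq> \<pi> ` {j. a j = l}"
      proof
        fix j assume "j \<in> {j. b j = \<beta> l}"
        moreover obtain k where "j = \<pi> k" using \<pi> by (metis bij_pointE)
        ultimately show "j \<in> \<pi> ` {j. a j = l}"
          using b \<beta> that by (auto simp: inj_on_def)
      qed
    qed (use b in auto)
    then show ?thesis
      using \<pi> by (simp add: card_image bij_is_inj inj_on_subset[of _ UNIV])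
  qed
  have "{l \<in> range b. card {j. b j = l} = i} = \<beta> ` {l \<in> range a. card {j. a j = l} = i}"
    using card by (auto simp: range)
  then show "number_of_multiplicity b i = number_of_multiplicity a i"
    unfolding number_of_multiplicity_def using inj_on_subset[OF \<beta>] by (auto intro!: card_image)
qed

lemma number_of_multiplicity_same_pattern:
  assumes "\<And>i j. a i = a j \<longleftrightarrow> b i = b j"
  shows "number_of_multiplicity b = number_of_multiplicity a"
proof (rule number_of_multiplicity_reindex[of id "\<lambda>l. b (SOME i. a i = l)"])
  have eq: "b (SOME k. a k = a i) = b i" for i
    using assms someI[of "\<lambda>k. a k = a i" i] by blast
  then show "b (id i) = b (SOME k. a k = a i)" for i by simp
  show "inj_on (\<lambda>l. b (SOME i. a i = l)) (range a)"
  proof (rule inj_onI, elim rangeE)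
    fix l l' i j
    assume "b (SOME i. a i = l) = b (SOME i. a i = l')" "l = a i" "l' = a j"
    then have "b i = b j" by (simp add: eq)
    then show "l = l'" using assms \<open>l = a i\<close> \<open>l' = a j\<close> by blast
  qed
qed simp

text \<open>Equal numbers of values of each multiplicity give, first, a multiplicity-preserving bijection between
the two sets of values, and then a bijection of the indices above it.\<close>

lemma number_of_multiplicity_eqE:
  fixes a :: "'n::finite \<Rightarrow> 'b" and b :: "'n \<Rightarrow> 'c"
  assumes "number_of_multiplicity a = number_of_multiplicity b"
  obtains \<pi> where "bij \<pi>" "\<And>i j. a i = a j \<longleftrightarrow> b (\<pi> i) = b (\<pi> j)"
proof -
  have "card {l\<in>range a. card {j. a j = l} = c} = card {l\<in>range b. card {j. b j = l} = c}" for c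
    using fun_cong[OF assms, of c] by (simp only: number_of_multiplicity_def)
  from bij_betw_matching_fibres[OF _ _ this]
  obtain \<beta> where \<beta>: "bij_betw \<beta> (range a) (range b)"
    "\<And>l. l \<in> range a \<Longrightarrow> card {j. b j = \<beta> l} = card {j. a j = l}"
    by auto
  have "card {x\<in>UNIV. \<beta> (a x) = c} = card {y\<in>UNIV. b y = c}" for c
  proof (cases "c \<in> range b")
    case True
    then obtain l where l: "l \<in> range a" "c = \<beta> l" using \<beta>(1) by (auto simp: bij_betw_def)
    then have "{x. \<beta> (a x) = c} = {x. a x = l}"
      using bij_betw_imp_inj_on[OF \<beta>(1)] by (auto simp: inj_on_def)
    then show ?thesis using \<beta>(2)[OF l(1)] l by simp
  next
    case False
    then have "{x. \<beta> (a x) = c} = {}" "{y. b y = c} = {}" using bij_betwE[OF \<beta>(1)] by blast+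
    then show ?thesis by simp
  qed
  from bij_betw_matching_fibres[OF finite finite this]
  obtain \<pi> where \<pi>: "bij_betw \<pi> UNIV UNIV" "\<And>x. b (\<pi> x) = \<beta> (a x)"
    by auto
  show ?thesis
  proof (rule that[OF \<pi>(1)])
    show "a i = a j \<longleftrightarrow> b (\<pi> i) = b (\<pi> j)" for i j
      using bij_betw_imp_inj_on[OF \<beta>(1)] by (auto simp: \<pi>(2) inj_on_def)
  qed
qed

lemma Sym_kappa_iff:
  assumes Q: "orthogonal_matrix Q" and A: "mat_of_sym A = Q ** diag a ** transpose Q"
  shows "A \<in> Sym_kappa \<kappa> \<longleftrightarrow> (\<forall>i\<ge>1. number_of_multiplicity a i = \<kappa> i)"
  by (simp add: number_of_multiplicity_def Sym_kappa_def A eigenvalue_conj_diag[OF Q] eigenvalue_multiplicity_conj_diag[OF Q])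

lemma Sym_kappa_number_of_multiplicity_eq:
  assumes "orthogonal_matrix Q" "mat_of_sym A = Q ** diag a ** transpose Q" "A \<in> Sym_kappa \<kappa>"
    and "orthogonal_matrix R" "mat_of_sym B = R ** diag b ** transpose R" "B \<in> Sym_kappa \<kappa>"
  shows "number_of_multiplicity a = number_of_multiplicity b"
proof
  fix i
  show "number_of_multiplicity a i = number_of_multiplicity b i"
    using assms Sym_kappa_iff[OF assms(1,2)]
      Sym_kappa_iff[OF assms(4,5)]
    by (cases "i = 0") (auto simp: number_of_multiplicity_0)
qed

lemma symmat_diagonalisation:
  obtains Q a where "orthogonal_matrix Q" "mat_of_sym A = Q ** diag a ** transpose Q"
proof -
  have "transpose (mat_of_sym A) = mat_of_sym A"
    using mat_of_sym[of A] by simp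
  then show ?thesis
    by (rule symmetric_diagonalisation) (rule that)
qed

section \<open>Semialgebraicity\<close>

lemma semialgebraic_neq: "real_polynomial_function f \<Longrightarrow> semialgebraic {x. f x \<noteq> 0}"
  using semialgebraic.Compl[OF semialgebraic.eq] by (simp add: Compl_eq)

lemma semialgebraic_Int:
  assumes "semialgebraic S" "semialgebraic T" shows "semialgebraic (S \<inter> T)"
proof -
  have "S \<inter> T = - (- S \<union> - T)" by auto
  then show ?thesis using assms by (metis semialgebraic.Compl semialgebraic.Un)
qed

lemma semialgebraic_UNIV: "semialgebraic UNIV"
  using semialgebraic.eq[OF real_polynomial_function.intros(2)[of 0]] by simp

lemma semialgebraic_empty: "semialgebraic {}"
  using semialgebraic.Compl[OF semialgebraic_UNIV] by simp

lemma semialgebraic_INT: "finite I \<Longrightarrow> (\<And>i. i \<in> I \<Longrightarrow> semialgebraic (S i)) \<Longrightarrow> semialgebraic (\<Inter>i\<in>I. S i)"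
  by (induction I rule: finite_induct) (auto intro: semialgebraic_Int semialgebraic_UNIV)

lemma semialgebraic_UN: "finite I \<Longrightarrow> (\<And>i. i \<in> I \<Longrightarrow> semialgebraic (S i)) \<Longrightarrow> semialgebraic (\<Union>i\<in>I. S i)"
  by (induction I rule: finite_induct) (auto intro: semialgebraic.Un semialgebraic_empty)

text \<open>This turns a statement about the order of vanishing at 0 into polynomial conditions on the coefficients.\<close>

lemma order_0_eq_iff:
  fixes p :: "'a::idom poly"
  assumes "p \<noteq> 0"
  shows "order 0 p = m \<longleftrightarrow> (\<forall>i<m. coeff p i = 0) \<and> coeff p m \<noteq> 0"
proof -
  have le: "n \<le> order 0 p \<longleftrightarrow> (\<forall>k<n. coeff p k = 0)" for n
    using monom_1_dvd_iff[OF assms] monom_1_dvd_iff' by blast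
  show ?thesis
    using le[of m] le[of "Suc m"] by (auto simp: less_Suc_eq)
qed

definition polynomial_coeffs :: "('a::real_normed_vector \<Rightarrow> real poly) \<Rightarrow> bool"
  where "polynomial_coeffs f \<longleftrightarrow> (\<forall>m. real_polynomial_function (\<lambda>x. coeff (f x) m))"

lemma polynomial_coeffs_add: "polynomial_coeffs f \<Longrightarrow> polynomial_coeffs g \<Longrightarrow> polynomial_coeffs (\<lambda>x. f x + g x)"
  by (auto simp: polynomial_coeffs_def)

lemma polynomial_coeffs_diff: "polynomial_coeffs f \<Longrightarrow> polynomial_coeffs g \<Longrightarrow> polynomial_coeffs (\<lambda>x. f x - g x)"
  by (auto simp: polynomial_coeffs_def)

lemma polynomial_coeffs_mult: "polynomial_coeffs f \<Longrightarrow> polynomial_coeffs g \<Longrightarrow> polynomial_coeffs (\<lambda>x. f x * g x)"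
  by (auto simp: polynomial_coeffs_def coeff_mult intro!: real_polynomial_function_sum real_polynomial_function.intros(4))

lemma polynomial_coeffs_const: "polynomial_coeffs (\<lambda>x. c)"
  by (auto simp: polynomial_coeffs_def)

lemma polynomial_coeffs_constant_poly: "real_polynomial_function f \<Longrightarrow> polynomial_coeffs (\<lambda>x. [:f x:])"
  unfolding polynomial_coeffs_def
proof
  fix m assume "real_polynomial_function f"
  then show "real_polynomial_function (\<lambda>x. coeff [:f x:] m)"
    by (cases m) auto
qed

lemma polynomial_coeffs_sum: "(\<And>i. i \<in> I \<Longrightarrow> polynomial_coeffs (f i)) \<Longrightarrow> polynomial_coeffs (\<lambda>x. \<Sum>i\<in>I. f i x)"
  by (induction I rule: infinite_finite_induct) (auto intro: polynomial_coeffs_const polynomial_coeffs_add)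

lemma polynomial_coeffs_prod: "(\<And>i. i \<in> I \<Longrightarrow> polynomial_coeffs (f i)) \<Longrightarrow> polynomial_coeffs (\<lambda>x. \<Prod>i\<in>I. f i x)"
  by (induction I rule: infinite_finite_induct) (auto intro: polynomial_coeffs_const polynomial_coeffs_mult)

lemma polynomial_coeffs_pderiv: "polynomial_coeffs f \<Longrightarrow> polynomial_coeffs (\<lambda>x. pderiv (f x))"
  by (auto simp: polynomial_coeffs_def coeff_pderiv)

lemma polynomial_coeffs_pderiv_funpow: "polynomial_coeffs f \<Longrightarrow> polynomial_coeffs (\<lambda>x. (pderiv ^^ k) (f x))"
  by (induction k) (auto intro: polynomial_coeffs_pderiv)

definition polynomial_entries :: "('a::real_normed_vector \<Rightarrow> real^'m^'n) \<Rightarrow> bool"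
  where "polynomial_entries F \<longleftrightarrow> (\<forall>i j. real_polynomial_function (\<lambda>x. F x $ i $ j))"

lemma polynomial_entries_const: "polynomial_entries (\<lambda>x. C)"
  by (auto simp: polynomial_entries_def)

lemma polynomial_entries_mult: "polynomial_entries F \<Longrightarrow> polynomial_entries G \<Longrightarrow> polynomial_entries (\<lambda>x. F x ** G x)"
  by (auto simp: polynomial_entries_def matrix_matrix_mult_def intro!: real_polynomial_function_sum real_polynomial_function.intros(4))

lemma polynomial_entries_add: "polynomial_entries F \<Longrightarrow> polynomial_entries G \<Longrightarrow> polynomial_entries (\<lambda>x. F x + G x)"
  by (auto simp: polynomial_entries_def)

lemma polynomial_entries_scaleR: "real_polynomial_function f \<Longrightarrow> polynomial_entries G \<Longrightarrow> polynomial_entries (\<lambda>x. f x *\<^sub>R G x)"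
  by (auto simp: polynomial_entries_def)

lemma polynomial_entries_sum: "(\<And>i. i \<in> I \<Longrightarrow> polynomial_entries (F i)) \<Longrightarrow> polynomial_entries (\<lambda>x. \<Sum>i\<in>I. F i x)"
  by (induction I rule: infinite_finite_induct) (auto intro: polynomial_entries_const polynomial_entries_add)

lemma charpoly_polynomial_coeffs:
  assumes "polynomial_entries F"
  shows "polynomial_coeffs (\<lambda>x. charpoly (F x))"
  unfolding charpoly_eq det_def
proof (intro polynomial_coeffs_sum polynomial_coeffs_mult polynomial_coeffs_const polynomial_coeffs_prod)
  fix p and i :: 'b
  have "polynomial_coeffs (\<lambda>x. mat [:0, 1:] $ i $ p i - [:F x $ i $ p i:])"
    using assms unfolding polynomial_entries_def
    by (intro polynomial_coeffs_diff polynomial_coeffs_const polynomial_coeffs_constant_poly) auto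
  then show "polynomial_coeffs (\<lambda>x. (mat [:0, 1:] - const_matrix (F x)) $ i $ p i)"
    by (simp add: const_matrix_def)
qed

lemma bounded_linear_mat_of_sym: "bounded_linear mat_of_sym"
proof (rule linear_conv_bounded_linear[THEN iffD1], rule linearI)
qed (simp_all add: plus_symmat.rep_eq scaleR_symmat.rep_eq)

lemma polynomial_entries_mat_of_sym: "polynomial_entries mat_of_sym"
  unfolding polynomial_entries_def
  by (intro allI real_polynomial_function.intros(1)
      bounded_linear_compose[OF bounded_linear_vec_nth]
      bounded_linear_compose[OF bounded_linear_vec_nth bounded_linear_mat_of_sym])

definition matrix_power :: "'a::semiring_1^'n^'n \<Rightarrow> nat \<Rightarrow> 'a^'n^'n"
  where "matrix_power A m = (((**) A) ^^ m) (mat 1)"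

text \<open>A fixed number of terms, so that the entries are visibly polynomial in \<open>A\<close> and the coefficients of \<open>p\<close>;
it suffices for the characteristic polynomial and its derivatives.\<close>

definition matrix_poly :: "real poly \<Rightarrow> real^'n^'n \<Rightarrow> real^'n^'n"
  where "matrix_poly p A = (\<Sum>m\<le>CARD('n). coeff p m *\<^sub>R matrix_power A m)"

lemma conj_mult:
  assumes "orthogonal_matrix Q"
  shows "(Q ** A ** transpose Q) ** (Q ** B ** transpose Q) = Q ** (A ** B) ** transpose Q"
  by (metis assms matrix_mul_assoc matrix_mul_rid orthogonal_matrix_def)

lemma matrix_add_rdistrib: "(A + B) ** C = A ** C + B ** (C :: 'a::semiring_1^'n^'m)"
  by (simp add: vec_eq_iff matrix_matrix_mult_def sum.distrib distrib_right)

lemma conj_sum: "(\<Sum>i\<in>I. Q ** F i ** R) = Q ** (\<Sum>i\<in>I. F i :: real^'n^'n) ** R"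
  by (induction I rule: infinite_finite_induct) (auto simp: matrix_add_ldistrib matrix_add_rdistrib)

lemma diag_sum: "(\<Sum>i\<in>I. diag (f i)) = (diag (\<lambda>j. \<Sum>i\<in>I. f i j) :: real^'n^'n)"
  by (induction I rule: infinite_finite_induct) (auto simp: vec_eq_iff)

lemma matrix_power_conj_diag:
  assumes Q: "orthogonal_matrix Q"
  shows "matrix_power (Q ** diag a ** transpose Q) m = Q ** diag (\<lambda>i. a i ^ m) ** transpose Q"
proof (induction m)
  case 0
  then show ?case
    using Q by (simp add: matrix_power_def diag_1 orthogonal_matrix_def)
next
  case (Suc m)
  then show ?case
    by (simp add: matrix_power_def conj_mult[OF Q] diag_times)
qed

lemma matrix_poly_conj_diag:
  fixes Q :: "real^'n^'n"
  assumes Q: "orthogonal_matrix Q" and p: "degree p \<le> CARD('n)"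
  shows "matrix_poly p (Q ** diag a ** transpose Q) = Q ** diag (\<lambda>i. poly p (a i)) ** transpose Q"
proof -
  have "poly p x = (\<Sum>m\<le>CARD('n). coeff p m * x ^ m)" for x
    using poly_as_sum_of_monoms'[OF p] by (metis (no_types, lifting) poly_monom poly_sum sum.cong)
  moreover have "coeff p m *\<^sub>R (Q ** diag (\<lambda>i. a i ^ m) ** transpose Q)
     = Q ** diag (\<lambda>i. coeff p m * a i ^ m) ** transpose Q" for m
  proof -
    have "diag (\<lambda>i. coeff p m * a i ^ m) = coeff p m *\<^sub>R diag (\<lambda>i. a i ^ m)"
      by (simp add: vec_eq_iff)
    then show ?thesis
      by (simp add: matrix_scalar_ac scalar_matrix_assoc)
  qed
  ultimately show ?thesis
    by (simp add: matrix_poly_def matrix_power_conj_diag[OF Q] conj_sum diag_sum)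
qed

lemma matrix_power_polynomial_entries:
  "polynomial_entries F \<Longrightarrow> polynomial_entries (\<lambda>x. matrix_power (F x) m)"
  by (induction m) (auto simp: matrix_power_def intro: polynomial_entries_const polynomial_entries_mult)

lemma matrix_poly_polynomial_entries:
  "polynomial_coeffs p \<Longrightarrow> polynomial_entries F \<Longrightarrow> polynomial_entries (\<lambda>x. matrix_poly (p x) (F x))"
  unfolding matrix_poly_def
  by (intro polynomial_entries_sum polynomial_entries_scaleR matrix_power_polynomial_entries)
    (auto simp: polynomial_coeffs_def)

lemma derivatives_vanish_iff_less_order:
  fixes p :: "'a::{idom,semiring_char_0} poly"
  assumes "p \<noteq> 0"
  shows "(\<forall>j\<le>k. poly ((pderiv ^^ j) p) x = 0) \<longleftrightarrow> k < order x p"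
  using assms
proof (induction k arbitrary: p)
  case 0
  then show ?case by (simp add: order_gt_0_iff)
next
  case (Suc k)
  have split: "(\<forall>j\<le>Suc k. poly ((pderiv ^^ j) p) x = 0) \<longleftrightarrow>
      poly p x = 0 \<and> (\<forall>j\<le>k. poly ((pderiv ^^ j) (pderiv p)) x = 0)"
  proof -
    have "(\<forall>j\<le>Suc k. P j) \<longleftrightarrow> P 0 \<and> (\<forall>j\<le>k. P (Suc j))" for P
      by (metis Suc_le_mono le0 not0_implies_Suc)
    from this[of "\<lambda>j. poly ((pderiv ^^ j) p) x = 0"] show ?thesis
      by (simp add: funpow_Suc_right del: funpow.simps)
  qed
  show ?case
  proof (cases "poly p x = 0")
    case True
    have "pderiv p \<noteq> 0"
    proof
      assume "pderiv p = 0"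
      then obtain c where "p = [:c:]"
        by (metis degree_eq_zeroE pderiv_eq_0_iff)
      with True Suc.prems show False by simp
    qed
    then show ?thesis
      using Suc.IH order_pderiv[OF Suc.prems True] True unfolding split by simp
  next
    case False
    then show ?thesis
      unfolding split by (simp add: order_0I)
  qed
qed

text \<open>On the eigenspace of a symmetric matrix \<open>A\<close> for \<open>l\<close> this matrix is the scalar \<open>\<Sum>j\<le>k. \<chi>\<^sup>(\<^sup>j\<^sup>)(l)\<^sup>2\<close>, where \<open>\<chi>\<close> is the characteristic
polynomial. The squares make it vanish only if all the derivatives vanish at \<open>l\<close>, that is, if the
multiplicity of \<open>l\<close> exceeds \<open>k\<close>; a single derivative of \<open>\<chi>\<close> may well have other zeros in the spectrum.\<close>

definition multiple_root_matrix :: "nat \<Rightarrow> real^'n^'n \<Rightarrow> real^'n^'n"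
  where "multiple_root_matrix k A =
    (\<Sum>j\<le>k. let M = matrix_poly ((pderiv ^^ j) (charpoly A)) A in M ** M)"

lemma multiple_root_matrix_polynomial_entries:
  "polynomial_entries (\<lambda>A. multiple_root_matrix k (mat_of_sym A))"
  unfolding multiple_root_matrix_def Let_def
  by (intro polynomial_entries_sum polynomial_entries_mult matrix_poly_polynomial_entries
      polynomial_coeffs_pderiv_funpow charpoly_polynomial_coeffs polynomial_entries_mat_of_sym)

lemma charpoly_multiple_root_matrix:
  fixes Q :: "real^'n^'n"
  assumes Q: "orthogonal_matrix Q" and A: "A = Q ** diag a ** transpose Q"
  shows "charpoly (multiple_root_matrix k A) \<noteq> 0"
    and "order 0 (charpoly (multiple_root_matrix k A)) = card {i. k < card {j. a j = a i}}"
proof -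
  define p where "p = charpoly A"
  have p: "p = (\<Prod>i\<in>UNIV. [:- a i, 1:])"
    by (simp add: p_def A charpoly_conj[OF Q] charpoly_diag)
  then have nz: "p \<noteq> 0" by simp
  have "degree p \<le> CARD('n)"
    using degree_prod_sum_le[of UNIV "\<lambda>i. [:- a i, 1:]"] by (simp add: p o_def)
  then have "degree ((pderiv ^^ j) p) \<le> CARD('n)" for j
    by (induction j) (auto simp: degree_pderiv)
  then have F: "multiple_root_matrix k A
      = Q ** diag (\<lambda>i. \<Sum>j\<le>k. (poly ((pderiv ^^ j) p) (a i))\<^sup>2) ** transpose Q"
    by (simp add: multiple_root_matrix_def p_def[symmetric] matrix_poly_conj_diag[OF Q, of _ a, folded A]
        Let_def conj_mult[OF Q] diag_times conj_sum diag_sum power2_eq_square)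
  show "charpoly (multiple_root_matrix k A) \<noteq> 0"
    by (simp add: F charpoly_conj[OF Q] charpoly_diag)
  have "(\<Sum>j\<le>k. (poly ((pderiv ^^ j) p) x)\<^sup>2) = 0 \<longleftrightarrow> k < card {j. a j = x}" for x
  proof -
    have "(\<Sum>j\<le>k. (poly ((pderiv ^^ j) p) x)\<^sup>2) = 0 \<longleftrightarrow> (\<forall>j\<le>k. poly ((pderiv ^^ j) p) x = 0)"
      by (subst sum_nonneg_eq_0_iff) auto
    also have "\<dots> \<longleftrightarrow> k < card {j. a j = x}"
      using derivatives_vanish_iff_less_order[OF nz] order_prod_linear[of UNIV x a] by (simp add: p)
    finally show ?thesis .
  qed
  then show "order 0 (charpoly (multiple_root_matrix k A)) = card {i. k < card {j. a j = a i}}"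
    by (simp add: F charpoly_conj[OF Q] charpoly_diag order_prod_linear)
qed

text \<open>Each value of multiplicity \<open>i\<close> is taken at \<open>i\<close> indices.\<close>

lemma card_indices_by_multiplicity:
  fixes a :: "'n::finite \<Rightarrow> 'b"
  shows "card {j. card {k. a k = a j} = i} = i * number_of_multiplicity a i"
proof -
  let ?L = "{l\<in>range a. card {j. a j = l} = i}"
  have "{j. card {k. a k = a j} = i} = (\<Union>l\<in>?L. {j. a j = l})"
    by auto
  also have "card \<dots> = (\<Sum>l\<in>?L. card {j. a j = l})"
    by (rule card_UN_disjoint) auto
  finally show ?thesis by (simp add: number_of_multiplicity_def)
qed

text \<open>With \<open>N k\<close> the number of indices whose eigenvalue has multiplicity greater than \<open>k\<close>, there are
\<open>(N (k - 1) - N k) / k\<close> eigenvalues of multiplicity \<open>k\<close>. The level sets of \<open>N k\<close> are semialgebraic, as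
\<open>N k\<close> is the order at 0 of the characteristic polynomial of \<open>multiple_root_matrix k A\<close>.\<close>

theorem semialgebraic_Sym_kappa: "semialgebraic (Sym_kappa \<kappa> :: 'n::finite symmat set)"
proof (cases "\<exists>k>CARD('n). \<kappa> k \<noteq> 0")
  case True
  then obtain k where k: "k > CARD('n)" "\<kappa> k \<noteq> 0" by blast
  have "A \<notin> Sym_kappa \<kappa>" for A :: "'n symmat"
  proof -
    obtain Q a where Q: "orthogonal_matrix Q" "mat_of_sym A = Q ** diag a ** transpose Q"
      by (rule symmat_diagonalisation)
    show ?thesis
      using k number_of_multiplicity_large[OF k(1), of a] unfolding Sym_kappa_iff[OF Q] by fastforce
  qed
  then have "(Sym_kappa \<kappa> :: 'n symmat set) = {}" by blast
  then show ?thesis by (simp add: semialgebraic_empty)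
next
  case False
  define N where "N k A = order 0 (charpoly (multiple_root_matrix k (mat_of_sym A)))"
    for k and A :: "'n symmat"
  have NA: "N k A = card {i. k < card {j. a j = a i}}" 
    if "orthogonal_matrix Q" "mat_of_sym A = Q ** diag a ** transpose Q" for k A Q a
    using charpoly_multiple_root_matrix(2)[OF that] by (simp add: N_def)
  have N_semialgebraic: "semialgebraic {A. N k A = m}" for k m
  proof -
    let ?p = "\<lambda>A :: 'n symmat. charpoly (multiple_root_matrix k (mat_of_sym A)) :: real poly"
    have "N k A = m \<longleftrightarrow> (\<forall>i<m. coeff (?p A) i = 0) \<and> coeff (?p A) m \<noteq> 0" for A :: "'n symmat"
    proof -
      obtain Q a where Q: "orthogonal_matrix Q" "mat_of_sym A = Q ** diag a ** transpose Q"
        by (rule symmat_diagonalisation)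
      show ?thesis
        unfolding N_def by (rule order_0_eq_iff[OF charpoly_multiple_root_matrix(1)[OF Q]])
    qed
    then have "{A. N k A = m} = (\<Inter>i\<in>{..<m}. {A. coeff (?p A) i = 0}) \<inter> {A. coeff (?p A) m \<noteq> 0}"
      by auto
    moreover have "polynomial_coeffs ?p"
      by (rule charpoly_polynomial_coeffs[OF multiple_root_matrix_polynomial_entries])
    then have "real_polynomial_function (\<lambda>A. coeff (?p A) i)" for i
      by (simp add: polynomial_coeffs_def)
    ultimately show ?thesis
      by (auto intro!: semialgebraic_Int semialgebraic_INT semialgebraic_neq semialgebraic.eq)
  qed
  have mem: "A \<in> Sym_kappa \<kappa> \<longleftrightarrow> (\<forall>k\<in>{1..CARD('n)}. N (k - 1) A = N k A + k * \<kappa> k)"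
    for A :: "'n symmat"
  proof -
    obtain Q a where Q: "orthogonal_matrix Q" "mat_of_sym A = Q ** diag a ** transpose Q"
      by (rule symmat_diagonalisation)
    let ?c = "number_of_multiplicity a"
    have step: "N (k - 1) A = N k A + k * ?c k" if "k \<ge> 1" for k
    proof -
      have "{i. k - 1 < card {j. a j = a i}} = {i. k < card {j. a j = a i}} \<union> {i. card {j. a j = a i} = k}"
        using that by auto
      then have "N (k - 1) A = N k A + card {i. card {j. a j = a i} = k}"
        unfolding NA[OF Q] by (subst card_Un_disjoint[symmetric]) auto
      then show ?thesis
        by (simp add: card_indices_by_multiplicity)
    qed
    have "A \<in> Sym_kappa \<kappa> \<longleftrightarrow> (\<forall>k\<ge>1. ?c k = \<kappa> k)"
      by (rule Sym_kappa_iff[OF Q])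
    also have "\<dots> \<longleftrightarrow> (\<forall>k\<in>{1..CARD('n)}. ?c k = \<kappa> k)"
      using number_of_multiplicity_large[of _ a] False by (metis atLeastAtMost_iff not_le_imp_less)
    also have "\<dots> \<longleftrightarrow> (\<forall>k\<in>{1..CARD('n)}. N (k - 1) A = N k A + k * \<kappa> k)"
      using step by (intro ball_cong) auto
    finally show ?thesis .
  qed
  have le: "N k A \<le> CARD('n)" for k A
  proof -
    obtain Q a where Q: "orthogonal_matrix Q" "mat_of_sym A = Q ** diag a ** transpose Q"
      by (rule symmat_diagonalisation)
    show ?thesis unfolding NA[OF Q] by (simp add: card_mono)
  qed
  have "(Sym_kappa \<kappa> :: 'n symmat set) = (\<Inter>k\<in>{1..CARD('n)}. \<Union>u\<in>{..CARD('n)}.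
      {A. N (k - 1) A = u + k * \<kappa> k} \<inter> {A. N k A = u})"
    using mem le by fastforce
  then show ?thesis
    by (auto intro!: semialgebraic_INT semialgebraic_UN semialgebraic_Int N_semialgebraic)
qed

section \<open>Calculus of maps of class \<open>C\<^sup>k\<close>\<close>

lemma linear_euclidean_representation:
  fixes f :: "'a::euclidean_space \<Rightarrow> 'b::real_vector"
  assumes "linear f"
  shows "f x = (\<Sum>b\<in>Basis. (x \<bullet> b) *\<^sub>R f b)"
proof -
  have "f x = f (\<Sum>b\<in>Basis. (x \<bullet> b) *\<^sub>R b)"
    by (simp add: euclidean_representation)
  also have "\<dots> = (\<Sum>b\<in>Basis. (x \<bullet> b) *\<^sub>R f b)"
    using assms by (simp add: linear_sum linear_scale)
  finally show ?thesis .
qed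

lemma Ck_on_cong:
  fixes f g :: "'a::euclidean_space \<Rightarrow> 'b::euclidean_space"
  assumes S: "open S" and eq: "\<And>x. x \<in> S \<Longrightarrow> f x = g x" and f: "Ck_on k S f"
  shows "Ck_on k S g"
  using eq f
proof (induction k arbitrary: f g)
  case 0
  then show ?case by (auto cong: continuous_on_cong)
next
  case (Suc k)
  have D: "(g has_derivative frechet_derivative f (at x)) (at x)" if "x \<in> S" for x
  proof (rule has_derivative_transform_within_open[OF _ S that])
    show "(f has_derivative frechet_derivative f (at x)) (at x)"
      using Suc.prems(2) that by (simp add: frechet_derivative_works[symmetric])
  qed (simp add: Suc.prems(1))
  have eq: "frechet_derivative f (at x) = frechet_derivative g (at x)" if "x \<in> S" for x
    using frechet_derivative_at[OF D[OF that]] .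
  have "Ck_on k S (\<lambda>x. frechet_derivative g (at x) v)" for v
    by (rule Suc.IH[of "\<lambda>x. frechet_derivative f (at x) v"]) (use eq Suc.prems(2) in simp_all)
  then show ?case
    using D by (auto simp: differentiable_def)
qed

lemma Ck_on_Suc_intro:
  fixes f :: "'a::euclidean_space \<Rightarrow> 'b::euclidean_space"
  assumes S: "open S" and D: "\<And>x. x \<in> S \<Longrightarrow> (f has_derivative f' x) (at x)"
    and C: "\<And>v. Ck_on k S (\<lambda>x. f' x v)"
  shows "Ck_on (Suc k) S f"
proof -
  have "f' x = frechet_derivative f (at x)" if "x \<in> S" for x
    by (rule frechet_derivative_at[OF D[OF that]])
  then have "Ck_on k S (\<lambda>x. frechet_derivative f (at x) v)" for v
    by (intro Ck_on_cong[OF S _ C[of v]]) simp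
  then show ?thesis
    using D by (auto simp: differentiable_def)
qed

lemma Ck_on_has_derivative:
  "Ck_on (Suc k) S f \<Longrightarrow> x \<in> S \<Longrightarrow> (f has_derivative frechet_derivative f (at x)) (at x)"
  by (simp add: frechet_derivative_works[symmetric])

lemma Ck_on_derivative:
  "Ck_on (Suc k) S f \<Longrightarrow> Ck_on k S (\<lambda>x. frechet_derivative f (at x) v)"
  by simp

lemma Ck_on_const: "open S \<Longrightarrow> Ck_on k S (\<lambda>x. c)"
proof (induction k arbitrary: c)
  case (Suc k)
  then show ?case
    by (intro Ck_on_Suc_intro[where f' = "\<lambda>x v. 0"]) auto
qed simp

lemma Ck_on_bounded_linear:
  assumes "bounded_linear f" "open S"
  shows "Ck_on k S f"
proof (cases k)
  case 0
  then show ?thesis using assms linear_continuous_on by auto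
next
  case (Suc m)
  have "Ck_on (Suc m) S f"
    by (rule Ck_on_Suc_intro[OF assms(2), where f' = "\<lambda>x. f"])
      (auto intro: bounded_linear_imp_has_derivative Ck_on_const assms)
  then show ?thesis by (simp only: Suc)
qed

lemma Ck_on_Suc_imp: "Ck_on (Suc k) S f \<Longrightarrow> Ck_on k S f"
proof (induction k arbitrary: f)
  case 0
  then show ?case
    by (auto intro!: continuous_at_imp_continuous_on differentiable_imp_continuous_within)
next
  case (Suc k)
  then show ?case by (metis Ck_on.simps(2))
qed

lemma Ck_on_subset: "Ck_on k S f \<Longrightarrow> T \<subseteq> S \<Longrightarrow> Ck_on k T f"
proof (induction k arbitrary: f)
  case 0
  then show ?case using continuous_on_subset by auto
next
  case (Suc k)
  then show ?case unfolding Ck_on.simps by blast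
qed

lemma Ck_on_add:
  assumes "open S" "Ck_on k S f" "Ck_on k S g"
  shows "Ck_on k S (\<lambda>x. f x + g x)"
  using assms(2,3)
proof (induction k arbitrary: f g)
  case 0
  then show ?case by (auto intro: continuous_on_add)
next
  case (Suc k)
  note D = Ck_on_has_derivative[OF Suc.prems(1)] Ck_on_has_derivative[OF Suc.prems(2)]
  show ?case
  proof (rule Ck_on_Suc_intro[OF assms(1)])
    fix x assume "x \<in> S"
    then show "((\<lambda>x. f x + g x) has_derivative
        (\<lambda>v. frechet_derivative f (at x) v + frechet_derivative g (at x) v)) (at x)"
      by (intro has_derivative_add D)
  qed (intro Suc.IH Ck_on_derivative Suc.prems)
qed

lemma Ck_on_sum:
  "open S \<Longrightarrow> (\<And>i. i \<in> I \<Longrightarrow> Ck_on k S (f i)) \<Longrightarrow> Ck_on k S (\<lambda>x. \<Sum>i\<in>I. f i x)"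
proof (induction I rule: infinite_finite_induct)
  case (insert i I)
  then show ?case by (simp add: Ck_on_add)
qed (simp_all add: Ck_on_const)

lemma Ck_on_bilinear:
  fixes f :: "'d::euclidean_space \<Rightarrow> 'a::euclidean_space" and g :: "'d \<Rightarrow> 'b::euclidean_space"
    and pr :: "'a \<Rightarrow> 'b \<Rightarrow> 'c::euclidean_space"
  assumes pr: "bounded_bilinear pr" and S: "open S" and "Ck_on k S f" "Ck_on k S g"
  shows "Ck_on k S (\<lambda>x. pr (f x) (g x))"
  using assms(3,4)
proof (induction k arbitrary: f g)
  case 0
  then show ?case by (auto intro: bounded_bilinear.continuous_on[OF pr])
next
  case (Suc k)
  note D = Ck_on_has_derivative[OF Suc.prems(1)] Ck_on_has_derivative[OF Suc.prems(2)]
  show ?case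
  proof (rule Ck_on_Suc_intro[OF S])
    fix x assume "x \<in> S"
    then show "((\<lambda>x. pr (f x) (g x)) has_derivative (\<lambda>v. pr (f x) (frechet_derivative g (at x) v) +
        pr (frechet_derivative f (at x) v) (g x))) (at x)"
      by (intro bounded_bilinear.FDERIV[OF pr] D)
  qed (intro Ck_on_add[OF S] Suc.IH Ck_on_derivative Ck_on_Suc_imp[OF Suc.prems(1)]
      Ck_on_Suc_imp[OF Suc.prems(2)] Suc.prems)
qed

lemma Ck_on_linear_compose:
  assumes L: "bounded_linear L" and S: "open S" and "Ck_on k S f"
  shows "Ck_on k S (\<lambda>x. L (f x))"
  using assms(3)
proof (induction k arbitrary: f)
  case 0
  then show ?case using bounded_linear.continuous_on[OF L] by auto
next
  case (Suc k)
  show ?case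
  proof (rule Ck_on_Suc_intro[OF S])
    fix x assume "x \<in> S"
    then show "((\<lambda>x. L (f x)) has_derivative (\<lambda>v. L (frechet_derivative f (at x) v))) (at x)"
      by (intro bounded_linear.has_derivative[OF L] Ck_on_has_derivative[OF Suc.prems])
  qed (intro Suc.IH Ck_on_derivative Suc.prems)
qed

lemmas Ck_on_scaleR = Ck_on_bilinear[OF bounded_bilinear_scaleR]

lemma Ck_on_inner_const: "open S \<Longrightarrow> Ck_on k S f \<Longrightarrow> Ck_on k S (\<lambda>x. f x \<bullet> b)"
  by (rule Ck_on_linear_compose[OF bounded_linear_inner_left])

text \<open>Expanding the inner derivative in a basis writes the chain rule as a sum of products of functions that
are \<open>C\<^sup>k\<close> by induction.\<close>

lemma Ck_on_compose:
  fixes f :: "'b::euclidean_space \<Rightarrow> 'c::euclidean_space" and g :: "'a::euclidean_space \<Rightarrow> 'b"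
  assumes S: "open S" and T: "open T" and gT: "g ` S \<subseteq> T" and "Ck_on k T f" and g: "Ck_on k S g"
  shows "Ck_on k S (\<lambda>x. f (g x))"
  using assms(4,5)
proof (induction k arbitrary: f)
  case 0
  then show ?case using gT continuous_on_compose2 by auto
next
  case (Suc k)
  let ?Df = "\<lambda>y. frechet_derivative f (at y)" and ?Dg = "\<lambda>x. frechet_derivative g (at x)"
  have "(\<lambda>x. f (g x)) = f \<circ> g" by auto
  then have D: "((\<lambda>x. f (g x)) has_derivative (\<lambda>v. ?Df (g x) (?Dg x v))) (at x)" if "x \<in> S" for x
    using diff_chain_at[of g "?Dg x" x f "?Df (g x)"] Suc.prems gT that
    by (auto simp: o_def intro!: Ck_on_has_derivative simp del: Ck_on.simps)
  have D': "((\<lambda>x. f (g x)) has_derivative (\<lambda>v. \<Sum>b\<in>Basis. (?Dg x v \<bullet> b) *\<^sub>R ?Df (g x) b)) (at x)"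
    if "x \<in> S" for x
  proof -
    have lin: "linear (?Df (g x))"
      using Suc.prems gT that by (auto intro: linear_frechet_derivative)
    then show ?thesis
      using D[OF that] by (subst linear_euclidean_representation[OF lin, symmetric])
  qed
  show ?case
    by (rule Ck_on_Suc_intro[OF S], erule D')
      (intro Ck_on_sum Ck_on_scaleR Ck_on_inner_const Suc.IH Ck_on_derivative Ck_on_Suc_imp[OF Suc.prems(2)]
        Suc.prems S)
qed

section \<open>Inverses of families of linear maps\<close>

text \<open>The product rule where one factor is merely continuous: its increment gets multiplied by \<open>g y\<close>, which is
of the order of \<open>y - x\<close> since \<open>g\<close> vanishes at \<open>x\<close>.\<close>

lemma has_derivative_scaleR_vanishing:
  fixes g :: "'a::euclidean_space \<Rightarrow> real" and m :: "'a \<Rightarrow> 'b::euclidean_space"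
  assumes g: "(g has_derivative g') (at x)" "g x = 0" and m: "isCont m x"
  shows "((\<lambda>y. g y *\<^sub>R m y) has_derivative (\<lambda>h. g' h *\<^sub>R m x)) (at x)"
proof -
  have bl: "bounded_linear g'" using g(1) has_derivative_bounded_linear by blast
  obtain K where K: "K > 0" "\<And>h. norm (g' h) \<le> norm h * K"
    using bounded_linear.pos_bounded[OF bl] by blast
  obtain d1 where d1: "d1 > 0" "\<And>y. norm (y - x) < d1 \<Longrightarrow> norm (g y - g x - g' (y - x)) \<le> 1 * norm (y - x)"
    using g(1) unfolding has_derivative_at_alt by (metis zero_less_one)
  have gb: "\<bar>g y\<bar> \<le> (1 + K) * norm (y - x)" if "norm (y - x) < d1" for y
    using d1(2)[OF that] K(2)[of "y - x"] g(2) by (simp add: algebra_simps)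
  have "((\<lambda>y. g y *\<^sub>R (m y - m x)) has_derivative (\<lambda>h. 0)) (at x)"
    unfolding has_derivative_at_alt
  proof (intro conjI allI impI)
    fix e :: real assume e: "e > 0"
    then have "e / (1 + K) > 0" using K by simp
    then obtain d2 where d2: "d2 > 0" "\<And>y. norm (y - x) < d2 \<Longrightarrow> norm (m y - m x) < e / (1 + K)"
      using m unfolding continuous_at_eps_delta by (metis dist_norm)
    show "\<exists>d>0. \<forall>y. norm (y - x) < d \<longrightarrow>
        norm (g y *\<^sub>R (m y - m x) - g x *\<^sub>R (m x - m x) - 0) \<le> e * norm (y - x)"
    proof (intro exI[of _ "min d1 d2"] conjI allI impI)
      fix y assume y: "norm (y - x) < min d1 d2"
      have "\<bar>g y\<bar> * norm (m y - m x) \<le> ((1 + K) * norm (y - x)) * (e / (1 + K))"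
        using gb[of y] d2(2)[of y] y K by (intro mult_mono) auto
      also have "\<dots> = e * norm (y - x)" using K by simp
      finally show "norm (g y *\<^sub>R (m y - m x) - g x *\<^sub>R (m x - m x) - 0) \<le> e * norm (y - x)"
        by simp
    qed (use d1 d2 in auto)
  qed simp
  from has_derivative_add[OF this has_derivative_scaleR_left[OF g(1), of "m x"]]
  show ?thesis
    by (simp add: algebra_simps)
qed

text \<open>A family of invertible linear maps and the family of their inverses. Regularity of such a family is always
expressed for its values at fixed vectors, which keeps all functions between Euclidean spaces.\<close>

locale linear_family_inverse =
  fixes S :: "'a::euclidean_space set" and L M :: "'a \<Rightarrow> 'b::euclidean_space \<Rightarrow> 'b"
  assumes S: "open S" and linL: "x \<in> S \<Longrightarrow> linear (L x)" and linM: "x \<in> S \<Longrightarrow> linear (M x)"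
    and M_L: "x \<in> S \<Longrightarrow> M x (L x v) = v" and L_M: "x \<in> S \<Longrightarrow> L x (M x v) = v"
begin

text \<open>The difference \<open>w = M y v - M x v\<close> satisfies \<open>L x w = (L x - L y) (M y v)\<close>. So \<open>|w|\<close> is at most a constant
times \<open>\<epsilon> y (|w| + |M x v|)\<close>, where \<open>\<epsilon> y\<close> bounds the norm of \<open>L y - L x\<close> and tends to 0; the term with
\<open>|w|\<close> can be absorbed.\<close>

lemma isCont_inverse:
  assumes L: "\<And>v. continuous_on S (\<lambda>x. L x v)" and x: "x \<in> S"
  shows "isCont (\<lambda>y. M y v) x"
proof -
  obtain K where K: "K > 0" "\<And>w. norm (M x w) \<le> K * norm w"
    using linear_bounded_pos[OF linM[OF x]] by blast
  \<comment> \<open>An upper bound for the operator norm of \<open>L y - L x\<close>.\<close>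
  define \<epsilon> where "\<epsilon> y = (\<Sum>b\<in>Basis. norm (L y b - L x b))" for y
  have \<epsilon>0: "(\<epsilon> \<longlongrightarrow> 0) (at x)"
  proof -
    have "((\<lambda>y. L y b) \<longlongrightarrow> L x b) (at x)" for b
      using L[of b] x S by (metis continuous_on_eq_continuous_at isCont_def)
    then have "(\<epsilon> \<longlongrightarrow> (\<Sum>b\<in>Basis. norm (L x b - L x b))) (at x)"
      unfolding \<epsilon>_def by (intro tendsto_intros)
    then show ?thesis by simp
  qed
  have LL: "norm (L y w - L x w) \<le> \<epsilon> y * norm w" if "y \<in> S" for y w
  proof -
    have "L y w - L x w = (\<Sum>b\<in>Basis. (w \<bullet> b) *\<^sub>R (L y b - L x b))"
      using linear_euclidean_representation[OF linL[OF that], of w]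
        linear_euclidean_representation[OF linL[OF x], of w]
      by (simp add: scaleR_diff_right sum_subtractf)
    also have "norm \<dots> \<le> (\<Sum>b\<in>Basis. norm w * norm (L y b - L x b))"
      by (intro sum_norm_le) (auto intro!: mult_right_mono Basis_le_norm)
    finally show ?thesis by (simp add: \<epsilon>_def sum_distrib_left mult.commute)
  qed
  have bound: "norm (M y v - M x v) \<le> 2 * K * norm (M x v) * \<epsilon> y" if y: "y \<in> S" "K * \<epsilon> y < 1/2" for y
  proof -
    define w where "w = M y v - M x v"
    have "norm w = norm (M x (L x w))" using M_L x by simp
    also have "\<dots> \<le> K * norm (L x w)" by (rule K)
    also have "L x w = L x (M y v) - L y (M y v)"
      using L_M x y linL[OF x] by (simp add: w_def linear_diff)
    also have "norm \<dots> \<le> \<epsilon> y * norm (M y v)"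
      using LL[OF y(1), of "M y v"] by (simp add: norm_minus_commute)
    also have "norm (M y v) \<le> norm w + norm (M x v)"
      unfolding w_def by (metis diff_add_cancel norm_triangle_ineq)
    finally have *: "norm w \<le> K * (\<epsilon> y * (norm w + norm (M x v)))"
      using K by (simp add: \<epsilon>_def sum_nonneg mult_left_mono)
    have "K * \<epsilon> y * norm w \<le> 1/2 * norm w"
      using y(2) by (intro mult_right_mono) auto
    with * show ?thesis
      by (simp add: w_def algebra_simps)
  qed
  have "\<forall>\<^sub>F y in at x. K * \<epsilon> y < 1/2"
    using tendsto_mult_left[OF \<epsilon>0, of K] by (intro order_tendstoD) auto
  moreover have "\<forall>\<^sub>F y in at x. y \<in> S"
    using S x eventually_at_topological by blast
  ultimately have "\<forall>\<^sub>F y in at x. norm (M y v - M x v) \<le> 2 * K * norm (M x v) * \<epsilon> y"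
    by eventually_elim (rule bound)
  moreover have "((\<lambda>y. 2 * K * norm (M x v) * \<epsilon> y) \<longlongrightarrow> 0) (at x)"
    using tendsto_mult_left[OF \<epsilon>0, of "2 * K * norm (M x v)"] by simp
  ultimately have "((\<lambda>y. M y v - M x v) \<longlongrightarrow> 0) (at x)"
    by (rule Lim_null_comparison)
  then show ?thesis
    unfolding isCont_def by (simp add: LIM_zero_iff)
qed

text \<open>With \<open>u = M x v\<close> one has \<open>M y v = u + M y (L x u - L y u)\<close>. The argument of \<open>M y\<close> vanishes at \<open>y = x\<close>, so
the continuity of \<open>M\<close> is enough to differentiate this expression.\<close>

lemma has_derivative_inverse:
  assumes E: "\<And>v. ((\<lambda>y. L y v) has_derivative E v) (at x)"
    and L: "\<And>v. continuous_on S (\<lambda>x. L x v)" and x: "x \<in> S"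
  shows "((\<lambda>y. M y v) has_derivative (\<lambda>h. - M x (E (M x v) h))) (at x)"
proof -
  define u where "u = M x v"
  let ?g = "\<lambda>y. L x u - L y u"
  have g: "(?g has_derivative (\<lambda>h. - E u h)) (at x)"
    using has_derivative_diff[OF has_derivative_const E[of u], of "L x u"] by simp
  have "((\<lambda>y. u + (\<Sum>b\<in>Basis. (?g y \<bullet> b) *\<^sub>R M y b)) has_derivative
      (\<lambda>h. 0 + (\<Sum>b\<in>Basis. (- E u h \<bullet> b) *\<^sub>R M x b))) (at x)"
    by (intro has_derivative_add has_derivative_const has_derivative_sum has_derivative_scaleR_vanishing
        has_derivative_inner_left g isCont_inverse L x) simp
  moreover have sum: "(\<Sum>b\<in>Basis. (w \<bullet> b) *\<^sub>R M y b) = M y w" if "y \<in> S" for y w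
    by (rule linear_euclidean_representation[OF linM[OF that], symmetric])
  ultimately have "((\<lambda>y. u + (\<Sum>b\<in>Basis. (?g y \<bullet> b) *\<^sub>R M y b)) has_derivative
      (\<lambda>h. - M x (E u h))) (at x)"
    unfolding sum[OF x] linear_neg[OF linM[OF x]] by simp
  moreover have "u + (\<Sum>b\<in>Basis. (?g y \<bullet> b) *\<^sub>R M y b) = M y v" if "y \<in> S" for y
    unfolding sum[OF that] using L_M[OF x] M_L[OF that] linM[OF that] by (simp add: u_def linear_diff)
  ultimately show ?thesis
    unfolding u_def by (rule has_derivative_transform_within_open[OF _ S x])
qed

text \<open>By the formula for its derivative, the inverse family gains one order of differentiability at each step of
the induction, up to that of \<open>L\<close>.\<close>

lemma Ck_on_inverse:
  assumes "\<And>v. Ck_on k S (\<lambda>x. L x v)"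
  shows "Ck_on k S (\<lambda>x. M x v)"
  using assms
proof (induction k arbitrary: v)
  case 0
  then show ?case
    using isCont_inverse by (auto intro: continuous_at_imp_continuous_on)
next
  case (Suc k)
  have Ck: "Ck_on k S (\<lambda>x. L x v)" for v
    using Suc.prems by (rule Ck_on_Suc_imp)
  have cont: "continuous_on S (\<lambda>x. L x v)" for v
  proof (rule continuous_at_imp_continuous_on, rule ballI)
    fix x assume "x \<in> S"
    then show "isCont (\<lambda>x. L x v) x"
      using Ck_on_has_derivative[OF Suc.prems] has_derivative_continuous by blast
  qed
  define E where "E x w h = (\<Sum>b\<in>Basis. (w \<bullet> b) *\<^sub>R frechet_derivative (\<lambda>y. L y b) (at x) h)" for x w h
  have E: "((\<lambda>y. L y w) has_derivative E x w) (at x)" if x: "x \<in> S" for x w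
  proof -
    have "((\<lambda>y. \<Sum>b\<in>Basis. (w \<bullet> b) *\<^sub>R L y b) has_derivative E x w) (at x)"
      unfolding E_def
      by (intro has_derivative_sum has_derivative_scaleR_right Ck_on_has_derivative[OF Suc.prems] x)
    moreover have "(\<Sum>b\<in>Basis. (w \<bullet> b) *\<^sub>R L y b) = L y w" if "y \<in> S" for y
      by (rule linear_euclidean_representation[OF linL[OF that], symmetric])
    ultimately show ?thesis
      by (rule has_derivative_transform_within_open[OF _ S x])
  qed
  have D: "((\<lambda>y. M y v) has_derivative (\<lambda>h. \<Sum>c\<in>Basis. (- E x (M x v) h \<bullet> c) *\<^sub>R M x c)) (at x)"
    if "x \<in> S" for x
    unfolding linear_euclidean_representation[OF linM[OF that], symmetric] linear_neg[OF linM[OF that]]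
    by (rule has_derivative_inverse[OF E[OF that] cont that])
  have DL: "Ck_on k S (\<lambda>x. frechet_derivative (\<lambda>y. L y b) (at x) h)" for b h
    using Suc.prems by simp
  have EC: "Ck_on k S (\<lambda>x. E x (M x v) h)" for h
    unfolding E_def by (intro Ck_on_sum Ck_on_scaleR Ck_on_inner_const S Suc.IH Ck DL)
  show ?case
    by (rule Ck_on_Suc_intro[OF S], erule D)
      (intro Ck_on_sum Ck_on_scaleR S Suc.IH Ck Ck_on_inner_const
        Ck_on_linear_compose[OF bounded_linear_minus[OF bounded_linear_ident] S EC])
qed

end

section \<open>The smooth inverse function theorem\<close>

lemma smooth_onD: "smooth_on S f \<Longrightarrow> Ck_on k S f"
  by (simp add: smooth_on_def)

lemma smooth_onI: "(\<And>k. Ck_on k S f) \<Longrightarrow> smooth_on S f"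
  by (simp add: smooth_on_def)

lemma smooth_on_has_derivative:
  "smooth_on S f \<Longrightarrow> x \<in> S \<Longrightarrow> (f has_derivative frechet_derivative f (at x)) (at x)"
  by (rule Ck_on_has_derivative[where k = 0]) (rule smooth_onD)

lemma smooth_on_derivative: "smooth_on S f \<Longrightarrow> smooth_on S (\<lambda>x. frechet_derivative f (at x) v)"
  by (rule smooth_onI) (rule Ck_on_derivative[OF smooth_onD])

lemma smooth_on_continuous: "smooth_on S f \<Longrightarrow> continuous_on S f"
  using smooth_onD[where k = 0] by auto

lemma smooth_on_subset: "smooth_on S f \<Longrightarrow> T \<subseteq> S \<Longrightarrow> smooth_on T f"
  by (rule smooth_onI) (rule Ck_on_subset[OF smooth_onD])

lemma smooth_on_compose:
  "open S \<Longrightarrow> open T \<Longrightarrow> g ` S \<subseteq> T \<Longrightarrow> smooth_on T f \<Longrightarrow> smooth_on S g \<Longrightarrow> smooth_on S (\<lambda>x. f (g x))"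
  by (rule smooth_onI) (rule Ck_on_compose[OF _ _ _ smooth_onD smooth_onD])

text \<open>The inverse function theorem gives a differentiable inverse \<open>g\<close> near \<open>f x0\<close>. Its derivative at \<open>y\<close> is the inverse of the
derivative of \<open>f\<close> at \<open>g y\<close>, hence is \<open>C\<^sup>k\<close> if \<open>g\<close> is; so \<open>g\<close> is of every class \<open>C\<^sup>k\<close>.\<close>

theorem smooth_local_inverse:
  fixes f :: "'a::euclidean_space \<Rightarrow> 'a"
  assumes U: "open U" and f: "smooth_on U f" and x0: "x0 \<in> U"
    and inj: "inj (frechet_derivative f (at x0))"
  obtains U' g where "open U'" "U' \<subseteq> U" "x0 \<in> U'" "open (f ` U')" "smooth_on (f ` U') g"
    "\<And>x. x \<in> U' \<Longrightarrow> g (f x) = x"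
proof -
  define F where "F x = Blinfun (frechet_derivative f (at x))" for x
  have F: "blinfun_apply (F x) = frechet_derivative f (at x)" if "x \<in> U" for x
    unfolding F_def using smooth_on_has_derivative[OF f that]
    by (intro bounded_linear_Blinfun_apply) (rule has_derivative_bounded_linear)
  have D: "(f has_derivative blinfun_apply (F x)) (at x)" if "x \<in> U" for x
    using smooth_on_has_derivative[OF f that] F[OF that] by simp
  have contF: "continuous_on U F"
  proof (rule continuous_on_blinfun_componentwise)
    fix i :: 'a
    show "continuous_on U (\<lambda>x. blinfun_apply (F x) i)"
      using smooth_on_continuous[OF smooth_on_derivative[OF f, of i]] F by (simp cong: continuous_on_cong)
  qed
  have lin: "linear (frechet_derivative f (at x0))"
    using smooth_on_has_derivative[OF f x0] has_derivative_linear by blast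
  obtain h where h: "linear h" "h \<circ> frechet_derivative f (at x0) = id"
    using linear_injective_left_inverse[OF lin inj] by blast
  have "Blinfun h o\<^sub>L F x0 = id_blinfun"
    using h(2) F[OF x0] h(1)
    by (intro blinfun_eqI) (simp add: bounded_linear_Blinfun_apply linear_conv_bounded_linear[symmetric] pointfree_idE)
  from inverse_function_theorem[OF U D contF x0 this]
  obtain U' V g g' where U': "open U'" "U' \<subseteq> U" "x0 \<in> U'" and V: "open V" "f x0 \<in> V"
    and hom: "homeomorphism U' V f g"
    and g: "\<And>y. y \<in> V \<Longrightarrow> (g has_derivative g' y) (at y)"
    and g': "\<And>y. y \<in> V \<Longrightarrow> g' y = inv (blinfun_apply (F (g y)))"
    and bij: "\<And>y. y \<in> V \<Longrightarrow> bij (blinfun_apply (F (g y)))"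
    by blast
  have gU: "g ` V = U'" and fU: "f ` U' = V" and gf: "\<And>x. x \<in> U' \<Longrightarrow> g (f x) = x"
    using hom by (auto simp: homeomorphism_def)
  have gyU: "g y \<in> U" if "y \<in> V" for y using gU U' that by blast
  have fam: "linear_family_inverse V (\<lambda>y. frechet_derivative f (at (g y))) g'"
    unfolding linear_family_inverse_def
  proof (intro conjI allI impI)
    show "open V" by (rule V)
    fix y and v :: 'a assume y: "y \<in> V"
    have eq: "blinfun_apply (F (g y)) = frechet_derivative f (at (g y))" using F gyU y by blast
    show "linear (frechet_derivative f (at (g y)))"
      using smooth_on_has_derivative[OF f gyU[OF y]] has_derivative_linear by blast
    show "linear (g' y)" using g[OF y] has_derivative_linear by blast
    show "g' y (frechet_derivative f (at (g y)) v) = v" "frechet_derivative f (at (g y)) (g' y v) = v"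
      using bij[OF y] g'[OF y] by (simp_all add: eq bij_is_inj bij_is_surj surj_f_inv_f)
  qed
  have "Ck_on k V g" for k
  proof (induction k)
    case 0
    then show ?case using hom by (simp add: homeomorphism_def)
  next
    case (Suc k)
    have "Ck_on k V (\<lambda>y. frechet_derivative f (at (g y)) v)" for v
      using gU U'(2) by (intro Ck_on_compose[OF V(1) U _ smooth_onD[OF smooth_on_derivative[OF f]] Suc]) auto
    then have "Ck_on k V (\<lambda>y. g' y v)" for v
      by (rule linear_family_inverse.Ck_on_inverse[OF fam])
    then show ?case
      by (intro Ck_on_Suc_intro[OF V(1) g])
  qed
  then have "smooth_on V g" by (simp add: smooth_on_def)
  with U' V gf show ?thesis
    by (intro that[of U' g]) (auto simp: fU)
qed

section \<open>Normal components and traces\<close>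

lemma normal_component_eqI:
  assumes T: "subspace (tangent_space X p)"
    and w: "w \<in> orthogonal_comp (tangent_space X p)" "v - w \<in> tangent_space X p"
  shows "normal_component X p v = w"
  unfolding normal_component_def
proof (rule the_equality)
  fix u assume u: "u \<in> orthogonal_comp (tangent_space X p) \<and> v - u \<in> tangent_space X p"
  have "(v - w) - (v - u) \<in> tangent_space X p"
    using u by (intro subspace_diff[OF T w(2)]) simp
  then have "u - w \<in> tangent_space X p" by simp
  moreover have "u - w \<in> orthogonal_comp (tangent_space X p)"
    using u w by (intro subspace_diff subspace_orthogonal_comp) auto
  ultimately have "(u - w) \<bullet> (u - w) = 0"
    by (auto simp: orthogonal_comp_def orthogonal_def)
  then show "u = w" by simp
qed (use w in simp)

lemma normal_component:
  assumes T: "subspace (tangent_space X p)"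
  shows "normal_component X p v \<in> orthogonal_comp (tangent_space X p)"
    and "v - normal_component X p v \<in> tangent_space X p"
proof -
  obtain y z where "y \<in> span (tangent_space X p)"
    "\<And>w. w \<in> span (tangent_space X p) \<Longrightarrow> orthogonal z w" "v = y + z"
    using orthogonal_subspace_decomp_exists[of "tangent_space X p" v] by metis
  moreover have "span (tangent_space X p) = tangent_space X p"
    using T by (simp add: span_eq_iff)
  ultimately have z: "z \<in> orthogonal_comp (tangent_space X p)" "v - z \<in> tangent_space X p"
    by (auto simp: orthogonal_comp_def orthogonal_commute)
  then show "normal_component X p v \<in> orthogonal_comp (tangent_space X p)"
    and "v - normal_component X p v \<in> tangent_space X p"
    using normal_component_eqI[OF T z] by auto
qed

lemma linear_normal_component:
  assumes T: "subspace (tangent_space X p)"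
  shows "linear (normal_component X p)"
proof
  note nc = normal_component[OF T]
  have o: "subspace (orthogonal_comp (tangent_space X p))" by (rule subspace_orthogonal_comp)
  show "normal_component X p (u + v) = normal_component X p u + normal_component X p v" for u v
    using subspace_add[OF T nc(2)[of u] nc(2)[of v]]
    by (intro normal_component_eqI T subspace_add[OF o] nc(1)) (simp add: algebra_simps)
  show "normal_component X p (c *\<^sub>R v) = c *\<^sub>R normal_component X p v" for c v
    using subspace_scale[OF T nc(2)[of v], of c]
    by (intro normal_component_eqI T subspace_scale[OF o] nc(1)) (simp add: algebra_simps)
qed

lemma normal_component_tangent:
  assumes "subspace (tangent_space X p)" "v \<in> tangent_space X p"
  shows "normal_component X p v = 0"
  using assms by (intro normal_component_eqI) (auto simp: subspace_0 subspace_orthogonal_comp)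

text \<open>Expand the vectors of \<open>B\<close> in \<open>C\<close>; summed over \<open>B\<close>, the coefficient of \<open>f u u'\<close> is the inner product of
\<open>u\<close> and \<open>u'\<close> expanded in \<open>B\<close>.\<close>

lemma trace_orthonormal_invariant:
  fixes f :: "'a::euclidean_space \<Rightarrow> 'a \<Rightarrow> 'b::real_vector"
  assumes f: "\<And>x. linear (f x)" "\<And>y. linear (\<lambda>x. f x y)"
    and B: "pairwise orthogonal B" "\<And>v. v \<in> B \<Longrightarrow> norm v = 1"
    and C: "pairwise orthogonal C" "\<And>v. v \<in> C \<Longrightarrow> norm v = 1"
    and eq: "span B = span C"
  shows "(\<Sum>v\<in>B. f v v) = (\<Sum>v\<in>C. f v v)"
proof -
  have fin: "finite B" "finite C"
    using B(1) C(1) by (auto intro: pairwise_orthogonal_imp_finite)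
  have expand: "f v v = (\<Sum>u\<in>C. \<Sum>u'\<in>C. ((v \<bullet> u) * (v \<bullet> u')) *\<^sub>R f u u')" if "v \<in> B" for v
  proof -
    have v: "v = (\<Sum>u\<in>C. (v \<bullet> u) *\<^sub>R u)"
      using orthonormal_basis_expand[OF C _ fin(2), of v] that eq span_base by metis
    have "f v v = f (\<Sum>u\<in>C. (v \<bullet> u) *\<^sub>R u) (\<Sum>u\<in>C. (v \<bullet> u) *\<^sub>R u)"
      using v by simp
    also have "\<dots> = (\<Sum>u\<in>C. f (\<Sum>u\<in>C. (v \<bullet> u) *\<^sub>R u) ((v \<bullet> u) *\<^sub>R u))"
      by (rule linear_sum[OF f(1)])
    also have "\<dots> = (\<Sum>u'\<in>C. \<Sum>u\<in>C. f ((v \<bullet> u) *\<^sub>R u) ((v \<bullet> u') *\<^sub>R u'))"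
      by (intro sum.cong refl linear_sum[OF f(2)])
    also have "\<dots> = (\<Sum>u'\<in>C. \<Sum>u\<in>C. ((v \<bullet> u) * (v \<bullet> u')) *\<^sub>R f u u')"
      by (simp add: linear_scale[OF f(1)] linear_scale[OF f(2)] mult.commute)
    also have "\<dots> = (\<Sum>u\<in>C. \<Sum>u'\<in>C. ((v \<bullet> u) * (v \<bullet> u')) *\<^sub>R f u u')"
      by (rule sum.swap)
    finally show ?thesis .
  qed
  have gram: "(\<Sum>v\<in>B. (v \<bullet> u) * (v \<bullet> u')) = (if u = u' then 1 else 0)" if "u \<in> C" "u' \<in> C" for u u'
  proof -
    have "u \<bullet> u' = (\<Sum>v\<in>B. (u \<bullet> v) *\<^sub>R v) \<bullet> u'"
      using orthonormal_basis_expand[OF B _ fin(1), of u] that eq span_base by metis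
    also have "\<dots> = (\<Sum>v\<in>B. (v \<bullet> u) * (v \<bullet> u'))"
      by (simp add: inner_sum_left inner_commute[of u])
    finally show ?thesis
      using that C by (auto simp: pairwise_def orthogonal_def norm_eq_1)
  qed
  have "(\<Sum>v\<in>B. f v v) = (\<Sum>v\<in>B. \<Sum>u\<in>C. \<Sum>u'\<in>C. ((v \<bullet> u) * (v \<bullet> u')) *\<^sub>R f u u')"
    by (intro sum.cong refl expand)
  also have "\<dots> = (\<Sum>u\<in>C. \<Sum>u'\<in>C. \<Sum>v\<in>B. ((v \<bullet> u) * (v \<bullet> u')) *\<^sub>R f u u')"
    by (subst sum.swap, intro sum.cong refl sum.swap)
  also have "\<dots> = (\<Sum>u\<in>C. \<Sum>u'\<in>C. (if u = u' then 1 else 0) *\<^sub>R f u u')"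
    by (intro sum.cong refl) (simp add: gram flip: scaleR_sum_left)
  also have "\<dots> = (\<Sum>u\<in>C. f u u)"
    using fin(2) by (simp add: if_distrib[of "\<lambda>c. c *\<^sub>R _"] sum.delta cong: if_cong)
  finally show ?thesis .
qed

section \<open>The second fundamental form in a slice chart\<close>

text \<open>Pairing \<open>f\<close> with a vector orthogonal to \<open>K\<close> gives a function that is constantly 0 along the line in \<open>W\<close>
through \<open>z\<close> in the direction \<open>w\<close>.\<close>

lemma derivative_into_subspace:
  fixes f :: "'a::euclidean_space \<Rightarrow> 'b::euclidean_space"
  assumes f: "(f has_derivative f') (at z)" and W: "subspace W" and K: "subspace K"
    and V: "open V" "z \<in> V" and z: "z \<in> W" and w: "w \<in> W"
    and into: "\<And>y. y \<in> V \<inter> W \<Longrightarrow> f y \<in> K"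
  shows "f' w \<in> K"
proof -
  obtain a b where ab: "a \<in> span K" "\<And>u. u \<in> span K \<Longrightarrow> orthogonal b u" "f' w = a + b"
    using orthogonal_subspace_decomp_exists[of K "f' w"] by metis
  have spanK: "span K = K" using K by (simp add: span_eq_iff)
  have bK: "u \<bullet> b = 0" if "u \<in> K" for u
    using ab(2)[of u] that spanK by (simp add: orthogonal_def inner_commute)
  let ?g = "\<lambda>t::real. f (z + t *\<^sub>R w) \<bullet> b"
  have lin: "((\<lambda>t::real. z + t *\<^sub>R w) has_derivative (\<lambda>t. t *\<^sub>R w)) (at 0)"
    by (auto intro!: derivative_eq_intros)
  have "((\<lambda>t::real. f (z + t *\<^sub>R w)) has_derivative (\<lambda>t. f' (t *\<^sub>R w))) (at 0)"
    using diff_chain_at[OF lin, of f f'] f by (simp add: o_def)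
  then have g: "(?g has_derivative (\<lambda>t. f' (t *\<^sub>R w) \<bullet> b)) (at 0)"
    by (rule has_derivative_inner_left)
  let ?T = "(\<lambda>t::real. z + t *\<^sub>R w) -` V"
  have "open ?T"
    using V(1) by (intro open_vimage continuous_intros) auto
  moreover have "0 = ?g t" if "t \<in> ?T" for t
    using bK[OF into[of "z + t *\<^sub>R w"]] that z w W by (simp add: subspace_add subspace_scale)
  ultimately have "((\<lambda>t::real. 0) has_derivative (\<lambda>t. f' (t *\<^sub>R w) \<bullet> b)) (at 0)"
    using V(2) by (intro has_derivative_transform_within_open[OF g]) auto
  then have "(\<lambda>t::real. f' (t *\<^sub>R w) \<bullet> b) = (\<lambda>t. 0)"
    using has_derivative_unique[OF _ has_derivative_const] by blast
  then have "f' w \<bullet> b = 0"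
    by (metis scaleR_one)
  then have "b \<bullet> b = 0"
    using bK[of a] ab(1) spanK unfolding ab(3) inner_add_left by simp
  then show ?thesis
    using ab spanK by simp
qed

text \<open>One of the charts required of an embedded submanifold.\<close>

locale slice_chart =
  fixes X U :: "'a::euclidean_space set" and \<phi> \<psi> :: "'a \<Rightarrow> 'a" and W :: "'a set"
  assumes U: "open U" and \<phi>U: "open (\<phi> ` U)" and \<phi>: "smooth_on U \<phi>" and \<psi>: "smooth_on (\<phi> ` U) \<psi>"
    and \<psi>\<phi>: "\<And>x. x \<in> U \<Longrightarrow> \<psi> (\<phi> x) = x" and W: "subspace W" and slice: "\<phi> ` (U \<inter> X) = \<phi> ` U \<inter> W"
begin

abbreviation D\<phi> where "D\<phi> x \<equiv> frechet_derivative \<phi> (at x)"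
abbreviation D\<psi> where "D\<psi> y \<equiv> frechet_derivative \<psi> (at y)"

lemma \<psi>_mem: "y \<in> \<phi> ` U \<Longrightarrow> \<psi> y \<in> U" and \<phi>\<psi>: "y \<in> \<phi> ` U \<Longrightarrow> \<phi> (\<psi> y) = y"
  using \<psi>\<phi> by auto

lemma mem_iff: "x \<in> U \<Longrightarrow> x \<in> X \<longleftrightarrow> \<phi> x \<in> W"
proof
  assume x: "x \<in> U" "\<phi> x \<in> W"
  then have "\<phi> x \<in> \<phi> ` (U \<inter> X)" using slice by blast
  then show "x \<in> X" using \<psi>\<phi> x by (metis Int_iff imageE)
qed (use slice in auto)

lemma has_derivative_\<phi>: "x \<in> U \<Longrightarrow> (\<phi> has_derivative D\<phi> x) (at x)"
  by (rule smooth_on_has_derivative[OF \<phi>])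

lemma has_derivative_\<psi>: "y \<in> \<phi> ` U \<Longrightarrow> (\<psi> has_derivative D\<psi> y) (at y)"
  by (rule smooth_on_has_derivative[OF \<psi>])

lemma linear_D\<phi>: "x \<in> U \<Longrightarrow> linear (D\<phi> x)"
  using has_derivative_\<phi> has_derivative_linear by blast

lemma linear_D\<psi>: "y \<in> \<phi> ` U \<Longrightarrow> linear (D\<psi> y)"
  using has_derivative_\<psi> has_derivative_linear by blast

lemma D\<psi>_D\<phi>: assumes "x \<in> U" shows "D\<psi> (\<phi> x) (D\<phi> x v) = v"
proof -
  have "((\<lambda>x. \<psi> (\<phi> x)) has_derivative (\<lambda>v. D\<psi> (\<phi> x) (D\<phi> x v))) (at x)"
    using diff_chain_at[OF has_derivative_\<phi>[OF assms] has_derivative_\<psi>] assms by (simp add: o_def)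
  moreover have "((\<lambda>x. \<psi> (\<phi> x)) has_derivative (\<lambda>v. v)) (at x)"
    by (rule has_derivative_transform_within_open[OF has_derivative_ident U assms]) (simp add: \<psi>\<phi>)
  ultimately show ?thesis by (metis has_derivative_unique)
qed

lemma D\<phi>_D\<psi>: assumes "x \<in> U" shows "D\<phi> x (D\<psi> (\<phi> x) w) = w"
proof -
  have x: "\<phi> x \<in> \<phi> ` U" using assms by simp
  have "((\<lambda>y. \<phi> (\<psi> y)) has_derivative (\<lambda>v. D\<phi> x (D\<psi> (\<phi> x) v))) (at (\<phi> x))"
    using diff_chain_at[OF has_derivative_\<psi>[OF x], of \<phi> "D\<phi> x"] has_derivative_\<phi>[OF assms] \<psi>\<phi>[OF assms]
    by (simp add: o_def)
  moreover have "((\<lambda>y. \<phi> (\<psi> y)) has_derivative (\<lambda>v. v)) (at (\<phi> x))"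
    by (rule has_derivative_transform_within_open[OF has_derivative_ident \<phi>U x]) (simp add: \<phi>\<psi>)
  ultimately show ?thesis by (metis has_derivative_unique)
qed

text \<open>Curves in \<open>X\<close> correspond to curves in \<open>W\<close>, whose velocities lie in \<open>W\<close>; conversely, lines in \<open>W\<close> are mapped
to curves in \<open>X\<close>.\<close>

lemma tangent_space_eq:
  assumes x: "x \<in> U" "x \<in> X"
  shows "tangent_space X x = D\<psi> (\<phi> x) ` W"
proof
  show "tangent_space X x \<subseteq> D\<psi> (\<phi> x) ` W"
  proof
    fix v assume "v \<in> tangent_space X x"
    then obtain e c where e: "e > 0" and c: "smooth_on {-e<..<e} c" "c ` {-e<..<e} \<subseteq> X" "c 0 = x"
      and v: "vector_derivative c (at 0) = v"
      by (auto simp: tangent_space_def)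
    have 0: "0 \<in> {-e<..<e}" using e by simp
    have "(c has_derivative frechet_derivative c (at 0)) (at 0)"
      by (rule smooth_on_has_derivative[OF c(1) 0])
    then have "c differentiable (at 0)"
      unfolding differentiable_def by blast
    then have dc: "(c has_derivative (\<lambda>t. t *\<^sub>R v)) (at 0)"
      unfolding vector_derivative_works v has_vector_derivative_def .
    then have d: "((\<lambda>t. \<phi> (c t)) has_derivative (\<lambda>t. D\<phi> x (t *\<^sub>R v))) (at 0)"
      using diff_chain_at[OF dc, of \<phi> "D\<phi> x"] has_derivative_\<phi>[OF x(1)] c(3) by (simp add: o_def)
    have "open ({-e<..<e} \<inter> c -` U)"
      using smooth_on_continuous[OF c(1)] U by (intro continuous_open_preimage) auto
    moreover have "\<phi> (c t) \<in> W" if "t \<in> ({-e<..<e} \<inter> c -` U) \<inter> UNIV" for t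
      using that c(2) mem_iff by blast
    ultimately have "D\<phi> x (1 *\<^sub>R v) \<in> W"
      using 0 x c(3) by (intro derivative_into_subspace[OF d subspace_UNIV W]) auto
    then show "v \<in> D\<psi> (\<phi> x) ` W"
      using D\<psi>_D\<phi>[OF x(1), of v] by (metis image_eqI scaleR_one)
  qed
  show "D\<psi> (\<phi> x) ` W \<subseteq> tangent_space X x"
  proof safe
    fix w assume w: "w \<in> W"
    let ?l = "\<lambda>t::real. \<phi> x + t *\<^sub>R w"
    have "open (?l -` (\<phi> ` U))"
      using \<phi>U by (intro open_vimage continuous_intros) auto
    then obtain e where e: "e > 0" "ball 0 e \<subseteq> ?l -` (\<phi> ` U)"
      using x openE[of "?l -` (\<phi> ` U)" 0] by auto
    have sub: "?l t \<in> \<phi> ` U" if "t \<in> {-e<..<e}" for t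
      using that e(2) by (auto simp: subset_iff dist_real_def)
    have lW: "?l t \<in> W" for t
      using x mem_iff w W by (simp add: subspace_add subspace_scale)
    let ?c = "\<lambda>t. \<psi> (?l t)"
    have sl: "smooth_on {-e<..<e} ?l"
      by (intro smooth_onI Ck_on_add Ck_on_const Ck_on_bounded_linear bounded_linear_scaleR_left) auto
    have "smooth_on {-e<..<e} ?c"
      using sub by (intro smooth_on_compose[OF _ \<phi>U _ \<psi> sl]) auto
    moreover have "?c ` {-e<..<e} \<subseteq> X"
    proof safe
      fix t assume t: "t \<in> {-e<..<e}"
      have "\<phi> (?c t) \<in> W" using \<phi>\<psi>[OF sub[OF t]] lW by simp
      then show "?c t \<in> X" using mem_iff \<psi>_mem[OF sub[OF t]] by simp
    qed
    moreover have "vector_derivative ?c (at 0) = D\<psi> (\<phi> x) w"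
    proof -
      have lin: "(?l has_derivative (\<lambda>t. t *\<^sub>R w)) (at 0)"
        by (auto intro!: derivative_eq_intros)
      have "(?c has_derivative (\<lambda>t. D\<psi> (\<phi> x) (t *\<^sub>R w))) (at 0)"
        using diff_chain_at[OF lin, of \<psi> "D\<psi> (\<phi> x)"] has_derivative_\<psi>[of "\<phi> x"] x by (simp add: o_def)
      then have "(?c has_vector_derivative D\<psi> (\<phi> x) w) (at 0)"
        using linear_D\<psi>[of "\<phi> x"] x by (simp add: has_vector_derivative_def linear_scale)
      then show ?thesis by (rule vector_derivative_at)
    qed
    ultimately show "D\<psi> (\<phi> x) w \<in> tangent_space X x"
      using e(1) \<psi>\<phi> x unfolding tangent_space_def by (intro CollectI exI[of _ e] conjI exI[of _ ?c]) auto
  qed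
qed

lemma subspace_tangent_space:
  "x \<in> U \<Longrightarrow> x \<in> X \<Longrightarrow> subspace (tangent_space X x)"
  using linear_D\<psi>[of "\<phi> x"] W by (simp add: tangent_space_eq linear_subspace_image)

lemma tangent_space_iff:
  assumes "x \<in> U" "x \<in> X"
  shows "v \<in> tangent_space X x \<longleftrightarrow> D\<phi> x v \<in> W"
proof
  assume "v \<in> tangent_space X x"
  then show "D\<phi> x v \<in> W"
    using D\<phi>_D\<psi>[OF assms(1)] by (auto simp: tangent_space_eq[OF assms])
next
  assume "D\<phi> x v \<in> W"
  then have "D\<psi> (\<phi> x) (D\<phi> x v) \<in> tangent_space X x"
    by (simp add: tangent_space_eq[OF assms])
  then show "v \<in> tangent_space X x"
    by (simp add: D\<psi>_D\<phi>[OF assms(1)])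
qed

text \<open>The vector field that is constant in the chart.\<close>

lemma tangent_extension_exists:
  assumes p: "p \<in> U" "p \<in> X" and \<eta>: "\<eta> \<in> tangent_space X p"
  shows "\<exists>Y. tangent_extension X p \<eta> Y"
proof -
  let ?Y = "\<lambda>q. D\<psi> (\<phi> q) (D\<phi> p \<eta>)"
  have "smooth_on U ?Y"
    by (rule smooth_on_compose[OF U \<phi>U order_refl smooth_on_derivative[OF \<psi>] \<phi>])
  moreover have "?Y p = \<eta>" using D\<psi>_D\<phi> p by simp
  moreover have "?Y q \<in> tangent_space X q" if "q \<in> U \<inter> X" for q
    using that \<eta> tangent_space_iff[OF p] by (simp add: tangent_space_eq)
  ultimately show ?thesis
    using U p unfolding tangent_extension_def by (intro exI[of _ ?Y] conjI exI[of _ U] ballI)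
qed

text \<open>The second derivative of \<open>\<psi>\<close> at \<open>\<phi> p\<close>.\<close>

definition hess where "hess p w u = frechet_derivative (\<lambda>z. D\<psi> z u) (at (\<phi> p)) w"

lemma has_derivative_D\<psi>: "p \<in> U \<Longrightarrow> ((\<lambda>z. D\<psi> z u) has_derivative (\<lambda>w. hess p w u)) (at (\<phi> p))"
  unfolding hess_def by (rule smooth_on_has_derivative[OF smooth_on_derivative[OF \<psi>]]) simp

lemma linear_hess_left: "p \<in> U \<Longrightarrow> linear (\<lambda>w. hess p w u)"
  using has_derivative_D\<psi> has_derivative_linear by blast

lemma hess_expand:
  assumes p: "p \<in> U"
  shows "hess p w u = (\<Sum>b\<in>Basis. (u \<bullet> b) *\<^sub>R hess p w b)"
proof -
  have "((\<lambda>z. \<Sum>b\<in>Basis. (u \<bullet> b) *\<^sub>R D\<psi> z b) has_derivative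
      (\<lambda>w. \<Sum>b\<in>Basis. (u \<bullet> b) *\<^sub>R hess p w b)) (at (\<phi> p))"
    by (intro has_derivative_sum has_derivative_scaleR_right has_derivative_D\<psi> p)
  then have "((\<lambda>z. D\<psi> z u) has_derivative (\<lambda>w. \<Sum>b\<in>Basis. (u \<bullet> b) *\<^sub>R hess p w b)) (at (\<phi> p))"
    by (rule has_derivative_transform_within_open[OF _ \<phi>U])
      (use p linear_D\<psi> in \<open>auto intro: linear_euclidean_representation[symmetric]\<close>)
  from has_derivative_unique[OF has_derivative_D\<psi>[OF p] this] show ?thesis
    by metis
qed

lemma linear_hess_right:
  assumes p: "p \<in> U"
  shows "linear (hess p w)"
proof
  show "hess p w (x + y) = hess p w x + hess p w y" for x y
    unfolding hess_expand[OF p, of w "x + y"] hess_expand[OF p, of w x] hess_expand[OF p, of w y]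
    by (simp add: inner_add_left scaleR_add_left sum.distrib)
  show "hess p w (c *\<^sub>R x) = c *\<^sub>R hess p w x" for c x
    unfolding hess_expand[OF p, of w "c *\<^sub>R x"] hess_expand[OF p, of w x]
    by (simp add: scaleR_sum_right)
qed

text \<open>Let \<open>y\<close> be the vector field \<open>Y\<close> in the chart, so \<open>Y (\<psi> z) = D\<psi> z (y z)\<close>. By the product rule its derivative in
the direction \<open>w = D\<phi> p \<xi>\<close> is the second derivative of \<open>\<psi>\<close> plus the image under \<open>D\<psi>\<close> of the derivative of \<open>y\<close>.
Since \<open>y\<close> takes values in \<open>W\<close> along \<open>W\<close>, the last term is tangent to \<open>X\<close> and has no normal component.\<close>

lemma normal_levi_civita:
  assumes p: "p \<in> U" "p \<in> X" and \<xi>: "\<xi> \<in> tangent_space X p" and Y: "tangent_extension X p \<eta> Y"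
  shows "normal_component X p (levi_civita p \<xi> Y) = normal_component X p (hess p (D\<phi> p \<xi>) (D\<phi> p \<eta>))"
proof -
  obtain V where V: "open V" "p \<in> V" "smooth_on V Y" and Yp: "Y p = \<eta>"
    and YT: "\<And>q. q \<in> V \<inter> X \<Longrightarrow> Y q \<in> tangent_space X q"
    using Y unfolding tangent_extension_def by blast
  define z0 where "z0 = \<phi> p"
  define w where "w = D\<phi> p \<xi>"
  define N where "N = \<phi> ` U \<inter> \<psi> -` V"
  have N: "open N" unfolding N_def
    by (intro continuous_open_preimage smooth_on_continuous[OF \<psi>] \<phi>U V)
  have z0: "z0 \<in> N" "z0 \<in> W" "z0 \<in> \<phi> ` U"
    using p V mem_iff \<psi>\<phi> by (auto simp: N_def z0_def)
  have wW: "w \<in> W" using \<xi> p tangent_space_iff by (simp add: w_def)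
  have w\<xi>: "D\<psi> z0 w = \<xi>" using D\<psi>_D\<phi> p by (simp add: w_def z0_def)
  have \<psi>z0: "\<psi> z0 = p" using \<psi>\<phi> p by (simp add: z0_def)
  have NU: "N \<subseteq> \<phi> ` U" and NV: "\<psi> ` N \<subseteq> V" and N\<psi>U: "\<psi> ` N \<subseteq> U" using \<psi>_mem by (auto simp: N_def)
  have Y\<psi>: "smooth_on N (\<lambda>z. Y (\<psi> z))"
    by (rule smooth_on_compose[OF N V(1) NV V(3) smooth_on_subset[OF \<psi> NU]])
  \<comment> \<open>The vector field \<open>Y\<close> read in the chart; expanding it in a basis makes its smoothness a matter
    of sums and products.\<close>
  define y where "y z = (\<Sum>b\<in>Basis. (Y (\<psi> z) \<bullet> b) *\<^sub>R D\<phi> (\<psi> z) b)" for z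
  have y: "y z = D\<phi> (\<psi> z) (Y (\<psi> z))" if "z \<in> N" for z
    unfolding y_def using N\<psi>U that by (intro linear_euclidean_representation[symmetric] linear_D\<phi>) auto
  have "smooth_on N y"
    unfolding y_def
    by (intro smooth_onI Ck_on_sum Ck_on_scaleR N Ck_on_inner_const smooth_onD[OF Y\<psi>]
        smooth_onD[OF smooth_on_compose[OF N U N\<psi>U smooth_on_derivative[OF \<phi>] smooth_on_subset[OF \<psi> NU]]])
  then have dy: "(y has_derivative frechet_derivative y (at z0)) (at z0)"
    using z0(1) by (rule smooth_on_has_derivative)
  define y' where "y' = frechet_derivative y (at z0) w"
  have y'W: "y' \<in> W" unfolding y'_def
  proof (rule derivative_into_subspace[OF dy W W N z0(1,2) wW])
    fix z assume z: "z \<in> N \<inter> W"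
    then have "\<psi> z \<in> U" "\<psi> z \<in> V" using NV N\<psi>U by auto
    moreover have "\<psi> z \<in> X" using mem_iff[of "\<psi> z"] z NU \<phi>\<psi> calculation by auto
    ultimately show "y z \<in> W"
      using YT tangent_space_iff z by (auto simp: y)
  qed
  have Yy: "(\<Sum>b\<in>Basis. (y z \<bullet> b) *\<^sub>R D\<psi> z b) = Y (\<psi> z)" if "z \<in> N" for z
  proof -
    have zU: "z \<in> \<phi> ` U" "\<psi> z \<in> U" using NU N\<psi>U that by auto
    have "(\<Sum>b\<in>Basis. (y z \<bullet> b) *\<^sub>R D\<psi> z b) = D\<psi> z (y z)"
      by (rule linear_euclidean_representation[OF linear_D\<psi>[OF zU(1)], symmetric])
    also have "\<dots> = Y (\<psi> z)"
      using D\<psi>_D\<phi>[OF zU(2)] \<phi>\<psi>[OF zU(1)] y[OF that] by simp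
    finally show ?thesis .
  qed
  have "((\<lambda>z. \<Sum>b\<in>Basis. (y z \<bullet> b) *\<^sub>R D\<psi> z b) has_derivative
     (\<lambda>h. \<Sum>b\<in>Basis. (y z0 \<bullet> b) *\<^sub>R hess p h b + (frechet_derivative y (at z0) h \<bullet> b) *\<^sub>R D\<psi> z0 b)) (at z0)"
    unfolding z0_def
    by (intro has_derivative_sum has_derivative_scaleR has_derivative_inner_left has_derivative_D\<psi> p
        dy[unfolded z0_def])
  then have d1: "((\<lambda>z. Y (\<psi> z)) has_derivative
     (\<lambda>h. \<Sum>b\<in>Basis. (y z0 \<bullet> b) *\<^sub>R hess p h b + (frechet_derivative y (at z0) h \<bullet> b) *\<^sub>R D\<psi> z0 b)) (at z0)"
    by (rule has_derivative_transform_within_open[OF _ N z0(1) Yy])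
  have d2: "((\<lambda>z. Y (\<psi> z)) has_derivative (\<lambda>h. frechet_derivative Y (at p) (D\<psi> z0 h))) (at z0)"
    using diff_chain_at[OF has_derivative_\<psi>[OF z0(3)], of Y "frechet_derivative Y (at p)"]
      smooth_on_has_derivative[OF V(3,2)] \<psi>z0 by (simp add: o_def)
  have y0: "y z0 = D\<phi> p \<eta>" using y[OF z0(1)] \<psi>z0 Yp by simp
  have "levi_civita p \<xi> Y = frechet_derivative Y (at p) (D\<psi> z0 w)"
    by (simp add: levi_civita_def w\<xi>)
  also have "\<dots> = (\<Sum>b\<in>Basis. (y z0 \<bullet> b) *\<^sub>R hess p w b + (y' \<bullet> b) *\<^sub>R D\<psi> z0 b)"
    using has_derivative_unique[OF d2 d1] unfolding y'_def by metis
  also have "\<dots> = hess p w (y z0) + D\<psi> z0 y'"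
    unfolding sum.distrib hess_expand[OF p(1), of w "y z0", symmetric]
    by (simp only: linear_euclidean_representation[OF linear_D\<psi>[OF z0(3)], of y', symmetric])
  finally have eq: "levi_civita p \<xi> Y = hess p w (D\<phi> p \<eta>) + D\<psi> z0 y'"
    by (simp only: y0)
  have "D\<psi> z0 y' \<in> tangent_space X p"
    using y'W tangent_space_eq[OF p] by (simp add: z0_def)
  then show ?thesis
    using subspace_tangent_space[OF p] unfolding eq w_def
    by (simp add: linear_add[OF linear_normal_component] normal_component_tangent)
qed

text \<open>The right-hand side is bilinear in \<open>\<xi>\<close> and \<open>\<eta>\<close>, which is what makes the mean curvature independent of the
orthonormal basis; and it shows that the choice of the extension of \<open>\<eta>\<close> is immaterial.\<close>

lemma second_fundamental_form_eq:
  assumes p: "p \<in> U" "p \<in> X" and "\<xi> \<in> tangent_space X p" "\<eta> \<in> tangent_space X p"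
  shows "second_fundamental_form X p \<xi> \<eta> = normal_component X p (hess p (D\<phi> p \<xi>) (D\<phi> p \<eta>))"
  unfolding second_fundamental_form_def
  by (rule normal_levi_civita[OF p assms(3) someI_ex[OF tangent_extension_exists[OF p assms(4)]]])

lemma second_fundamental_form_extension:
  assumes p: "p \<in> U" "p \<in> X" and "\<xi> \<in> tangent_space X p" "\<eta> \<in> tangent_space X p"
    and Y: "tangent_extension X p \<eta> Y"
  shows "second_fundamental_form X p \<xi> \<eta> = normal_component X p (levi_civita p \<xi> Y)"
  unfolding normal_levi_civita[OF p assms(3) Y] by (rule second_fundamental_form_eq[OF assms(1-4)])

lemma mean_curvature_orthonormal_basis:
  assumes p: "p \<in> U" "p \<in> X"
    and B: "pairwise orthogonal B" "\<And>v. v \<in> B \<Longrightarrow> norm v = 1" "span B = tangent_space X p"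
  shows "mean_curvature X p = (\<Sum>v\<in>B. second_fundamental_form X p v v)"
proof -
  let ?P = "\<lambda>B. pairwise orthogonal B \<and> (\<forall>v\<in>B. norm v = 1) \<and> span B = tangent_space X p"
  define C where "C = (SOME B. ?P B)"
  have C: "?P C" unfolding C_def by (rule someI[of ?P B]) (use B in auto)
  let ?f = "\<lambda>\<xi> \<eta>. normal_component X p (hess p (D\<phi> p \<xi>) (D\<phi> p \<eta>))"
  note T = subspace_tangent_space[OF p]
  have lin1: "linear (?f x)" for x
    using linear_compose[OF linear_compose[OF linear_D\<phi>[OF p(1)] linear_hess_right[OF p(1), of "D\<phi> p x"]]
        linear_normal_component[OF T]]
    unfolding o_def .
  have lin2: "linear (\<lambda>x. ?f x y)" for y
    using linear_compose[OF linear_compose[OF linear_D\<phi>[OF p(1)] linear_hess_left[OF p(1), of "D\<phi> p y"]]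
        linear_normal_component[OF T]]
    unfolding o_def .
  have eq: "(\<Sum>v\<in>E. second_fundamental_form X p v v) = (\<Sum>v\<in>E. ?f v v)" if "?P E" for E
    using that span_base by (intro sum.cong refl second_fundamental_form_eq p) blast+
  have "mean_curvature X p = (\<Sum>v\<in>C. second_fundamental_form X p v v)"
    by (simp add: mean_curvature_def C_def)
  also have "\<dots> = (\<Sum>v\<in>C. ?f v v)" by (rule eq[OF C])
  also have "\<dots> = (\<Sum>v\<in>B. ?f v v)"
    using B C by (intro trace_orthonormal_invariant lin1 lin2) auto
  also have "\<dots> = (\<Sum>v\<in>B. second_fundamental_form X p v v)"
    using B by (intro eq[symmetric]) auto
  finally show ?thesis .
qed

end

lemma embedded_submanifold_slice_chart:
  fixes X :: "'a::euclidean_space set"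
  assumes "embedded_submanifold k X" "p \<in> X"
  obtains U \<phi> \<psi> W where "slice_chart X U \<phi> \<psi> W" "p \<in> U"
  using bspec[OF assms(1)[unfolded embedded_submanifold_def] assms(2)]
proof (elim exE conjE)
  fix U W :: "'a set" and \<phi> \<psi> :: "'a \<Rightarrow> 'a"
  assume *: "open U" "open (\<phi> ` U)" "smooth_on U \<phi>" "smooth_on (\<phi> ` U) \<psi>"
    "\<forall>x\<in>U. \<psi> (\<phi> x) = x" "subspace W" "\<phi> ` (U \<inter> X) = \<phi> ` U \<inter> W" and p: "p \<in> U"
  from * have "slice_chart X U \<phi> \<psi> W" by (simp add: slice_chart_def)
  then show thesis using p by (rule that)
qed

section \<open>Mean curvature and isometries\<close>

lemma tangent_space_linear_image:
  assumes g: "bounded_linear g" "g ` X \<subseteq> X" and v: "v \<in> tangent_space X q"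
  shows "g v \<in> tangent_space X (g q)"
proof -
  obtain e c where e: "e > 0" and c: "smooth_on {-e<..<e} c" "c ` {-e<..<e} \<subseteq> X" "c 0 = q"
    and v: "vector_derivative c (at 0) = v"
    using v by (auto simp: tangent_space_def)
  have "smooth_on {-e<..<e} (\<lambda>t. g (c t))"
    by (intro smooth_onI Ck_on_linear_compose[OF g(1)] smooth_onD[OF c(1)]) auto
  moreover have "(\<lambda>t. g (c t)) ` {-e<..<e} \<subseteq> X" using c(2) g(2) by auto
  moreover have "vector_derivative (\<lambda>t. g (c t)) (at 0) = g v"
  proof -
    have "c differentiable (at 0)"
      using smooth_on_has_derivative[OF c(1), of 0] e by (auto simp: differentiable_def)
    then have "(c has_vector_derivative v) (at 0)" using v vector_derivative_works by blast
    from bounded_linear.has_vector_derivative[OF g(1) this] show ?thesis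
      by (rule vector_derivative_at)
  qed
  ultimately show ?thesis
    using e c(3) unfolding tangent_space_def by (intro CollectI exI[of _ e] conjI exI[of _ "\<lambda>t. g (c t)"]) auto
qed

text \<open>An isometry of the ambient space that preserves \<open>X\<close> carries tangent vectors, extensions of them to tangent
vector fields and orthonormal bases of the tangent space to such objects at the image point. So it
transports the second fundamental form, and the trace defining the mean curvature.\<close>

theorem mean_curvature_fixed_by_isometry:
  assumes X: "embedded_submanifold k X" and p: "p \<in> X"
    and g: "orthogonal_transformation g" and gX: "g ` X = X" and gp: "g p = p"
  shows "g (mean_curvature X p) = mean_curvature X p"
proof -
  obtain U \<phi> \<psi> W where chart: "slice_chart X U \<phi> \<psi> W" and pU: "p \<in> U"
    using embedded_submanifold_slice_chart[OF X p] .
  interpret slice_chart X U \<phi> \<psi> W by (rule chart)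
  define h where "h = inv g"
  have h: "orthogonal_transformation h" unfolding h_def by (rule orthogonal_transformation_inv[OF g])
  have gh: "g (h x) = x" and hg: "h (g x) = x" for x
    using orthogonal_transformation_surj[OF g] orthogonal_transformation_inj[OF g]
    by (simp_all add: h_def surj_f_inv_f)
  have hX: "h ` X \<subseteq> X" using gX hg by (metis image_subset_iff imageE subset_refl)
  have lin: "linear g" "linear h" "bounded_linear g" "bounded_linear h"
    using g h by (auto simp: orthogonal_transformation_def linear_conv_bounded_linear)
  have inner: "g x \<bullet> g y = x \<bullet> y" "norm (g x) = norm x" for x y
    using g by (auto simp: orthogonal_transformation_def orthogonal_transformation_norm)
  have hp: "h p = p" using gp hg by metis
  note T = subspace_tangent_space[OF pU p]
  have gT: "g v \<in> tangent_space X (g q)" if "v \<in> tangent_space X q" for v q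
    using tangent_space_linear_image[OF lin(3) _ that] gX by auto
  have hT: "h v \<in> tangent_space X (h q)" if "v \<in> tangent_space X q" for v q
    using tangent_space_linear_image[OF lin(4) hX that] by auto
  have nc: "normal_component X p (g v) = g (normal_component X p v)" for v
  proof (rule normal_component_eqI[OF T])
    show "g (normal_component X p v) \<in> orthogonal_comp (tangent_space X p)"
      unfolding orthogonal_comp_def
    proof safe
      fix u assume "u \<in> tangent_space X p"
      then have "h u \<in> tangent_space X p" using hT hp by metis
      then have "h u \<bullet> normal_component X p v = 0"
        using normal_component(1)[OF T] by (auto simp: orthogonal_comp_def orthogonal_def)
      then show "orthogonal u (g (normal_component X p v))"
        using inner(1)[of "h u"] gh by (simp add: orthogonal_def)
    qed
    show "g v - g (normal_component X p v) \<in> tangent_space X p"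
      using gT[OF normal_component(2)[OF T], of v] gp by (simp add: linear_diff[OF lin(1)])
  qed
  have sff: "second_fundamental_form X p (g v) (g v) = g (second_fundamental_form X p v v)"
    if v: "v \<in> tangent_space X p" for v
  proof -
    obtain Y where Y: "tangent_extension X p v Y" using tangent_extension_exists[OF pU p v] by blast
    then obtain V where V: "open V" "p \<in> V" "smooth_on V Y" and Yp: "Y p = v"
      and YT: "\<And>q. q \<in> V \<inter> X \<Longrightarrow> Y q \<in> tangent_space X q"
      unfolding tangent_extension_def by blast
    let ?Y = "\<lambda>q. g (Y (h q))"
    have hV: "open (h -` V)"
      using V(1) linear_continuous_on[OF lin(4)] by (intro open_vimage) auto
    have "smooth_on (h -` V) ?Y"
      by (intro smooth_onI Ck_on_linear_compose[OF lin(3)] hV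
          Ck_on_compose[OF hV V(1) _ smooth_onD[OF V(3)] Ck_on_bounded_linear[OF lin(4) hV]]) auto
    moreover have "?Y q \<in> tangent_space X q" if "q \<in> h -` V \<inter> X" for q
      using YT[of "h q"] that hX gT[of "Y (h q)" "h q"] gh by auto
    ultimately have Y': "tangent_extension X p (g v) ?Y"
      unfolding tangent_extension_def using Yp hp hV V(2) by auto
    have "(?Y has_derivative (\<lambda>x. g (frechet_derivative Y (at p) (h x)))) (at p)"
    proof -
      have "((\<lambda>q. Y (h q)) has_derivative (\<lambda>x. frechet_derivative Y (at p) (h x))) (at p)"
        using diff_chain_at[OF bounded_linear_imp_has_derivative[OF lin(4)], of Y "frechet_derivative Y (at p)" p]
          smooth_on_has_derivative[OF V(3,2)] hp by (simp add: o_def)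
      then show ?thesis by (rule bounded_linear.has_derivative[OF lin(3)])
    qed
    then have "levi_civita p (g v) ?Y = g (levi_civita p v Y)"
      unfolding levi_civita_def by (metis frechet_derivative_at hg)
    moreover have "g v \<in> tangent_space X p" using gT[OF v] gp by simp
    ultimately show ?thesis
      using second_fundamental_form_extension[OF pU p _ _ Y'] second_fundamental_form_extension[OF pU p v v Y]
      by (simp add: nc)
  qed
  obtain B where B: "B \<subseteq> tangent_space X p" "pairwise orthogonal B" "\<And>v. v \<in> B \<Longrightarrow> norm v = 1"
    "span B = tangent_space X p"
    using orthonormal_basis_subspace[OF T] by metis
  have H: "mean_curvature X p = (\<Sum>v\<in>B. second_fundamental_form X p v v)"
    using mean_curvature_orthonormal_basis[OF pU p B(2,3,4)] .
  have "g ` tangent_space X p = tangent_space X p"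
  proof
    show "g ` tangent_space X p \<subseteq> tangent_space X p" using gT[of _ p] gp by auto
    show "tangent_space X p \<subseteq> g ` tangent_space X p"
      using hT[of _ p] hp gh by (metis image_eqI subsetI)
  qed
  then have "span (g ` B) = tangent_space X p"
    using linear_span_image[OF lin(1), of B] B(4) by simp
  moreover have "pairwise orthogonal (g ` B)"
    using B(2) by (auto simp: pairwise_def orthogonal_def inner)
  ultimately have "mean_curvature X p = (\<Sum>v\<in>g ` B. second_fundamental_form X p v v)"
    using B(3) by (intro mean_curvature_orthonormal_basis pU p) (auto simp: inner)
  also have "\<dots> = (\<Sum>v\<in>B. second_fundamental_form X p (g v) (g v))"
    by (rule sum.reindex_cong[of g]) (auto intro: inj_on_subset[OF orthogonal_transformation_inj[OF g]])
  also have "\<dots> = (\<Sum>v\<in>B. g (second_fundamental_form X p v v))"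
    using B(1) by (intro sum.cong refl sff) auto
  also have "\<dots> = g (mean_curvature X p)"
    by (simp add: H linear_sum[OF lin(1)])
  finally show ?thesis by simp
qed

lemma mean_curvature_normal:
  assumes X: "embedded_submanifold k X" and p: "p \<in> X"
  shows "subspace (tangent_space X p)" "mean_curvature X p \<in> orthogonal_comp (tangent_space X p)"
proof -
  obtain U \<phi> \<psi> W where chart: "slice_chart X U \<phi> \<psi> W" and pU: "p \<in> U"
    using embedded_submanifold_slice_chart[OF X p] .
  interpret slice_chart X U \<phi> \<psi> W by (rule chart)
  show T: "subspace (tangent_space X p)" by (rule subspace_tangent_space[OF pU p])
  show "mean_curvature X p \<in> orthogonal_comp (tangent_space X p)"
    unfolding mean_curvature_def second_fundamental_form_def
    by (intro subspace_sum subspace_orthogonal_comp normal_component(1) T)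
qed

text \<open>The mean curvature vector is normal; being fixed by the isometries, it is also tangent.\<close>

corollary mean_curvature_zero_if_fixed_vectors_tangent:
  assumes X: "embedded_submanifold k X" and p: "p \<in> X"
    and fixed: "\<And>v. (\<And>g. orthogonal_transformation g \<Longrightarrow> g ` X = X \<Longrightarrow> g p = p \<Longrightarrow> g v = v) \<Longrightarrow> v \<in> tangent_space X p"
  shows "mean_curvature X p = 0"
proof -
  have "mean_curvature X p \<in> tangent_space X p"
    by (rule fixed) (rule mean_curvature_fixed_by_isometry[OF X p])
  with mean_curvature_normal(2)[OF X p] have "mean_curvature X p \<bullet> mean_curvature X p = 0"
    by (auto simp: orthogonal_comp_def orthogonal_def)
  then show ?thesis by simp
qed

section \<open>Orthogonal conjugation of symmetric matrices\<close>

lemma matrix_diff_ldistrib: "A ** (B - C) = A ** B - A ** (C :: 'a::ring_1^'n^'m)"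
  by (simp add: vec_eq_iff matrix_matrix_mult_def sum_subtractf right_diff_distrib)

lemma matrix_diff_rdistrib: "(A - B) ** C = A ** C - B ** (C :: 'a::ring_1^'n^'m)"
  by (simp add: vec_eq_iff matrix_matrix_mult_def sum_subtractf left_diff_distrib)

lemma transpose_add: "transpose (A + B) = transpose A + transpose B"
  by (simp add: transpose_def vec_eq_iff)

lemma transpose_diff: "transpose (A - B) = transpose A - transpose B"
  by (simp add: transpose_def vec_eq_iff)

lemma transpose_scaleR: "transpose (c *\<^sub>R A) = c *\<^sub>R transpose (A :: real^'n^'m)"
  by (simp add: transpose_def vec_eq_iff)

lemma bounded_linear_transpose: "bounded_linear (transpose :: real^'n^'m \<Rightarrow> _)"
  unfolding linear_conv_bounded_linear[symmetric]
  by (rule linearI) (simp_all add: transpose_add transpose_scaleR)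

lemma bounded_bilinear_matrix_mult:
  "bounded_bilinear ((**) :: real^'m^'n \<Rightarrow> real^'k^'m \<Rightarrow> real^'k^'n)"
  unfolding bilinear_conv_bounded_bilinear[symmetric] bilinear_def
  by (auto intro!: linearI simp: matrix_add_ldistrib matrix_add_rdistrib matrix_scalar_ac scalar_matrix_assoc)

text \<open>The orthogonal projection onto the symmetric matrices, used as a linear left inverse of the embedding.\<close>

definition symm :: "real^'n^'n \<Rightarrow> 'n::finite symmat"
  where "symm A = sym_of_mat ((1/2) *\<^sub>R (A + transpose A))"

lemma mat_of_sym_symm: "mat_of_sym (symm A) = (1/2) *\<^sub>R (A + transpose A)"
  unfolding symm_def by (rule sym_of_mat_inverse) (simp add: transpose_scaleR transpose_add add.commute)

lemma mat_of_sym_symm_symmetric: "transpose A = A \<Longrightarrow> mat_of_sym (symm A) = A"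
  by (simp add: mat_of_sym_symm scaleR_2[symmetric])

lemma transpose_mat_of_sym: "transpose (mat_of_sym A) = mat_of_sym A"
  using mat_of_sym[of A] by simp

lemma symm_mat_of_sym: "symm (mat_of_sym A) = A"
  by (metis mat_of_sym_inject mat_of_sym_symm_symmetric transpose_mat_of_sym)

lemma bounded_linear_symm: "bounded_linear symm"
  unfolding linear_conv_bounded_linear[symmetric]
  by (rule linearI; simp add: mat_of_sym_inject[symmetric] mat_of_sym_symm plus_symmat.rep_eq
      scaleR_symmat.rep_eq transpose_add transpose_scaleR algebra_simps)

definition conj_sym :: "real^'n^'n \<Rightarrow> 'n::finite symmat \<Rightarrow> 'n symmat"
  where "conj_sym K A = symm (K ** mat_of_sym A ** transpose K)"

lemma mat_of_conj_sym: "mat_of_sym (conj_sym K A) = K ** mat_of_sym A ** transpose K"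
  unfolding conj_sym_def
  by (rule mat_of_sym_symm_symmetric) (simp add: matrix_transpose_mul transpose_mat_of_sym matrix_mul_assoc)

lemma conj_sym_mult: "conj_sym K (conj_sym L A) = conj_sym (K ** L) A"
  by (simp add: mat_of_sym_inject[symmetric] mat_of_conj_sym matrix_transpose_mul matrix_mul_assoc)

lemma conj_sym_1: "conj_sym (mat 1) A = A"
  by (simp add: mat_of_sym_inject[symmetric] mat_of_conj_sym)

lemma bounded_linear_conj_sym: "bounded_linear (conj_sym K)"
  unfolding linear_conv_bounded_linear[symmetric]
  by (rule linearI; simp add: mat_of_sym_inject[symmetric] mat_of_conj_sym plus_symmat.rep_eq
      scaleR_symmat.rep_eq matrix_add_ldistrib matrix_add_rdistrib matrix_scalar_ac scalar_matrix_assoc)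

lemma orthogonal_transformation_conj_sym:
  assumes K: "orthogonal_matrix K"
  shows "orthogonal_transformation (conj_sym K)"
  unfolding orthogonal_transformation_def
proof (intro conjI allI)
  show "linear (conj_sym K)"
    using bounded_linear_conj_sym by (simp add: linear_conv_bounded_linear)
  fix A B
  have "transpose (K ** mat_of_sym A ** transpose K) ** (K ** mat_of_sym B ** transpose K)
      = K ** (transpose (mat_of_sym A) ** mat_of_sym B) ** transpose K"
    by (simp only: matrix_transpose_mul transpose_transpose conj_mult[OF K] matrix_mul_assoc[symmetric])
       (metis K matrix_mul_assoc matrix_mul_lid orthogonal_matrix_def)
  then have "conj_sym K A \<bullet> conj_sym K B = trace (K ** (transpose (mat_of_sym A) ** mat_of_sym B) ** transpose K)"
    by (simp add: inner_symmat.rep_eq mat_of_conj_sym)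
  also have "\<dots> = trace (transpose K ** (K ** (transpose (mat_of_sym A) ** mat_of_sym B)))"
    by (rule trace_mul_sym)
  also have "\<dots> = A \<bullet> B"
    using K by (simp add: inner_symmat.rep_eq matrix_mul_assoc orthogonal_matrix_def)
  finally show "conj_sym K A \<bullet> conj_sym K B = A \<bullet> B" .
qed

lemma conj_sym_Sym_kappa:
  assumes K: "orthogonal_matrix K" and A: "A \<in> Sym_kappa \<kappa>"
  shows "conj_sym K A \<in> Sym_kappa \<kappa>"
proof -
  obtain Q a where Q: "orthogonal_matrix Q" "mat_of_sym A = Q ** diag a ** transpose Q"
    by (rule symmat_diagonalisation)
  have "mat_of_sym (conj_sym K A) = (K ** Q) ** diag a ** transpose (K ** Q)"
    by (simp add: mat_of_conj_sym Q(2) matrix_transpose_mul matrix_mul_assoc)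
  from Sym_kappa_iff[OF orthogonal_matrix_mul[OF K Q(1)] this] A show ?thesis
    by (simp add: Sym_kappa_iff[OF Q])
qed

lemma conj_sym_transpose_cancel:
  assumes "orthogonal_matrix K"
  shows "conj_sym K (conj_sym (transpose K) A) = A" "conj_sym (transpose K) (conj_sym K A) = A"
  using assms by (simp_all add: conj_sym_mult orthogonal_matrix_def conj_sym_1)

lemma conj_sym_image_Sym_kappa:
  assumes K: "orthogonal_matrix K"
  shows "conj_sym K ` Sym_kappa \<kappa> = Sym_kappa \<kappa>"
proof
  show "Sym_kappa \<kappa> \<subseteq> conj_sym K ` Sym_kappa \<kappa>"
  proof
    fix A :: "'a symmat" assume "A \<in> Sym_kappa \<kappa>"
    then have "conj_sym (transpose K) A \<in> Sym_kappa \<kappa>"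
      using K by (intro conj_sym_Sym_kappa) auto
    then show "A \<in> conj_sym K ` Sym_kappa \<kappa>"
      using conj_sym_transpose_cancel(1)[OF K] by (metis image_eqI)
  qed
qed (use conj_sym_Sym_kappa[OF K] in blast)

text \<open>Treats sign matrices and permutation matrices at once.\<close>

definition monomial_matrix :: "('n::finite \<Rightarrow> real) \<Rightarrow> ('n \<Rightarrow> 'n) \<Rightarrow> real^'n^'n"
  where "monomial_matrix s \<sigma> = (\<chi> i j. if j = \<sigma> i then s i else 0)"

lemma matrix_mult_nth: "(A ** B) $ i $ j = (\<Sum>k\<in>UNIV. A $ i $ k * B $ k $ j)"
  by (simp add: matrix_matrix_mult_def)

lemma monomial_conj_nth:
  "(monomial_matrix s \<sigma> ** M ** transpose (monomial_matrix s \<sigma>)) $ i $ j = s i * s j * M $ \<sigma> i $ \<sigma> j"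
proof -
  have 1: "(monomial_matrix s \<sigma> ** M) $ i $ k = s i * M $ \<sigma> i $ k" for k
    by (simp add: monomial_matrix_def matrix_matrix_mult_def if_distrib[of "\<lambda>x. x * _"] sum.delta' cong: if_cong)
  show ?thesis
    unfolding matrix_mult_nth[of "_ ** M"] 1
    by (simp add: monomial_matrix_def transpose_def if_distrib[of "\<lambda>x. _ * x"] sum.delta' mult_ac cong: if_cong)
qed

lemma orthogonal_monomial_matrix:
  assumes "inj \<sigma>" "\<And>i. s i * s i = 1"
  shows "orthogonal_matrix (monomial_matrix s \<sigma>)"
proof -
  have "(monomial_matrix s \<sigma> ** mat 1 ** transpose (monomial_matrix s \<sigma>)) $ i $ j = mat 1 $ i $ j" for i j
    unfolding monomial_conj_nth using assms by (auto simp: mat_def inj_eq)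
  then have "monomial_matrix s \<sigma> ** transpose (monomial_matrix s \<sigma>) = mat 1"
    by (simp add: vec_eq_iff)
  then show ?thesis
    by (simp add: orthogonal_matrix_def matrix_left_right_inverse)
qed

lemma monomial_conj_diag:
  assumes "inj \<sigma>" "\<And>i. s i * s i = 1"
  shows "monomial_matrix s \<sigma> ** diag a ** transpose (monomial_matrix s \<sigma>) = diag (a \<circ> \<sigma>)"
  using assms by (auto simp: vec_eq_iff monomial_conj_nth inj_eq)

section \<open>The Cayley transform\<close>

text \<open>A vector \<open>x\<close> in the kernel of \<open>1 - S/2\<close> satisfies \<open>x \<bullet> x = x \<bullet> S x / 2\<close>, which is 0 as \<open>S\<close> is
skew-symmetric.\<close>

definition cayley_inv :: "real^'n^'n \<Rightarrow> real^'n^'n"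
  where "cayley_inv S = matrix_inv (mat 1 - (1/2) *\<^sub>R S)"

lemma cayley_inv:
  fixes S :: "real^'n^'n"
  assumes S: "transpose S = - S"
  shows "cayley_inv S ** (mat 1 - (1/2) *\<^sub>R S) = mat 1" "(mat 1 - (1/2) *\<^sub>R S) ** cayley_inv S = mat 1"
proof -
  let ?A = "mat 1 - (1/2) *\<^sub>R S"
  have "x = 0" if "?A *v x = 0" for x
  proof -
    have "x - (1/2) *\<^sub>R (S *v x) = 0"
      using that by (simp add: matrix_vector_mult_diff_rdistrib scaleR_matrix_vector_assoc)
    then have x: "x = (1/2) *\<^sub>R (S *v x)" by simp
    have "x \<bullet> (S *v x) = (transpose S *v x) \<bullet> x"
      by (simp add: dot_lmul_matrix)
    also have "\<dots> = - (x \<bullet> (S *v x))"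
      unfolding S by (simp add: inner_commute vec_eq_iff matrix_vector_mult_def sum_negf inner_vec_def)
    finally have "x \<bullet> (S *v x) = 0" by simp
    then have "x \<bullet> x = 0"
      by (subst (2) x) simp
    then show "x = 0" by simp
  qed
  then have "\<exists>B. B ** ?A = mat 1"
    unfolding matrix_left_invertible_ker by blast
  then have "\<exists>B. ?A ** B = mat 1 \<and> B ** ?A = mat 1"
    using matrix_left_right_inverse by blast
  from someI_ex[OF this]
  show "cayley_inv S ** ?A = mat 1" "?A ** cayley_inv S = mat 1"
    unfolding cayley_inv_def matrix_inv_def by blast+
qed

text \<open>The Cayley transform \<open>(1 + S/2) (1 - S/2)\<^sup>-\<^sup>1\<close> of a skew-symmetric matrix, written with a single occurrence of
the inverse. It serves as an algebraic substitute for the exponential map: it takes orthogonal values,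
and the factor 1/2 makes its derivative at 0 the identity.\<close>

definition cayley :: "real^'n^'n \<Rightarrow> real^'n^'n"
  where "cayley S = 2 *\<^sub>R cayley_inv S - mat 1"

lemma orthogonal_cayley:
  assumes S: "transpose S = - S"
  shows "orthogonal_matrix (cayley S)"
proof -
  define T where "T = (1/2) *\<^sub>R S"
  define N where "N = cayley_inv S"
  have T: "transpose T = - T" by (simp add: T_def transpose_scaleR S)
  have N: "N ** (mat 1 - T) = mat 1" "(mat 1 - T) ** N = mat 1"
    using cayley_inv[OF S] by (simp_all add: N_def T_def)
  have Nt: "transpose N ** (mat 1 + T) = mat 1"
    using arg_cong[OF N(2), of transpose] by (simp add: matrix_transpose_mul transpose_diff T)
  have c: "cayley S = (mat 1 + T) ** N"
  proof -
    have "N - T ** N = mat 1" using N(2) by (simp add: matrix_diff_rdistrib)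
    then have "T ** N = N - mat 1" by (simp add: algebra_simps)
    then show ?thesis
      by (simp add: cayley_def N_def[symmetric] matrix_add_rdistrib scaleR_2)
  qed
  have comm: "(mat 1 - T) ** (mat 1 + T) = (mat 1 + T) ** (mat 1 - T)"
    by (simp add: matrix_add_ldistrib matrix_add_rdistrib matrix_diff_ldistrib matrix_diff_rdistrib)
  have "transpose (cayley S) ** cayley S = transpose N ** ((mat 1 - T) ** (mat 1 + T)) ** N"
    by (simp add: c matrix_transpose_mul transpose_add T matrix_mul_assoc)
  also have "\<dots> = (transpose N ** (mat 1 + T)) ** ((mat 1 - T) ** N)"
    by (simp only: comm matrix_mul_assoc)
  also have "\<dots> = mat 1" by (simp add: N Nt)
  finally show ?thesis by (simp add: orthogonal_matrix)
qed

lemma cayley_inv_0: "cayley_inv 0 = (mat 1 :: real^'n^'n)"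
proof -
  have "transpose (0 :: real^'n^'n) = - 0" by (simp add: transpose_def vec_eq_iff)
  from cayley_inv(1)[OF this] show ?thesis by simp
qed

lemma linear_family_cayley:
  fixes s :: "'a::euclidean_space \<Rightarrow> real^'n^'n"
  assumes skew: "\<And>x. transpose (s x) = - s x"
  shows "linear_family_inverse UNIV (\<lambda>x Z. (mat 1 - (1/2) *\<^sub>R s x) ** Z) (\<lambda>x Z. cayley_inv (s x) ** (Z :: real^'n^'n))"
  unfolding linear_family_inverse_def
proof (intro conjI allI impI)
  have lin: "linear (\<lambda>Z. K ** Z)" for K :: "real^'n^'n"
    by (rule linearI) (simp_all add: matrix_add_ldistrib matrix_scalar_ac scalar_matrix_assoc)
  show "linear ((**) (mat 1 - (1 / 2) *\<^sub>R s x) :: real^'n^'n \<Rightarrow> _)" for x by (rule lin)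
  show "linear ((**) (cayley_inv (s x)) :: real^'n^'n \<Rightarrow> _)" for x by (rule lin)
  show "cayley_inv (s x) ** ((mat 1 - (1 / 2) *\<^sub>R s x) ** v) = v"
    "(mat 1 - (1 / 2) *\<^sub>R s x) ** (cayley_inv (s x) ** v) = v" for x v
    using cayley_inv[OF skew[of x]] by (simp_all add: matrix_mul_assoc)
qed simp

lemma Ck_on_cayley_inv:
  fixes s :: "'a::euclidean_space \<Rightarrow> real^'n^'n"
  assumes s: "bounded_linear s" and skew: "\<And>x. transpose (s x) = - s x"
  shows "Ck_on k UNIV (\<lambda>x. cayley_inv (s x))"
proof -
  have "Ck_on k UNIV (\<lambda>x. (mat 1 - (1/2) *\<^sub>R s x) ** Z)" for Z :: "real^'n^'n"
  proof -
    have "Ck_on k UNIV (\<lambda>x. mat 1 + (- (1/2)) *\<^sub>R s x)"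
      by (intro Ck_on_add Ck_on_const Ck_on_bounded_linear bounded_linear_const_scaleR s) auto
    then show ?thesis
      by (intro Ck_on_bilinear[OF bounded_bilinear_matrix_mult] Ck_on_const) auto
  qed
  from linear_family_inverse.Ck_on_inverse[OF linear_family_cayley[OF skew] this, of "mat 1"]
  show ?thesis by simp
qed

lemma has_derivative_cayley:
  fixes s :: "'a::euclidean_space \<Rightarrow> real^'n^'n"
  assumes s: "bounded_linear s" and skew: "\<And>x. transpose (s x) = - s x" and 0: "s p = 0"
  shows "((\<lambda>x. cayley (s x)) has_derivative s) (at p)"
proof -
  have lin: "((\<lambda>x. (mat 1 - (1/2) *\<^sub>R s x) ** Z) has_derivative (\<lambda>h. - ((1/2) *\<^sub>R s h) ** Z)) (at p)"
    for Z :: "real^'n^'n"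
  proof -
    have "((\<lambda>x. mat 1 - (1/2) *\<^sub>R s x) has_derivative (\<lambda>h. 0 - (1/2) *\<^sub>R s h)) (at p)"
      by (intro has_derivative_diff has_derivative_const has_derivative_scaleR_right
          bounded_linear_imp_has_derivative s)
    from bounded_bilinear.FDERIV[OF bounded_bilinear_matrix_mult this has_derivative_const[of Z]]
    show ?thesis by (simp add: bounded_bilinear.zero_right[OF bounded_bilinear_matrix_mult])
  qed
  then have cont: "continuous_on UNIV (\<lambda>x. (mat 1 - (1/2) *\<^sub>R s x) ** Z)" for Z :: "real^'n^'n"
    using bounded_linear.continuous_on[OF s continuous_on_id]
    by (intro bounded_bilinear.continuous_on[OF bounded_bilinear_matrix_mult] continuous_intros) auto
  have "((\<lambda>x. cayley_inv (s x) ** mat 1) has_derivative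
      (\<lambda>h. - (cayley_inv (s p) ** (- ((1/2) *\<^sub>R s h) ** (cayley_inv (s p) ** mat 1))))) (at p)"
    by (rule linear_family_inverse.has_derivative_inverse[OF linear_family_cayley[OF skew] lin cont]) simp
  then have "((\<lambda>x. cayley_inv (s x)) has_derivative (\<lambda>h. (1/2) *\<^sub>R s h)) (at p)"
    by (simp add: 0 cayley_inv_0)
  then have "((\<lambda>x. 2 *\<^sub>R cayley_inv (s x) - mat 1) has_derivative (\<lambda>h. 2 *\<^sub>R ((1/2) *\<^sub>R s h) - 0)) (at p)"
    by (intro has_derivative_diff has_derivative_scaleR_right has_derivative_const)
  then show ?thesis by (simp add: cayley_def)
qed

section \<open>Perturbation of block matrices\<close>

text \<open>Gershgorin's argument inside a block: consider the equation \<open>D v = l v\<close> at the index, among those of the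
block of \<open>i0\<close>, where the entry of \<open>v\<close> is largest.\<close>

lemma block_eigenvalue_near:
  fixes D :: "real^'n^'n"
  assumes block: "\<And>i j. a i \<noteq> a j \<Longrightarrow> D $ i $ j = 0"
    and near: "\<And>i. (\<Sum>j\<in>UNIV. \<bar>D $ i $ j - diag a $ i $ j\<bar>) < \<delta>"
    and v: "D *v v = l *\<^sub>R v" and i0: "v $ i0 \<noteq> 0"
  shows "\<bar>l - a i0\<bar> < \<delta>"
proof -
  define I where "I = {i. a i = a i0}"
  have I: "finite I" "i0 \<in> I" by (auto simp: I_def)
  obtain i where i: "i \<in> I" "\<And>j. j \<in> I \<Longrightarrow> \<bar>v $ j\<bar> \<le> \<bar>v $ i\<bar>"
    using I finite_imageI[OF I(1), of "\<lambda>j. \<bar>v $ j\<bar>"] Max_in[of "(\<lambda>j. \<bar>v $ j\<bar>) ` I"] Max_ge[of "(\<lambda>j. \<bar>v $ j\<bar>) ` I"]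
    by (metis (no_types, lifting) empty_iff image_iff image_is_empty imageI)
  have vi: "\<bar>v $ i\<bar> > 0" using i(2)[OF I(2)] i0 by auto
  have ai: "a i = a i0" using i(1) by (simp add: I_def)
  have "(l - a i0) * v $ i = (\<Sum>j\<in>UNIV. (D $ i $ j - diag a $ i $ j) * v $ j)"
  proof -
    have "(\<Sum>j\<in>UNIV. D $ i $ j * v $ j) = l * v $ i"
      using arg_cong[OF v, of "\<lambda>w. w $ i"] by (simp add: matrix_vector_mult_def)
    moreover have "(\<Sum>j\<in>UNIV. diag a $ i $ j * v $ j) = a i0 * v $ i"
      by (simp add: if_distrib[of "\<lambda>x. x * _"] sum.delta ai cong: if_cong)
    ultimately show ?thesis
      by (simp add: left_diff_distrib sum_subtractf)
  qed
  also have "\<bar>\<dots>\<bar> \<le> (\<Sum>j\<in>UNIV. \<bar>D $ i $ j - diag a $ i $ j\<bar> * \<bar>v $ i\<bar>)"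
  proof (rule order_trans[OF sum_abs], rule sum_mono)
    fix j
    show "\<bar>(D $ i $ j - diag a $ i $ j) * v $ j\<bar> \<le> \<bar>D $ i $ j - diag a $ i $ j\<bar> * \<bar>v $ i\<bar>"
    proof (cases "j \<in> I")
      case True
      then show ?thesis using i(2) by (simp add: abs_mult mult_left_mono)
    next
      case False
      then have "a i \<noteq> a j" using ai by (auto simp: I_def)
      then show ?thesis using block by auto
    qed
  qed
  also have "\<dots> = (\<Sum>j\<in>UNIV. \<bar>D $ i $ j - diag a $ i $ j\<bar>) * \<bar>v $ i\<bar>"
    by (simp add: sum_distrib_right)
  also have "\<dots> < \<delta> * \<bar>v $ i\<bar>"
    using near vi by (intro mult_strict_right_mono)
  finally show ?thesis
    using vi by (simp add: abs_mult)
qed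

text \<open>An eigenvector of \<open>D\<close> is supported in the one block whose value of \<open>a\<close> is close to its eigenvalue. This
assigns a value of \<open>a\<close> to each eigenvalue. Every value of \<open>a\<close> is reached, because the eigenvectors span;
hence the assignment is injective if there are no more eigenvalues than values of \<open>a\<close>. So each block has
only one eigenvalue, and is scalar.\<close>

lemma block_diagonal_scalar_if_few_eigenvalues:
  fixes D R :: "real^'n^'n"
  assumes block: "\<And>i j. a i \<noteq> a j \<Longrightarrow> D $ i $ j = 0"
    and near: "\<And>i. (\<Sum>j\<in>UNIV. \<bar>D $ i $ j - diag a $ i $ j\<bar>) < \<delta>"
    and gap: "\<And>i j. a i \<noteq> a j \<Longrightarrow> 2 * \<delta> \<le> \<bar>a i - a j\<bar>"
    and R: "orthogonal_matrix R" and D: "D = R ** diag b ** transpose R"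
    and card: "card (range b) = card (range a)"
  shows "\<exists>\<beta>. \<forall>i j. a i = a j \<longrightarrow> D $ i $ j = (if i = j then \<beta> (a i) else 0)"
proof -
  have eig: "D *v column j R = b j *\<^sub>R column j R" for j
  proof -
    have "D ** R = R ** diag b"
      using R by (simp add: D matrix_mul_assoc[symmetric] orthogonal_matrix_def)
    then have "(D ** R) $ i $ j = (R ** diag b) $ i $ j" for i by simp
    then show ?thesis
      by (simp add: vec_eq_iff matrix_matrix_mult_def matrix_vector_mult_def column_def
          if_distrib[of "\<lambda>x. _ * x"] sum.delta mult.commute cong: if_cong)
  qed
  have close: "\<bar>b j - a i\<bar> < \<delta>" if "R $ i $ j \<noteq> 0" for i j
    using block_eigenvalue_near[OF block near eig[of j], of i] that by (simp add: column_def)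
  have same: "a i = a i'" if "R $ i $ j \<noteq> 0" "R $ i' $ j' \<noteq> 0" "b j = b j'" for i i' j j'
    using close[OF that(1)] close[OF that(2)] gap[of i i'] that(3) by (cases "a i = a i'") auto
  have col: "\<exists>i. R $ i $ j \<noteq> 0" for j
  proof (rule ccontr)
    assume "\<not> ?thesis"
    then have "(transpose R ** R) $ j $ j = 0" by (simp add: matrix_matrix_mult_def)
    then show False using R by (simp add: orthogonal_matrix_def mat_def)
  qed
  have row: "\<exists>j. R $ i $ j \<noteq> 0" for i
  proof (rule ccontr)
    assume "\<not> ?thesis"
    then have "(R ** transpose R) $ i $ i = 0" by (simp add: matrix_matrix_mult_def)
    then show False using R by (simp add: orthogonal_matrix_def mat_def)
  qed
  \<comment> \<open>The value of \<open>a\<close> on the block that supports the eigenvectors for the eigenvalue \<open>x\<close>.\<close>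
  define \<theta> where "\<theta> x = a (SOME i. \<exists>j. b j = x \<and> R $ i $ j \<noteq> 0)" for x
  have \<theta>: "\<theta> (b j) = a i" if "R $ i $ j \<noteq> 0" for i j
  proof -
    have "\<exists>j'. b j' = b j \<and> R $ (SOME i. \<exists>j'. b j' = b j \<and> R $ i $ j' \<noteq> 0) $ j' \<noteq> 0"
      by (rule someI[of _ i]) (use that in blast)
    then show ?thesis unfolding \<theta>_def using same that by blast
  qed
  have "\<theta> ` range b = range a"
  proof
    show "\<theta> ` range b \<subseteq> range a" by (auto simp: \<theta>_def)
    show "range a \<subseteq> \<theta> ` range b" using row \<theta> by (metis image_eqI image_subset_iff rangeI)
  qed
  then have inj: "inj_on \<theta> (range b)"
    using card by (intro eq_card_imp_inj_on) auto
  define \<beta> where "\<beta> = inv_into (range b) \<theta>"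
  have \<beta>: "\<beta> (a i) = b j" if "R $ i $ j \<noteq> 0" for i j
    unfolding \<beta>_def \<theta>[OF that, symmetric] using inj by (intro inv_into_f_f) auto
  have "D $ i $ j = (if i = j then \<beta> (a i) else 0)" if "a i = a j" for i j
  proof -
    have "D $ i $ j = (\<Sum>k\<in>UNIV. R $ i $ k * b k * R $ j $ k)"
      by (simp add: D matrix_matrix_mult_def transpose_def if_distrib[of "\<lambda>x. _ * x"] sum.delta cong: if_cong)
    also have "\<dots> = (\<Sum>k\<in>UNIV. \<beta> (a i) * (R $ i $ k * R $ j $ k))"
    proof (rule sum.cong[OF refl])
      fix k show "R $ i $ k * b k * R $ j $ k = \<beta> (a i) * (R $ i $ k * R $ j $ k)"
        using \<beta>[of i k] by (cases "R $ i $ k = 0") auto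
    qed
    also have "\<dots> = \<beta> (a i) * (R ** transpose R) $ i $ j"
      by (simp add: matrix_matrix_mult_def transpose_def sum_distrib_left)
    finally show ?thesis
      using R by (simp add: orthogonal_matrix_def mat_def)
  qed
  then show ?thesis by blast
qed

section \<open>Slice charts and tangent vectors\<close>

text \<open>The matrices that, in the basis given by \<open>Q\<close>, have scalar blocks on the level sets of \<open>a\<close> and arbitrary
entries elsewhere.\<close>

definition slice_subspace :: "real^'n^'n \<Rightarrow> ('n::finite \<Rightarrow> real) \<Rightarrow> 'n symmat set"
  where "slice_subspace Q a = {H. \<forall>i j. a i = a j \<longrightarrow>
    (i \<noteq> j \<longrightarrow> mat_of_sym (conj_sym (transpose Q) H) $ i $ j = 0) \<and>
    mat_of_sym (conj_sym (transpose Q) H) $ i $ i = mat_of_sym (conj_sym (transpose Q) H) $ j $ j}"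

definition block_part :: "('n::finite \<Rightarrow> real) \<Rightarrow> real^'n^'n \<Rightarrow> real^'n^'n"
  where "block_part a M = (\<chi> i j. if a i = a j then M $ i $ j else 0)"

text \<open>Inverts the map that takes \<open>S\<close> to the commutator of \<open>S\<close> and \<open>diag a\<close>, outside the blocks; inside the
blocks, where \<open>a j - a i = 0\<close>, division by zero makes the entry 0.\<close>

definition commutator_inverse :: "('n::finite \<Rightarrow> real) \<Rightarrow> real^'n^'n \<Rightarrow> real^'n^'n"
  where "commutator_inverse a M = (\<chi> i j. M $ i $ j / (a j - a i))"

lemma bounded_linear_block_part: "bounded_linear (block_part a)"
  unfolding linear_conv_bounded_linear[symmetric]
  by (rule linearI) (simp_all add: block_part_def vec_eq_iff)

lemma bounded_linear_commutator_inverse: "bounded_linear (commutator_inverse a)"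
  unfolding linear_conv_bounded_linear[symmetric]
  by (rule linearI) (simp_all add: commutator_inverse_def vec_eq_iff add_divide_distrib)

lemma transpose_commutator_inverse:
  assumes "transpose M = M"
  shows "transpose (commutator_inverse a M) = - commutator_inverse a M"
proof -
  have "M $ j $ i = M $ i $ j" for i j
    using arg_cong[OF assms, of "\<lambda>N. N $ i $ j"] by (simp add: transpose_def)
  then have "M $ j $ i / (a i - a j) = - (M $ i $ j / (a j - a i))" for i j
    by (metis minus_diff_eq minus_divide_right)
  then show ?thesis
    unfolding commutator_inverse_def transpose_def vec_eq_iff vector_uminus_component vec_lambda_beta
    by blast
qed

lemma transpose_block_part:
  assumes "transpose M = M"
  shows "transpose (block_part a M) = block_part a M"
proof -
  have "M $ j $ i = M $ i $ j" for i j
    using arg_cong[OF assms, of "\<lambda>N. N $ i $ j"] by (simp add: transpose_def)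
  then show ?thesis
    by (auto simp: block_part_def vec_eq_iff transpose_def)
qed

lemma diag_mult_nth: "(diag a ** M) $ i $ j = a i * (M :: real^'n^'n) $ i $ j"
  and mult_diag_nth: "(M ** diag a) $ i $ j = M $ i $ j * a j"
  by (simp_all add: matrix_matrix_mult_def if_distrib[of "\<lambda>x. x * _"] if_distrib[of "\<lambda>x. _ * x"] sum.delta sum.delta' cong: if_cong)

lemma commutator_commutator_inverse:
  "commutator_inverse a M ** diag a - diag a ** commutator_inverse a M + block_part a M = M"
proof -
  have "x / (a j - a i) * a j - a i * (x / (a j - a i)) = x" if "a i \<noteq> a j" for x i j
  proof -
    have "x / (a j - a i) * a j - a i * (x / (a j - a i)) = x / (a j - a i) * (a j - a i)"
      by (simp add: right_diff_distrib mult.commute diff_divide_distrib)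
    then show ?thesis using that by simp
  qed
  then show ?thesis
    by (simp add: vec_eq_iff diag_mult_nth mult_diag_nth commutator_inverse_def block_part_def)
qed

lemma subspace_slice_subspace: "subspace (slice_subspace Q a)"
proof -
  let ?c = "\<lambda>H. mat_of_sym (conj_sym (transpose Q) H)"
  have l: "linear (conj_sym (transpose Q))"
    using bounded_linear_conj_sym by (simp add: linear_conv_bounded_linear)
  have c: "?c 0 = 0" "?c (x + y) = ?c x + ?c y" "?c (r *\<^sub>R x) = r *\<^sub>R ?c x" for x y r
    by (simp_all add: linear_0[OF l] linear_add[OF l] linear_scale[OF l]
      zero_symmat.rep_eq plus_symmat.rep_eq scaleR_symmat.rep_eq)
  show ?thesis
    unfolding slice_subspace_def
  proof (intro subspaceI CollectI allI impI)
    fix x y r i j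
    assume x: "x \<in> {H. \<forall>i j. a i = a j \<longrightarrow> (i \<noteq> j \<longrightarrow> ?c H $ i $ j = 0) \<and> ?c H $ i $ i = ?c H $ j $ j}"
      and ij: "a i = a j"
    then have x: "(i \<noteq> j \<longrightarrow> ?c x $ i $ j = 0) \<and> ?c x $ i $ i = ?c x $ j $ j" by blast
    then show "(i \<noteq> j \<longrightarrow> ?c (r *\<^sub>R x) $ i $ j = 0) \<and> ?c (r *\<^sub>R x) $ i $ i = ?c (r *\<^sub>R x) $ j $ j"
      unfolding c by simp
    assume "y \<in> {H. \<forall>i j. a i = a j \<longrightarrow> (i \<noteq> j \<longrightarrow> ?c H $ i $ j = 0) \<and> ?c H $ i $ i = ?c H $ j $ j}"
    with ij have "(i \<noteq> j \<longrightarrow> ?c y $ i $ j = 0) \<and> ?c y $ i $ i = ?c y $ j $ j" by blast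
    with x show "(i \<noteq> j \<longrightarrow> ?c (x + y) $ i $ j = 0) \<and> ?c (x + y) $ i $ i = ?c (x + y) $ j $ j"
      unfolding c by simp
  qed (simp add: c)
qed

text \<open>Conjugation carries one subspace onto the other. Used in both directions, this makes the dimension of
\<open>Sym_kappa \<kappa>\<close> the same at all points.\<close>

lemma slice_subspace_transport:
  assumes Q: "orthogonal_matrix Q" and R: "orthogonal_matrix R" and ab: "\<And>i j. a i = a j \<longleftrightarrow> b i = b j"
  shows "dim (slice_subspace Q a) \<le> dim (slice_subspace R b)"
proof -
  let ?T = "conj_sym (Q ** transpose R)"
  have "slice_subspace Q a \<subseteq> ?T ` slice_subspace R b"
  proof
    fix H assume H: "H \<in> slice_subspace Q a"
    let ?H = "conj_sym (R ** transpose Q) H"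
    have "(Q ** transpose R) ** (R ** transpose Q) = mat 1"
      using Q R by (metis matrix_mul_assoc matrix_mul_rid orthogonal_matrix_def)
    then have "H = ?T ?H"
      by (simp only: conj_sym_mult conj_sym_1)
    moreover have "transpose R ** (R ** transpose Q) = transpose Q"
      using R by (metis matrix_mul_assoc matrix_mul_lid orthogonal_matrix_def)
    then have eq: "conj_sym (transpose R) ?H = conj_sym (transpose Q) H"
      by (simp only: conj_sym_mult)
    from H have "?H \<in> slice_subspace R b"
      unfolding slice_subspace_def mem_Collect_eq eq ab .
    ultimately show "H \<in> ?T ` slice_subspace R b" by blast
  qed
  then have "dim (slice_subspace Q a) \<le> dim (?T ` slice_subspace R b)"
    by (rule dim_subset)
  also have "\<dots> \<le> dim (slice_subspace R b)"
    using bounded_linear_conj_sym by (intro dim_image_le) (simp add: linear_conv_bounded_linear)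
  finally show ?thesis .
qed

locale diagonalised_point =
  fixes Q :: "real^'n^'n" and a :: "'n::finite \<Rightarrow> real" and p :: "'n symmat"
  assumes Q: "orthogonal_matrix Q" and p: "mat_of_sym p = Q ** diag a ** transpose Q"
begin

definition coords :: "'n symmat \<Rightarrow> real^'n^'n"
  where "coords H = mat_of_sym (conj_sym (transpose Q) H)"

definition rotation :: "'n symmat \<Rightarrow> real^'n^'n"
  where "rotation H = Q ** cayley (commutator_inverse a (coords H))"

text \<open>The inverse of the slice chart: the blocks of \<open>H\<close> are rotated by an amount given by the remaining entries.\<close>

definition param :: "'n symmat \<Rightarrow> 'n symmat"
  where "param H = symm (rotation H ** block_part a (coords H) ** transpose (rotation H))"

lemma bounded_linear_coords: "bounded_linear coords"
  unfolding coords_def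
  by (rule bounded_linear_compose[OF bounded_linear_mat_of_sym bounded_linear_conj_sym])

lemma transpose_coords: "transpose (coords H) = coords H"
  by (simp add: coords_def transpose_mat_of_sym)

lemma coords_inverse: "Q ** coords H ** transpose Q = mat_of_sym H"
  unfolding coords_def mat_of_conj_sym[of Q, symmetric] conj_sym_transpose_cancel(1)[OF Q] ..

lemma coords_at_p: "coords p = diag a"
  unfolding coords_def mat_of_conj_sym p transpose_transpose by (rule orthogonal_conj_cancel[OF Q])

lemma bounded_linear_generator: "bounded_linear (\<lambda>H. commutator_inverse a (coords H))"
  by (rule bounded_linear_compose[OF bounded_linear_commutator_inverse bounded_linear_coords])

lemma bounded_linear_blocks: "bounded_linear (\<lambda>H. block_part a (coords H))"
  by (rule bounded_linear_compose[OF bounded_linear_block_part bounded_linear_coords])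

lemma transpose_generator: "transpose (commutator_inverse a (coords H)) = - commutator_inverse a (coords H)"
  by (rule transpose_commutator_inverse[OF transpose_coords])

lemma generator_at_p: "commutator_inverse a (coords p) = 0"
  by (simp add: coords_at_p commutator_inverse_def vec_eq_iff)

lemma blocks_at_p: "block_part a (coords p) = diag a"
  by (simp add: coords_at_p block_part_def vec_eq_iff)

lemma orthogonal_rotation: "orthogonal_matrix (rotation H)"
  unfolding rotation_def by (intro orthogonal_matrix_mul Q orthogonal_cayley transpose_generator)

lemma mat_of_param:
  "mat_of_sym (param H) = rotation H ** block_part a (coords H) ** transpose (rotation H)"
  unfolding param_def
  by (rule mat_of_sym_symm_symmetric)
    (simp add: matrix_transpose_mul transpose_block_part transpose_coords matrix_mul_assoc)

lemma rotation_at_p: "rotation p = Q"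
  unfolding rotation_def generator_at_p cayley_def cayley_inv_0 by (simp add: scaleR_2)

lemma param_at_p: "param p = p"
  by (simp add: mat_of_sym_inject[symmetric] mat_of_param rotation_at_p blocks_at_p p)

text \<open>All ingredients are linear or bilinear, except the inverse matrix in the Cayley transform.\<close>

lemma smooth_on_param: "smooth_on UNIV param"
proof (rule smooth_onI)
  fix k
  note mult = Ck_on_bilinear[OF bounded_bilinear_matrix_mult open_UNIV]
  have "Ck_on k UNIV (\<lambda>H. 2 *\<^sub>R cayley_inv (commutator_inverse a (coords H)) + (- mat 1))"
    by (intro Ck_on_add Ck_on_const Ck_on_linear_compose[OF bounded_linear_scaleR_right]
        Ck_on_cayley_inv bounded_linear_generator transpose_generator open_UNIV)
  then have rot: "Ck_on k UNIV rotation"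
    unfolding rotation_def cayley_def by (intro mult Ck_on_const) (simp_all add: open_UNIV)
  show "Ck_on k UNIV param"
    unfolding param_def
    by (intro Ck_on_linear_compose[OF bounded_linear_symm] mult rot open_UNIV
        Ck_on_linear_compose[OF bounded_linear_transpose] Ck_on_bounded_linear[OF bounded_linear_blocks])
qed

text \<open>At \<open>p\<close> the rotated blocks form \<open>diag a\<close> and the rotation is trivial. To first order, moving the rotation adds
the commutator of \<open>S\<close> and \<open>diag a\<close>, which gives back the entries outside the blocks, and moving the blocks
adds the entries inside them.\<close>

lemma has_derivative_param: "(param has_derivative (\<lambda>h. h)) (at p)"
proof -
  let ?S = "\<lambda>H. commutator_inverse a (coords H)" and ?D = "\<lambda>H. block_part a (coords H)"
  note mult = bounded_bilinear.FDERIV[OF bounded_bilinear_matrix_mult]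
  have "(rotation has_derivative (\<lambda>h. Q ** ?S h + 0 ** cayley (?S p))) (at p)"
    unfolding rotation_def
    by (intro mult has_derivative_const has_derivative_cayley[OF bounded_linear_generator transpose_generator generator_at_p])
  then have R: "(rotation has_derivative (\<lambda>h. Q ** ?S h)) (at p)"
    by (simp add: bounded_bilinear.zero_left[OF bounded_bilinear_matrix_mult])
  have D: "(?D has_derivative ?D) (at p)"
    by (rule bounded_linear_imp_has_derivative[OF bounded_linear_blocks])
  have "(param has_derivative (\<lambda>h. symm (rotation p ** ?D p ** transpose (Q ** ?S h) +
      (rotation p ** ?D h + Q ** ?S h ** ?D p) ** transpose (rotation p)))) (at p)"
    unfolding param_def
    by (intro bounded_linear.has_derivative[OF bounded_linear_symm] mult R D
        bounded_linear.has_derivative[OF bounded_linear_transpose])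
  moreover have "symm (rotation p ** ?D p ** transpose (Q ** ?S h) +
      (rotation p ** ?D h + Q ** ?S h ** ?D p) ** transpose (rotation p)) = h" for h
  proof -
    have "rotation p ** ?D p ** transpose (Q ** ?S h) +
        (rotation p ** ?D h + Q ** ?S h ** ?D p) ** transpose (rotation p)
      = Q ** (?S h ** diag a - diag a ** ?S h + ?D h) ** transpose Q"
    proof -
      have "A ** (- B) = - (A ** B)" for A B :: "real^'n^'n"
        by (simp add: vec_eq_iff matrix_matrix_mult_def sum_negf)
      moreover have "(- B) ** A = - (B ** A)" for A B :: "real^'n^'n"
        by (simp add: vec_eq_iff matrix_matrix_mult_def sum_negf)
      ultimately show ?thesis
        by (simp add: rotation_at_p blocks_at_p matrix_transpose_mul transpose_generator matrix_add_ldistrib matrix_add_rdistrib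
            matrix_diff_ldistrib matrix_diff_rdistrib matrix_mul_assoc)
    qed
    also have "\<dots> = mat_of_sym h"
      by (simp only: commutator_commutator_inverse coords_inverse)
    finally show ?thesis by (simp add: symm_mat_of_sym)
  qed
  ultimately show ?thesis by simp
qed

definition near :: "real \<Rightarrow> 'n symmat set"
  where "near \<delta> = {H. \<forall>i. (\<Sum>j\<in>UNIV. \<bar>block_part a (coords H) $ i $ j - diag a $ i $ j\<bar>) < \<delta>}"

lemma open_near: "open (near \<delta>)"
proof -
  have "near \<delta> = (\<Inter>i\<in>UNIV. {H. (\<Sum>j\<in>UNIV. \<bar>block_part a (coords H) $ i $ j - diag a $ i $ j\<bar>) < \<delta>})"
    by (auto simp: near_def)
  moreover have "continuous_on UNIV (\<lambda>H. (\<Sum>j\<in>UNIV. \<bar>block_part a (coords H) $ i $ j - diag a $ i $ j\<bar>))" for i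
    using linear_continuous_on[OF bounded_linear_blocks] by (intro continuous_intros)
  ultimately show ?thesis
    by (auto intro!: open_INT open_Collect_less continuous_on_const)
qed

lemma near_at_p: "\<delta> > 0 \<Longrightarrow> p \<in> near \<delta>"
  by (simp add: near_def blocks_at_p)

lemma slice_subspace_iff:
  "H \<in> slice_subspace Q a \<longleftrightarrow> (\<forall>i j. a i = a j \<longrightarrow>
    (i \<noteq> j \<longrightarrow> coords H $ i $ j = 0) \<and> coords H $ i $ i = coords H $ j $ j)"
  unfolding slice_subspace_def coords_def mem_Collect_eq ..

text \<open>The matrix \<open>param H\<close> is orthogonally conjugate to the block matrix of \<open>H\<close>. If the blocks are scalar then,
being close to distinct values of \<open>a\<close>, they reproduce the pattern of coincidences of \<open>a\<close>. Conversely,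
membership in \<open>Sym_kappa \<kappa>\<close> gives the block matrix as many distinct eigenvalues as \<open>p\<close> has, too few for a
block that is not scalar.\<close>

lemma param_mem_iff:
  assumes gap: "\<And>i j. a i \<noteq> a j \<Longrightarrow> 2 * \<delta> \<le> \<bar>a i - a j\<bar>"
    and pX: "p \<in> Sym_kappa \<kappa>" and H: "H \<in> near \<delta>"
  shows "param H \<in> Sym_kappa \<kappa> \<longleftrightarrow> H \<in> slice_subspace Q a"
proof
  have nearD: "(\<Sum>j\<in>UNIV. \<bar>block_part a (coords H) $ i $ j - diag a $ i $ j\<bar>) < \<delta>" for i
    using H by (simp add: near_def)
  {
    assume X: "param H \<in> Sym_kappa \<kappa>"
    obtain R b where R: "orthogonal_matrix R" "block_part a (coords H) = R ** diag b ** transpose R"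
      by (rule symmetric_diagonalisation[OF transpose_block_part[OF transpose_coords]])
    have "mat_of_sym (param H) = (rotation H ** R) ** diag b ** transpose (rotation H ** R)"
      by (simp add: mat_of_param R(2) matrix_transpose_mul matrix_mul_assoc)
    from Sym_kappa_number_of_multiplicity_eq[OF Q p pX orthogonal_matrix_mul[OF orthogonal_rotation R(1)] this X]
    obtain \<pi> where \<pi>: "bij \<pi>" "\<And>i j. a i = a j \<longleftrightarrow> b (\<pi> i) = b (\<pi> j)"
      using number_of_multiplicity_eqE by blast
    have "card (range b) = card (range a)"
    proof -
      have "range b = (\<lambda>i. b (\<pi> i)) ` UNIV"
        using bij_is_surj[OF \<pi>(1)] by (metis image_image)
      moreover have "card (range (\<lambda>i. b (\<pi> i))) = card (range a)"
      proof (rule bij_betw_same_card[symmetric])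
        have "b (\<pi> (SOME k. a k = a i)) = b (\<pi> i)" for i
          using \<pi>(2) someI[of "\<lambda>k. a k = a i" i] by blast
        then show "bij_betw (\<lambda>l. b (\<pi> (SOME k. a k = l))) (range a) (range (\<lambda>i. b (\<pi> i)))"
          using \<pi>(2) by (auto simp: bij_betw_def inj_on_def image_image)
      qed
      ultimately show ?thesis by simp
    qed
    then obtain \<beta> where \<beta>: "\<And>i j. a i = a j \<Longrightarrow> block_part a (coords H) $ i $ j = (if i = j then \<beta> (a i) else 0)"
      using block_diagonal_scalar_if_few_eigenvalues[OF _ nearD gap R] by (auto simp: block_part_def)
    have "coords H $ i $ j = (if i = j then \<beta> (a i) else 0)" if "a i = a j" for i j
      using \<beta>[OF that] that by (simp add: block_part_def)
    then show "H \<in> slice_subspace Q a"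
      by (simp add: slice_subspace_iff)
  }
  assume W: "H \<in> slice_subspace Q a"
  have W1: "coords H $ i $ j = 0" if "a i = a j" "i \<noteq> j" for i j
    using W that unfolding slice_subspace_iff by blast
  have W2: "coords H $ i $ i = coords H $ j $ j" if "a i = a j" for i j
    using W that unfolding slice_subspace_iff by blast
  define b where "b i = coords H $ i $ i" for i
  have D: "block_part a (coords H) = diag b"
    using W1 by (simp add: block_part_def vec_eq_iff b_def)
  have close: "\<bar>b i - a i\<bar> < \<delta>" for i
    using member_le_sum[of i UNIV "\<lambda>j. \<bar>block_part a (coords H) $ i $ j - diag a $ i $ j\<bar>"] nearD[of i]
    by (simp add: D)
  have "a i = a j \<longleftrightarrow> b i = b j" for i j
  proof
    show "b i = b j" if "a i = a j" unfolding b_def by (rule W2[OF that])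
    show "a i = a j" if "b i = b j"
      using gap[of i j] close[of i] close[of j] that by (cases "a i = a j") auto
  qed
  then have "number_of_multiplicity b = number_of_multiplicity a"
    by (rule number_of_multiplicity_same_pattern)
  then show "param H \<in> Sym_kappa \<kappa>"
    using pX Sym_kappa_iff[OF Q p]
      Sym_kappa_iff[OF orthogonal_rotation mat_of_param[of H, unfolded D]] by simp
qed

lemma spectral_gap_exists: "\<exists>\<delta>>0. \<forall>i j. a i \<noteq> a j \<longrightarrow> 2 * \<delta> \<le> \<bar>a i - a j\<bar>"
proof -
  \<comment> \<open>The element 1 only makes the set nonempty when all values of \<open>a\<close> coincide.\<close>
  define G where "G = insert 1 ((\<lambda>(i, j). \<bar>a i - a j\<bar> / 2) ` {(i, j). a i \<noteq> a j})"
  have G: "finite G" "G \<noteq> {}" "\<And>x. x \<in> G \<Longrightarrow> x > 0"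
    by (auto simp: G_def intro: finite_subset[of _ UNIV])
  have "Min G > 0" using G by simp
  moreover have "2 * Min G \<le> \<bar>a i - a j\<bar>" if "a i \<noteq> a j" for i j
  proof -
    have "\<bar>a i - a j\<bar> / 2 \<in> G" using that by (force simp: G_def)
    then have "Min G \<le> \<bar>a i - a j\<bar> / 2" by (rule Min_le[OF G(1)])
    then show ?thesis by simp
  qed
  ultimately show ?thesis by blast
qed

lemma slice_chart_at_point:
  assumes pX: "p \<in> Sym_kappa \<kappa>"
  shows "\<exists>U \<phi> \<psi>. open U \<and> p \<in> U \<and> open (\<phi> ` U) \<and> smooth_on U \<phi> \<and> smooth_on (\<phi> ` U) \<psi> \<and>
    (\<forall>x\<in>U. \<psi> (\<phi> x) = x) \<and> \<phi> ` (U \<inter> Sym_kappa \<kappa>) = \<phi> ` U \<inter> slice_subspace Q a"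
proof -
  obtain \<delta> where \<delta>: "\<delta> > 0" "\<And>i j. a i \<noteq> a j \<Longrightarrow> 2 * \<delta> \<le> \<bar>a i - a j\<bar>"
    using spectral_gap_exists by blast
  have "frechet_derivative param (at p) = (\<lambda>h. h)"
    using frechet_derivative_at[OF has_derivative_param] by simp
  then have "inj (frechet_derivative param (at p))" by simp
  from smooth_local_inverse[OF open_near smooth_on_subset[OF smooth_on_param subset_UNIV] near_at_p[OF \<delta>(1)] this]
  obtain U' g where U': "open U'" "U' \<subseteq> near \<delta>" "p \<in> U'" "open (param ` U')" "smooth_on (param ` U') g"
    "\<And>x. x \<in> U' \<Longrightarrow> g (param x) = x"
    by blast
  have gU: "g ` param ` U' = U'" using U'(6) by (auto simp: image_iff)
  have "g ` (param ` U' \<inter> Sym_kappa \<kappa>) = U' \<inter> slice_subspace Q a"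
  proof (intro set_eqI iffI)
    fix x assume "x \<in> g ` (param ` U' \<inter> Sym_kappa \<kappa>)"
    then obtain y where y: "y \<in> U'" "param y \<in> Sym_kappa \<kappa>" "x = g (param y)" by blast
    then have "x = y" using U'(6) by simp
    then show "x \<in> U' \<inter> slice_subspace Q a"
      using y U'(2) param_mem_iff[OF \<delta>(2) pX, of y] by blast
  next
    fix x assume x: "x \<in> U' \<inter> slice_subspace Q a"
    then have "param x \<in> param ` U' \<inter> Sym_kappa \<kappa>"
      using U'(2) param_mem_iff[OF \<delta>(2) pX, of x] by blast
    moreover have "x = g (param x)" using x U'(6) by simp
    ultimately show "x \<in> g ` (param ` U' \<inter> Sym_kappa \<kappa>)" by (rule rev_image_eqI)
  qed
  then show ?thesis
    using U' gU param_at_p smooth_on_subset[OF smooth_on_param subset_UNIV]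
    by (intro exI[of _ "param ` U'"] exI[of _ g] exI[of _ param]) (auto intro: rev_image_eqI)
qed

text \<open>Invariance under sign changes makes \<open>v\<close> diagonal in the basis given by \<open>Q\<close>, and invariance under
transpositions of indices with equal eigenvalues makes its diagonal entries constant on each block. The
line through \<open>p\<close> in the direction \<open>v\<close> then stays in \<open>Sym_kappa \<kappa>\<close> for a short time.\<close>

lemma tangent_if_fixed_by_stabiliser:
  assumes pX: "p \<in> Sym_kappa \<kappa>"
    and fixed: "\<And>g. orthogonal_transformation g \<Longrightarrow> g ` Sym_kappa \<kappa> = Sym_kappa \<kappa> \<Longrightarrow> g p = p \<Longrightarrow> g v = v"
  shows "v \<in> tangent_space (Sym_kappa \<kappa>) p"
proof -
  have monomial: "s i * s j * coords v $ \<sigma> i $ \<sigma> j = coords v $ i $ j"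
    if \<sigma>: "inj \<sigma>" "a \<circ> \<sigma> = a" and s: "\<And>i. s i * s i = 1" for s \<sigma> i j
  proof -
    define P where "P = monomial_matrix s \<sigma>"
    \<comment> \<open>The transformation that is \<open>P\<close> in the basis given by \<open>Q\<close>.\<close>
    define K where "K = Q ** P ** transpose Q"
    have P: "orthogonal_matrix P" unfolding P_def by (rule orthogonal_monomial_matrix[OF \<sigma>(1) s])
    have K: "orthogonal_matrix K" unfolding K_def using P Q by (intro orthogonal_matrix_mul) auto
    have conj: "K ** (Q ** M ** transpose Q) ** transpose K = Q ** (P ** M ** transpose P) ** transpose Q" for M
      using Q by (simp add: K_def matrix_transpose_mul orthogonal_matrix_def matrix_mul_assoc)
        (metis matrix_mul_assoc matrix_mul_lid)
    have "conj_sym K p = p"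
      by (simp add: mat_of_sym_inject[symmetric] mat_of_conj_sym p conj)
        (simp add: P_def monomial_conj_diag[OF \<sigma>(1) s] \<sigma>(2))
    then have "conj_sym K v = v"
      by (intro fixed orthogonal_transformation_conj_sym conj_sym_image_Sym_kappa K)
    then have "Q ** (P ** coords v ** transpose P) ** transpose Q = Q ** coords v ** transpose Q"
      by (metis conj coords_inverse mat_of_conj_sym)
    then have "P ** coords v ** transpose P = coords v"
      using orthogonal_conj_cancel[OF Q] by metis
    then show ?thesis
      unfolding P_def using monomial_conj_nth[of s \<sigma> "coords v" i j] by simp
  qed
  have offdiag: "coords v $ i $ j = 0" if "i \<noteq> j" for i j
    using monomial[of id "\<lambda>k. if k = i then -1 else 1" i j] that by simp
  have equal: "coords v $ i $ i = coords v $ j $ j" if "a i = a j" for i j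
    using monomial[of "Transposition.transpose i j" "\<lambda>k. 1" i i] that
    by (auto simp: Transposition.transpose_def fun_eq_iff)
  define w where "w i = coords v $ i $ i" for i
  have v: "mat_of_sym v = Q ** diag w ** transpose Q"
  proof -
    have "coords v = diag w" using offdiag by (auto simp: vec_eq_iff w_def)
    then show ?thesis using coords_inverse by metis
  qed
  \<comment> \<open>The parameters at which distinct eigenvalues of \<open>p\<close> remain distinct along the line in the direction \<open>v\<close>.\<close>
  define T where "T = (\<Inter>i\<in>UNIV. \<Inter>j\<in>UNIV. {t::real. a i \<noteq> a j \<longrightarrow> a i + t * w i \<noteq> a j + t * w j})"
  have "open {t::real. a i \<noteq> a j \<longrightarrow> a i + t * w i \<noteq> a j + t * w j}" for i j
    by (cases "a i = a j") (auto intro!: open_Collect_neq continuous_intros)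
  then have "open T" unfolding T_def by (intro open_INT) auto
  moreover have "0 \<in> T" by (auto simp: T_def)
  ultimately obtain e where e: "e > 0" "ball 0 e \<subseteq> T" using openE by blast
  let ?c = "\<lambda>t::real. p + t *\<^sub>R v"
  have "?c t \<in> Sym_kappa \<kappa>" if "t \<in> {-e<..<e}" for t
  proof -
    have t: "t \<in> T" using e(2) that by (auto simp: dist_real_def subset_iff)
    have m: "mat_of_sym (?c t) = Q ** diag (\<lambda>i. a i + t * w i) ** transpose Q"
    proof -
      have "diag (\<lambda>i. a i + t * w i) = diag a + t *\<^sub>R diag w" by (simp add: vec_eq_iff)
      then show ?thesis
        by (simp add: plus_symmat.rep_eq scaleR_symmat.rep_eq p v matrix_add_ldistrib matrix_add_rdistrib
            matrix_scalar_ac scalar_matrix_assoc)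
    qed
    have "a i = a j \<longleftrightarrow> a i + t * w i = a j + t * w j" for i j
      using t equal[of i j] by (auto simp: T_def w_def)
    then have n: "number_of_multiplicity (\<lambda>i. a i + t * w i) = number_of_multiplicity a"
      by (rule number_of_multiplicity_same_pattern)
    show ?thesis
      using pX unfolding Sym_kappa_iff[OF Q m]
        Sym_kappa_iff[OF Q p] n .
  qed
  moreover have "smooth_on {-e<..<e} ?c"
    by (intro smooth_onI Ck_on_add Ck_on_const Ck_on_bounded_linear bounded_linear_scaleR_left) auto
  moreover have "vector_derivative ?c (at 0) = v"
    by (intro vector_derivative_at) (auto intro!: derivative_eq_intros)
  ultimately show ?thesis
    using e(1) unfolding tangent_space_def by (intro CollectI exI[of _ e] conjI exI[of _ ?c]) auto
qed

end

section \<open>Matrices with prescribed multiplicities form a minimal submanifold\<close>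

text \<open>The permutation that matches the multiplicities of two lists of eigenvalues can be absorbed into the
orthogonal matrix.\<close>

lemma diagonalisation_with_pattern:
  assumes "orthogonal_matrix Q" "mat_of_sym A = Q ** diag a ** transpose Q" "A \<in> Sym_kappa \<kappa>" "B \<in> Sym_kappa \<kappa>"
  obtains R b where "orthogonal_matrix R" "mat_of_sym B = R ** diag b ** transpose R" "\<And>i j. a i = a j \<longleftrightarrow> b i = b j"
proof -
  obtain R b where R: "orthogonal_matrix R" "mat_of_sym B = R ** diag b ** transpose R"
    by (rule symmat_diagonalisation)
  obtain \<pi> where \<pi>: "bij \<pi>" "\<And>i j. a i = a j \<longleftrightarrow> b (\<pi> i) = b (\<pi> j)"
    using number_of_multiplicity_eqE[OF Sym_kappa_number_of_multiplicity_eq[OF assms(1-3) R assms(4)]] by blast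
  define P where "P = monomial_matrix (\<lambda>_. 1) \<pi>"
  have P: "orthogonal_matrix P"
    unfolding P_def using \<pi>(1) by (intro orthogonal_monomial_matrix) (auto simp: bij_is_inj)
  have "P ** diag b ** transpose P = diag (b \<circ> \<pi>)"
    unfolding P_def using \<pi>(1) by (intro monomial_conj_diag) (auto simp: bij_is_inj)
  then have "transpose P ** diag (b \<circ> \<pi>) ** P = diag b"
    using orthogonal_conj_cancel[OF P] by metis
  then have "mat_of_sym B = (R ** transpose P) ** diag (b \<circ> \<pi>) ** transpose (R ** transpose P)"
    by (simp add: R(2) matrix_transpose_mul matrix_mul_assoc) (metis matrix_mul_assoc)
  then show ?thesis
    using P R(1) \<pi>(2) by (intro that[of "R ** transpose P" "b \<circ> \<pi>"]) (auto intro!: orthogonal_matrix_mul)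
qed

theorem embedded_submanifold_Sym_kappa: "\<exists>k. embedded_submanifold k (Sym_kappa \<kappa> :: 'n::finite symmat set)"
proof (cases "(Sym_kappa \<kappa> :: 'n symmat set) = {}")
  case False
  then obtain A :: "'n symmat" where A: "A \<in> Sym_kappa \<kappa>" by blast
  obtain Q a where Q: "orthogonal_matrix Q" "mat_of_sym A = Q ** diag a ** transpose Q"
    by (rule symmat_diagonalisation)
  have "embedded_submanifold (dim (slice_subspace Q a)) (Sym_kappa \<kappa> :: 'n symmat set)"
    unfolding embedded_submanifold_def
  proof
    fix B :: "'n symmat" assume B: "B \<in> Sym_kappa \<kappa>"
    obtain R b where R: "orthogonal_matrix R" "mat_of_sym B = R ** diag b ** transpose R"
      and ab: "\<And>i j. a i = a j \<longleftrightarrow> b i = b j"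
      using diagonalisation_with_pattern[OF Q A B] by metis
    have dim: "dim (slice_subspace R b) = dim (slice_subspace Q a)"
      using slice_subspace_transport[OF Q(1) R(1) ab] slice_subspace_transport[OF R(1) Q(1), of b a] ab
      by (simp add: order_antisym)
    interpret diagonalised_point R b B using R by unfold_locales
    show "\<exists>U \<phi> \<psi> W. open U \<and> B \<in> U \<and> open (\<phi> ` U) \<and> smooth_on U \<phi> \<and> smooth_on (\<phi> ` U) \<psi> \<and>
        (\<forall>x\<in>U. \<psi> (\<phi> x) = x) \<and> subspace (W :: 'n symmat set) \<and> dim W = dim (slice_subspace Q a) \<and>
        \<phi> ` (U \<inter> Sym_kappa \<kappa>) = \<phi> ` U \<inter> W"
      using dim slice_chart_at_point[OF B] subspace_slice_subspace[of R b] by blast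
  qed
  then show ?thesis by blast
qed (simp add: embedded_submanifold_def)

theorem minimal_submanifold_Sym_kappa: "minimal_submanifold (Sym_kappa \<kappa> :: 'n::finite symmat set)"
proof -
  obtain k where k: "embedded_submanifold k (Sym_kappa \<kappa> :: 'n symmat set)"
    using embedded_submanifold_Sym_kappa by blast
  have "mean_curvature (Sym_kappa \<kappa>) A = 0" if A: "A \<in> Sym_kappa \<kappa>" for A :: "'n symmat"
  proof -
    obtain Q a where Q: "orthogonal_matrix Q" "mat_of_sym A = Q ** diag a ** transpose Q"
      by (rule symmat_diagonalisation)
    interpret diagonalised_point Q a A using Q by unfold_locales
    show ?thesis
      by (rule mean_curvature_zero_if_fixed_vectors_tangent[OF k A]) (rule tangent_if_fixed_by_stabiliser[OF A])
  qed
  with k show ?thesis by (auto simp: minimal_submanifold_def)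
qed

theorem theorem1p6:
  fixes \<kappa> :: "nat \<Rightarrow> nat"
  assumes "(\<lambda>i. Suc i * \<kappa> (Suc i)) sums CARD('n::finite)"
  shows "semialgebraic (Sym_kappa \<kappa> :: 'n symmat set) \<and>
         minimal_submanifold (Sym_kappa \<kappa> :: 'n symmat set)"
  using semialgebraic_Sym_kappa minimal_submanifold_Sym_kappa by blast

end
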